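(* Consider the mixed problem: find $(\phi,\theta)\in\mathcal V$ and $\lambda=(\lambda_1,\lambda_2)\in Q$ such that $$a(\phi,\theta;\psi,\delta)+b(\psi,\delta;\lambda_1,\lambda_2)=f(\psi,\delta),\qquad b(\phi,\theta;\Gamma_1,\Gamma_2)=0$$ for all $(\psi,\delta)\in\mathcal V$ and all $(\Gamma_1,\Gamma_2)\in Q$. This problem is well-posed: for every pair of data $(f,r)$ as in the context there is exactly one solution $((\phi,\theta),\lambda)\in\mathcal V\times Q$, and there is a constant $C>0$, independent of the data, such that $\|(\phi,\theta)\|_{\mathcal V}+\|\lambda\|_Q\le C\,\|f(\cdot)\|_{\mathcal V'}$, where $f(\cdot)\in\mathcal V'$ denotes the linear form defined by the data.
   Context: Let $\Omega\subset\mathbb R^d$, $d=2$, be a bounded open set with characteristic length $\ell>0$ (for example its diameter), and let $L>0$. Let $B_1,B_2\subsetneq\Omega$ be disjoint measurable subsets with measures $|B_1|,|B_2|>0$. Let $\kappa>0$ and $\bar\kappa>0$ be constants. Spaces and norms: $\mathcal U=H^1_0(\Omega)$ with $\|\phi\|_{\mathcal U}=(\|\phi\|_{L^2(\Omega)}^2+\ell^2\|\nabla\phi\|_{L^2(\Omega)}^2)^{1/2}$; $\mathcal W=H^1(0,L)$ with $\|\theta\|_{\mathcal W}=(\|\theta\|_{L^2(0,L)}^2+L^2\|\theta'\|_{L^2(0,L)}^2)^{1/2}$; $\mathcal V=\mathcal U\times\mathcal W$ with $\|(\phi,\theta)\|_{\mathcal V}=(\|\phi\|_{\mathcal U}^2+\ell^{d-1}\|\theta\|_{\mathcal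 W}^2)^{1/2}$; $Q=\mathbb R^2$ with the Euclidean norm $\|\cdot\|_Q$. Values $\theta(0),\theta(L)$ are those of the continuous representative of $\theta$. Forms: $a(\phi,\theta;\psi,\delta)=\int_\Omega\kappa\,\nabla\phi\cdot\nabla\psi\,dV+\int_0^L\bar\kappa\,\theta'\delta'\,dx$ on $\mathcal V\times\mathcal V$, and $$b(\phi,\theta;\Gamma_1,\Gamma_2)=\Gamma_1\Big(\theta(0)-\frac1{|B_1|}\int_{B_1}\phi\,dV\Big)+\Gamma_2\Big(\theta(L)-\frac1{|B_2|}\int_{B_2}\phi\,dV\Big)$$ on $\mathcal V\times Q$. Data: $f\in H^{-1}(\Omega)$ and a function $r$ on $(0,L)$ such that $f_L(\delta)=\int_0^L r\,\delta\,dx$ is a continuous linear form on $\mathcal W$. The linear form on $\mathcal V$ is $f(\psi,\delta)=f_\Omega(\psi)+f_L(\delta)$, with $f_\Omega(\psi)=\int_\Omega f\psi$ understood as the duality pairing between $H^{-1}(\Omega)$ and $H_0^1(\Omega)$. *)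

theory Defs
  imports "HOL-Analysis.Analysis"
begin

text \<open>
  Elements of Lebesgue and Sobolev spaces over \<open>S\<close> are represented by functions on the whole
  type; only their values almost everywhere in \<open>S\<close> matter, and two representatives denote
  the same element iff they satisfy \<open>ae_eq S\<close>.
\<close>

definition ae_eq :: "'a::euclidean_space set \<Rightarrow> ('a \<Rightarrow> 'b) \<Rightarrow> ('a \<Rightarrow> 'b) \<Rightarrow> bool" where
  "ae_eq S u v \<longleftrightarrow> (AE x in lebesgue_on S. u x = v x)"

definition L2 :: "'a::euclidean_space set \<Rightarrow> ('a \<Rightarrow> 'b::euclidean_space) set" where
  "L2 S = {u. u \<in> borel_measurable (lebesgue_on S) \<and>
              integrable (lebesgue_on S) (\<lambda>x. (norm (u x))\<^sup>2)}"

definition L2_norm :: "'a::euclidean_space set \<Rightarrow> ('a \<Rightarrow> 'b::euclidean_space) \<Rightarrow> real" where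
  "L2_norm S u = sqrt (\<integral>x. (norm (u x))\<^sup>2 \<partial>(lebesgue_on S))"

primrec C_k :: "nat \<Rightarrow> ('a::euclidean_space \<Rightarrow> real) \<Rightarrow> bool" where
  "C_k 0 f \<longleftrightarrow> continuous_on UNIV f"
| "C_k (Suc k) f \<longleftrightarrow> (\<forall>x. f differentiable (at x)) \<and>
     (\<forall>i\<in>Basis. C_k k (\<lambda>x. frechet_derivative f (at x) i))"

definition test_functions :: "'a::euclidean_space set \<Rightarrow> ('a \<Rightarrow> real) set" where
  "test_functions S = {\<eta>. (\<forall>k. C_k k \<eta>) \<and>
     compact (closure {x. \<eta> x \<noteq> 0}) \<and> closure {x. \<eta> x \<noteq> 0} \<subseteq> S}"

definition has_weak_gradient ::
    "'a::euclidean_space set \<Rightarrow> ('a \<Rightarrow> real) \<Rightarrow> ('a \<Rightarrow> 'a) \<Rightarrow> bool" where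
  "has_weak_gradient S u g \<longleftrightarrow>
     (\<forall>\<eta>\<in>test_functions S. \<forall>i\<in>Basis.
        (\<integral>x. u x * frechet_derivative \<eta> (at x) i \<partial>(lebesgue_on S)) =
        - (\<integral>x. (g x \<bullet> i) * \<eta> x \<partial>(lebesgue_on S)))"

definition H1 :: "'a::euclidean_space set \<Rightarrow> ('a \<Rightarrow> real) set" where
  "H1 S = {u. u \<in> L2 S \<and> (\<exists>g. g \<in> L2 S \<and> has_weak_gradient S u g)}"

text \<open>
  The weak gradient is determined up to null sets, so the choice below is immaterial under
  integrals.  For intervals in \<open>real\<close> it is the ordinary weak derivative.
\<close>

definition wgrad :: "'a::euclidean_space set \<Rightarrow> ('a \<Rightarrow> real) \<Rightarrow> 'a \<Rightarrow> 'a" where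
  "wgrad S u = (SOME g. g \<in> L2 S \<and> has_weak_gradient S u g)"

definition H1_norm :: "real \<Rightarrow> 'a::euclidean_space set \<Rightarrow> ('a \<Rightarrow> real) \<Rightarrow> real" where
  "H1_norm l S u = sqrt ((L2_norm S u)\<^sup>2 + l\<^sup>2 * (L2_norm S (wgrad S u))\<^sup>2)"

definition H10 :: "'a::euclidean_space set \<Rightarrow> ('a \<Rightarrow> real) set" where
  "H10 S = {u. u \<in> H1 S \<and>
     (\<forall>e>0. \<exists>\<eta>\<in>test_functions S. H1_norm 1 S (\<lambda>x. u x - \<eta> x) < e)}"

text \<open>
  Functionals act on representatives; being linear and bounded they cannot distinguish
  representatives of the same element.
\<close>

definition H_minus1 :: "'a::euclidean_space set \<Rightarrow> (('a \<Rightarrow> real) \<Rightarrow> real) set" where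
  "H_minus1 S = {F.
     (\<forall>u\<in>H10 S. \<forall>v\<in>H10 S. F (\<lambda>x. u x + v x) = F u + F v) \<and>
     (\<forall>c. \<forall>u\<in>H10 S. F (\<lambda>x. c * u x) = c * F u) \<and>
     (\<exists>M. \<forall>u\<in>H10 S. \<bar>F u\<bar> \<le> M * H1_norm 1 S u)}"

text \<open>
  For \<open>\<theta> \<in> H1 {0<..<L}\<close> the function chosen here exists and is unique on the closed interval, so its
  values at \<open>0\<close> and \<open>L\<close> are the boundary values of \<open>\<theta>\<close>.
\<close>

definition cont_rep :: "real \<Rightarrow> (real \<Rightarrow> real) \<Rightarrow> real \<Rightarrow> real" where
  "cont_rep L \<theta> = (SOME h. continuous_on {0..L} h \<and> ae_eq {0<..<L} h \<theta>)"

abbreviation U_space :: "'a::euclidean_space set \<Rightarrow> ('a \<Rightarrow> real) set" where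
  "U_space \<Omega> \<equiv> H10 \<Omega>"

abbreviation W_space :: "real \<Rightarrow> (real \<Rightarrow> real) set" where
  "W_space L \<equiv> H1 {0<..<L}"

definition V_space :: "'a::euclidean_space set \<Rightarrow> real \<Rightarrow> (('a \<Rightarrow> real) \<times> (real \<Rightarrow> real)) set" where
  "V_space \<Omega> L = U_space \<Omega> \<times> W_space L"

definition V_norm ::
    "real \<Rightarrow> 'a::euclidean_space set \<Rightarrow> real \<Rightarrow> ('a \<Rightarrow> real) \<times> (real \<Rightarrow> real) \<Rightarrow> real" where
  "V_norm l \<Omega> L = (\<lambda>(\<phi>, \<theta>).
     sqrt ((H1_norm l \<Omega> \<phi>)\<^sup>2 + l ^ (DIM('a) - 1) * (H1_norm L {0<..<L} \<theta>)\<^sup>2))"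

definition V_dual_norm ::
    "real \<Rightarrow> 'a::euclidean_space set \<Rightarrow> real \<Rightarrow> (('a \<Rightarrow> real) \<times> (real \<Rightarrow> real) \<Rightarrow> real) \<Rightarrow> real" where
  "V_dual_norm l \<Omega> L F = Sup {\<bar>F v\<bar> | v. v \<in> V_space \<Omega> L \<and> V_norm l \<Omega> L v \<le> 1}"

definition form_a ::
    "real \<Rightarrow> real \<Rightarrow> 'a::euclidean_space set \<Rightarrow> real \<Rightarrow>
     ('a \<Rightarrow> real) \<times> (real \<Rightarrow> real) \<Rightarrow> ('a \<Rightarrow> real) \<times> (real \<Rightarrow> real) \<Rightarrow> real" where
  "form_a \<kappa> \<kappa>' \<Omega> L = (\<lambda>(\<phi>, \<theta>) (\<psi>, \<delta>).
     (\<integral>x. \<kappa> * (wgrad \<Omega> \<phi> x \<bullet> wgrad \<Omega> \<psi> x) \<partial>(lebesgue_on \<Omega>)) +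
     (\<integral>x. \<kappa>' * (wgrad {0<..<L} \<theta> x * wgrad {0<..<L} \<delta> x) \<partial>(lebesgue_on {0<..<L})))"

definition mean_over :: "'a::euclidean_space set \<Rightarrow> ('a \<Rightarrow> real) \<Rightarrow> real" where
  "mean_over B \<phi> = (1 / measure lebesgue B) * (\<integral>x. \<phi> x \<partial>(lebesgue_on B))"

definition form_b ::
    "'a::euclidean_space set \<Rightarrow> 'a set \<Rightarrow> real \<Rightarrow>
     ('a \<Rightarrow> real) \<times> (real \<Rightarrow> real) \<Rightarrow> real^2 \<Rightarrow> real" where
  "form_b B1 B2 L = (\<lambda>(\<phi>, \<theta>) \<Gamma>.
     \<Gamma> $ 1 * (cont_rep L \<theta> 0 - mean_over B1 \<phi>) +
     \<Gamma> $ 2 * (cont_rep L \<theta> L - mean_over B2 \<phi>))"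

definition form_L :: "real \<Rightarrow> (real \<Rightarrow> real) \<Rightarrow> (real \<Rightarrow> real) \<Rightarrow> real" where
  "form_L L r \<delta> = (\<integral>x. r x * \<delta> x \<partial>(lebesgue_on {0<..<L}))"

text \<open>
  Integrability is required explicitly because the Bochner integral of a non-integrable
  function is 0; it also yields linearity of \<open>form_L\<close>.
\<close>

definition admissible_r :: "real \<Rightarrow> (real \<Rightarrow> real) \<Rightarrow> bool" where
  "admissible_r L r \<longleftrightarrow>
     (\<forall>\<delta>\<in>W_space L. integrable (lebesgue_on {0<..<L}) (\<lambda>x. r x * \<delta> x)) \<and>
     (\<exists>M. \<forall>\<delta>\<in>W_space L. \<bar>form_L L r \<delta>\<bar> \<le> M * H1_norm L {0<..<L} \<delta>)"

definition form_f ::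
    "real \<Rightarrow> (('a::euclidean_space \<Rightarrow> real) \<Rightarrow> real) \<Rightarrow> (real \<Rightarrow> real) \<Rightarrow>
     ('a \<Rightarrow> real) \<times> (real \<Rightarrow> real) \<Rightarrow> real" where
  "form_f L f r = (\<lambda>(\<psi>, \<delta>). f \<psi> + form_L L r \<delta>)"

definition mixed_solution ::
    "real \<Rightarrow> real \<Rightarrow> 'a::euclidean_space set \<Rightarrow> real \<Rightarrow> 'a set \<Rightarrow> 'a set \<Rightarrow>
     (('a \<Rightarrow> real) \<Rightarrow> real) \<Rightarrow> (real \<Rightarrow> real) \<Rightarrow>
     ('a \<Rightarrow> real) \<times> (real \<Rightarrow> real) \<Rightarrow> real^2 \<Rightarrow> bool" where
  "mixed_solution \<kappa> \<kappa>' \<Omega> L B1 B2 f r u \<mu> \<longleftrightarrow>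
     u \<in> V_space \<Omega> L \<and>
     (\<forall>v\<in>V_space \<Omega> L. form_a \<kappa> \<kappa>' \<Omega> L u v + form_b B1 B2 L v \<mu> = form_f L f r v) \<and>
     (\<forall>\<Gamma>. form_b B1 B2 L u \<Gamma> = 0)"

end

theory Submission
  imports Defs
begin

text \<open>
  The constraints are lifted explicitly: the pairs \<open>(0, 1 - x/L)\<close> and \<open>(0, x/L)\<close> are dual to the two
  components of \<open>b\<close>.  Hence \<open>V\<close> splits as \<open>ker b\<close> plus a plane, the inf-sup condition is
  immediate, the field solves the variational problem on \<open>ker b\<close> alone, and the multipliers are the
  residuals at the two lifts.  On \<open>ker b\<close> the form \<open>a\<close> is coercive: the Poincare inequality bounds
  \<open>\<phi>\<close>, the first constraint then bounds \<open>\<theta>(0)\<close> by a mean of \<open>\<phi>\<close>, and \<open>\<theta>\<close> is controlled by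
  \<open>\<theta>(0)\<close> and \<open>\<theta>'\<close>.  Since \<open>a\<close> is symmetric, existence on \<open>ker b\<close> is Riesz representation, by
  minimising the energy over the complete space \<open>ker b\<close>.
\<close>

section \<open>Semi-inner products\<close>

text \<open>Energy alone does not see constants: \<open>(0, c)\<close> has zero energy, so
  \<open>a\<close> is not coercive on \<open>V\<close>, and it is the constraint at \<open>0\<close>
  that ties such constants to \<open>\<phi>\<close>, which the boundary condition already controls.
  Coercivity serves a second time in completeness: it turns energy-Cauchy sequences into Cauchy
  sequences in H1, and \<open>ker b\<close> is closed there because endpoint values and means are
  continuous. Endpoint values require a continuous representative; it is found by subtracting from
  \<open>\<theta>\<close> the indefinite integral of its weak derivative, since the remainder has
  weak derivative zero and is therefore constant. The gradient \<open>wgrad\<close> is a choice, so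
  it is linear only up to null sets; this rests on uniqueness of weak gradients, hence on the
  fundamental lemma, hence on a supply of smooth bumps. All constants come from the geometry,
  \<open>\<kappa>\<close> and \<open>\<kappa>'\<close>; the data enter only through the dual
  norm.\<close>

text \<open>
  Elements of Sobolev spaces are only representatives, so definiteness is not assumed.  The single
  operation \<open>comb c u v\<close> stands for \<open>u + c v\<close>.
\<close>

locale semi_inner =
  fixes K :: "'v set" and comb :: "real \<Rightarrow> 'v \<Rightarrow> 'v \<Rightarrow> 'v" and A :: "'v \<Rightarrow> 'v \<Rightarrow> real"
  assumes comb_closed: "u \<in> K \<Longrightarrow> v \<in> K \<Longrightarrow> comb c u v \<in> K"
    and sym: "u \<in> K \<Longrightarrow> v \<in> K \<Longrightarrow> A u v = A v u"
    and lin: "u \<in> K \<Longrightarrow> v \<in> K \<Longrightarrow> w \<in> K \<Longrightarrow> A (comb c u v) w = A u w + c * A v w"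
    and nonneg: "u \<in> K \<Longrightarrow> 0 \<le> A u u"
begin

definition nrm :: "'v \<Rightarrow> real" where "nrm u = sqrt (A u u)"

lemma nrm_nonneg [simp]: "u \<in> K \<Longrightarrow> 0 \<le> nrm u"
  by (simp add: nrm_def nonneg)

lemma nrm_sq: "u \<in> K \<Longrightarrow> (nrm u)\<^sup>2 = A u u"
  by (simp add: nrm_def nonneg)

lemma lin_right: "u \<in> K \<Longrightarrow> v \<in> K \<Longrightarrow> w \<in> K \<Longrightarrow> A w (comb c u v) = A w u + c * A w v"
  by (simp add: comb_closed lin sym[of w])

lemma expand:
  assumes "u \<in> K" "v \<in> K"
  shows "A (comb c u v) (comb c u v) = A u u + 2 * c * A u v + c\<^sup>2 * A v v"
  using assms by (simp add: lin lin_right comb_closed sym[of v u] algebra_simps power2_eq_square)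

text \<open>The quadratic in \<open>c\<close> given by \<open>expand\<close> is never negative.
  Without definiteness \<open>A v v\<close> may vanish for a nontrivial \<open>v\<close>, so that
  case is separate.\<close>

lemma cauchy_schwarz:
  assumes "u \<in> K" "v \<in> K"
  shows "\<bar>A u v\<bar> \<le> nrm u * nrm v"
proof -
  have q: "0 \<le> A u u + 2 * c * A u v + c\<^sup>2 * A v v" for c
    using expand[OF assms, of c] nonneg[OF comb_closed[OF assms, of c]] by simp
  have "(A u v)\<^sup>2 \<le> A u u * A v v"
  proof (cases "A v v = 0")
    case True
    have "A u v = 0"
    proof (rule ccontr)
      assume n: "A u v \<noteq> 0"
      \<comment> \<open>With \<open>A v v = 0\<close> the quadratic is affine in \<open>c\<close>;
        this \<open>c\<close> gives it the value -1.\<close>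
      have "0 \<le> A u u + 2 * (- (A u u + 1) / (2 * A u v)) * A u v"
        using q[of "- (A u u + 1) / (2 * A u v)"] True by simp
      then show False using n by (simp add: field_simps)
    qed
    then show ?thesis using True by simp
  next
    case False
    then have pos: "A v v > 0" using nonneg[OF assms(2)] by simp
    \<comment> \<open>The minimiser of the quadratic.\<close>
    have "0 \<le> A u u + 2 * (- A u v / A v v) * A u v + (- A u v / A v v)\<^sup>2 * A v v"
      by (rule q)
    then show ?thesis using pos by (simp add: field_simps power2_eq_square)
  qed
  then have "sqrt ((A u v)\<^sup>2) \<le> sqrt (A u u * A v v)" by (rule real_sqrt_le_mono)
  then show ?thesis by (simp add: nrm_def real_sqrt_mult)
qed

lemma nrm_comb_le:
  assumes "u \<in> K" "v \<in> K"
  shows "nrm (comb c u v) \<le> nrm u + \<bar>c\<bar> * nrm v"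
proof (rule power2_le_imp_le)
  have "c * A u v \<le> \<bar>c\<bar> * (nrm u * nrm v)"
    using cauchy_schwarz[OF assms] by (metis abs_ge_self abs_ge_zero abs_mult mult_left_mono order_trans)
  then show "(nrm (comb c u v))\<^sup>2 \<le> (nrm u + \<bar>c\<bar> * nrm v)\<^sup>2"
    using assms by (simp add: nrm_sq comb_closed expand power2_sum power_mult_distrib mult.left_commute)
qed (use assms in auto)

lemma nrm_comb_ge:
  assumes "u \<in> K" "v \<in> K"
  shows "\<bar>nrm u - nrm v\<bar> \<le> nrm (comb (-1) u v)"
proof (rule power2_le_imp_le)
  have "A u v \<le> nrm u * nrm v"
    using cauchy_schwarz[OF assms] by simp
  then show "\<bar>nrm u - nrm v\<bar>\<^sup>2 \<le> (nrm (comb (-1) u v))\<^sup>2"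
    using assms by (simp add: nrm_sq comb_closed expand power2_diff)
qed (use assms comb_closed in auto)

text \<open>There is no zero and no scaling in the locale; \<open>comb c u u\<close> plays the part
  of \<open>(1 + c) u\<close>. Taking \<open>c = -1\<close> gives an element of seminorm zero, and
  \<open>c = 1 / nrm u - 1\<close> one of seminorm 1.\<close>

lemma comb_same: "u \<in> K \<Longrightarrow> A (comb c u u) (comb c u u) = (1 + c)\<^sup>2 * A u u"
  by (simp add: expand power2_sum algebra_simps)

lemma nrm_comb_same: "u \<in> K \<Longrightarrow> nrm (comb c u u) = \<bar>1 + c\<bar> * nrm u"
  by (simp add: nrm_def comb_same real_sqrt_mult)

text \<open>A supremum over the unit ball yields a homogeneous bound after rescaling. The bound
  \<open>bd\<close> makes the supremum meaningful, and it also settles elements of seminorm zero,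
  which cannot be rescaled: there \<open>F u = 0\<close>.\<close>

lemma dual_bound:
  assumes F: "\<And>u v c. u \<in> K \<Longrightarrow> v \<in> K \<Longrightarrow> F (comb c u v) = F u + c * F v"
    and bd: "\<And>u. u \<in> K \<Longrightarrow> \<bar>F u\<bar> \<le> M * nrm u"
    and u: "u \<in> K"
  shows "0 \<le> Sup {\<bar>F v\<bar> | v. v \<in> K \<and> nrm v \<le> 1}"
    and "\<bar>F u\<bar> \<le> Sup {\<bar>F v\<bar> | v. v \<in> K \<and> nrm v \<le> 1} * nrm u"
proof -
  let ?X = "{\<bar>F v\<bar> | v. v \<in> K \<and> nrm v \<le> 1}"
  have "\<bar>F v\<bar> \<le> \<bar>M\<bar>" if "v \<in> K" "nrm v \<le> 1" for v
  proof -
    have "\<bar>F v\<bar> \<le> \<bar>M\<bar> * nrm v"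
      using bd[OF that(1)] mult_right_mono[OF abs_ge_self[of M] nrm_nonneg[OF that(1)]] by linarith
    also have "\<dots> \<le> \<bar>M\<bar>" using that(2) by (simp add: mult_left_le)
    finally show ?thesis .
  qed
  then have bdd: "bdd_above ?X" by (auto intro!: bdd_aboveI[of _ "\<bar>M\<bar>"])
  have up: "\<bar>F v\<bar> \<le> Sup ?X" if "v \<in> K" "nrm v \<le> 1" for v
    by (rule cSup_upper[OF _ bdd]) (use that in auto)
  have z: "comb (-1) u u \<in> K" "nrm (comb (-1) u u) = 0"
    using u comb_closed nrm_comb_same by auto
  show "0 \<le> Sup ?X" using order_trans[OF abs_ge_zero up[OF z(1)]] z(2) by simp
  show "\<bar>F u\<bar> \<le> Sup ?X * nrm u"
  proof (cases "nrm u = 0")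
    case True
    then show ?thesis using bd[OF u] by simp
  next
    case False
    then have t: "nrm u > 0" using nrm_nonneg[OF u] by linarith
    let ?v = "comb (1 / nrm u - 1) u u"
    have "nrm ?v = 1" using t nrm_comb_same[OF u] by simp
    moreover have "F ?v = F u / nrm u" using F[OF u u] by (simp add: algebra_simps)
    ultimately have "\<bar>F u / nrm u\<bar> \<le> Sup ?X" using up[OF comb_closed[OF u u], of "1 / nrm u - 1"] by simp
    then show ?thesis using t by (simp add: abs_divide divide_le_eq)
  qed
qed

text \<open>A minimising sequence of \<open>J\<close> is Cauchy and its limit is a minimiser. Along
  \<open>comb c u v\<close> the functional \<open>J\<close> is a quadratic in \<open>c\<close> whose
  slope at 0 is \<open>2 * (A u v - F v)\<close>, so minimality forces the equation.\<close>

theorem riesz: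
  assumes K0: "z \<in> K"
    and F: "\<And>u v c. u \<in> K \<Longrightarrow> v \<in> K \<Longrightarrow> F (comb c u v) = F u + c * F v"
    and bd: "\<And>u. u \<in> K \<Longrightarrow> \<bar>F u\<bar> \<le> M * nrm u"
    and complete: "\<And>X. (\<And>n. X n \<in> K) \<Longrightarrow>
        (\<And>e. e > 0 \<Longrightarrow> \<exists>N. \<forall>m\<ge>N. \<forall>n\<ge>N. nrm (comb (-1) (X m) (X n)) < e) \<Longrightarrow>
        \<exists>u\<in>K. (\<lambda>n. nrm (comb (-1) (X n) u)) \<longlonglongrightarrow> 0"
  shows "\<exists>u\<in>K. \<forall>v\<in>K. A u v = F v"
proof -
  define J where "J v = A v v - 2 * F v" for v
  have Jb: "- (M\<^sup>2) \<le> J v" if "v \<in> K" for v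
  proof -
    have "J v \<ge> (nrm v)\<^sup>2 - 2 * (M * nrm v)"
      using bd[OF that] that by (simp add: J_def nrm_sq)
    moreover have "(nrm v)\<^sup>2 - 2 * (M * nrm v) + M\<^sup>2 = (nrm v - M)\<^sup>2"
      by (simp add: power2_diff)
    ultimately show ?thesis using zero_le_power2[of "nrm v - M"] by linarith
  qed
  define d where "d = Inf (J ` K)"
  have bdd: "bdd_below (J ` K)" using Jb by (auto intro!: bdd_belowI[of _ "- (M\<^sup>2)"])
  have dle: "d \<le> J v" if "v \<in> K" for v
    unfolding d_def using that bdd by (auto intro: cInf_lower)
  have "\<exists>v\<in>K. J v < d + 1 / real (Suc n)" for n
  proof -
    have "Inf (J ` K) < d + 1 / real (Suc n)" by (simp add: d_def)
    then show ?thesis using K0 by (subst (asm) cInf_less_iff[OF _ bdd]) auto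
  qed
  then obtain X where X: "\<And>n. X n \<in> K" "\<And>n. J (X n) < d + 1 / real (Suc n)" by metis
  \<comment> \<open>parallelogram law: \<open>?h\<close> is the midpoint of \<open>X m\<close> and \<open>X n\<close>\<close>
  have JX: "A (comb (-1) (X m) (X n)) (comb (-1) (X m) (X n)) \<le> 2 / real (Suc m) + 2 / real (Suc n)" for m n
  proof -
    let ?d = "comb (-1) (X m) (X n)"
    let ?h = "comb (-1/2) (X m) ?d"
    have dK: "?d \<in> K" and hK: "?h \<in> K" using X comb_closed by auto
    have "A ?h ?h = A (X m) (X m) - A (X m) ?d + A ?d ?d / 4"
      using X dK by (simp add: expand power2_eq_square)
    moreover have "A (X m) ?d = A (X m) (X m) - A (X m) (X n)"
      using X by (simp add: lin_right)
    moreover have "A ?d ?d = A (X m) (X m) - 2 * A (X m) (X n) + A (X n) (X n)"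
      using X by (simp add: expand)
    moreover have "F ?h = F (X m) / 2 + F (X n) / 2"
      using X dK by (simp add: F field_simps)
    \<comment> \<open>The contributions of \<open>F\<close> cancel because \<open>F ?h\<close> is
      the mean of the two values. Since \<open>J ?h\<close> is at least the infimum, only the two
      excesses over \<open>d\<close> survive.\<close>
    ultimately have "A ?d ?d = 2 * J (X m) + 2 * J (X n) - 4 * J ?h"
      by (simp add: J_def field_simps)
    then show ?thesis using dle[OF hK] X(2)[of m] X(2)[of n] by simp
  qed
  have "\<exists>u\<in>K. (\<lambda>n. nrm (comb (-1) (X n) u)) \<longlonglongrightarrow> 0"
  proof (rule complete)
    fix e :: real assume e: "e > 0"
    then obtain N where N: "4 / real (Suc N) < e\<^sup>2"
      using reals_Archimedean[of "e\<^sup>2 / 4"] by (auto simp: field_simps)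
    show "\<exists>N. \<forall>m\<ge>N. \<forall>n\<ge>N. nrm (comb (-1) (X m) (X n)) < e"
    proof (intro exI allI impI)
      fix m n assume mn: "N \<le> m" "N \<le> n"
      have "2 / real (Suc m) \<le> 2 / real (Suc N)" "2 / real (Suc n) \<le> 2 / real (Suc N)"
        using mn by (auto intro!: divide_left_mono)
      then have "A (comb (-1) (X m) (X n)) (comb (-1) (X m) (X n)) < e\<^sup>2"
        using JX[of m n] N by simp
      then show "nrm (comb (-1) (X m) (X n)) < e"
        using e by (simp add: nrm_def real_less_lsqrt)
    qed
  qed (rule X)
  then obtain u where u: "u \<in> K" "(\<lambda>n. nrm (comb (-1) (X n) u)) \<longlonglongrightarrow> 0" by blast
  have nX: "(\<lambda>n. nrm (X n)) \<longlonglongrightarrow> nrm u"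
  proof (rule LIM_zero_cancel, rule Lim_null_comparison[OF _ u(2)])
    show "\<forall>\<^sub>F n in sequentially. norm (nrm (X n) - nrm u) \<le> nrm (comb (- 1) (X n) u)"
      using nrm_comb_ge X u by simp
  qed
  have FX: "(\<lambda>n. F (X n)) \<longlonglongrightarrow> F u"
  proof (rule LIM_zero_cancel, rule Lim_null_comparison)
    have "norm (F (X n) - F u) \<le> M * nrm (comb (- 1) (X n) u)" for n
      using bd[OF comb_closed[OF X(1)[of n] u(1), of "-1"]] F[OF X(1)[of n] u(1), of "-1"] by simp
    then show "\<forall>\<^sub>F n in sequentially. norm (F (X n) - F u) \<le> M * nrm (comb (- 1) (X n) u)" by simp
    show "(\<lambda>n. M * nrm (comb (- 1) (X n) u)) \<longlonglongrightarrow> 0" using tendsto_mult_left[OF u(2), of M] by simp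
  qed
  have "(\<lambda>n. (nrm (X n))\<^sup>2 - 2 * F (X n)) \<longlonglongrightarrow> (nrm u)\<^sup>2 - 2 * F u"
    by (intro tendsto_intros nX FX)
  then have "(\<lambda>n. J (X n)) \<longlonglongrightarrow> J u" using X u by (simp add: nrm_sq J_def)
  moreover have "(\<lambda>n. d + 1 / real (Suc n)) \<longlonglongrightarrow> d + 0"
    by (intro tendsto_intros LIMSEQ_inverse_real_of_nat[unfolded inverse_eq_divide])
  ultimately have Ju: "J u \<le> d" using X(2)
    by (intro LIMSEQ_le[where Y = "\<lambda>n. d + 1 / real (Suc n)"]) (auto intro: less_imp_le)
  have "A u v = F v" if v: "v \<in> K" for v
  proof (rule ccontr)
    assume ne: "A u v \<noteq> F v"
    have q: "0 \<le> 2 * c * (A u v - F v) + c\<^sup>2 * A v v" for c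
    proof -
      have "J u \<le> J (comb c u v)" using Ju dle[OF comb_closed[OF u(1) v]] by (rule order_trans)
      then show ?thesis by (simp add: J_def expand[OF u(1) v] F[OF u(1) v] algebra_simps)
    qed
    define t where "t = A u v - F v"
    \<comment> \<open>Adding 1 keeps the denominator positive even where \<open>A v v = 0\<close>;
      the trial value \<open>c = - t / k\<close> then makes the quadratic negative.\<close>
    define k where "k = A v v + 1"
    have k: "k > 0" using nonneg[OF v] by (simp add: k_def)
    have "0 \<le> 2 * (- t / k) * t + (- t / k)\<^sup>2 * (k - 1)" using q[of "- t / k"] by (simp add: t_def k_def)
    also have "\<dots> = - (t\<^sup>2) * (k + 1) / k\<^sup>2" using k by (simp add: field_simps power2_eq_square)
    also have "\<dots> < 0" using k ne by (intro divide_neg_pos mult_neg_pos) (auto simp: t_def)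
    finally show False by simp
  qed
  then show ?thesis using u(1) by blast
qed

end


section \<open>Square-integrable functions\<close>

definition L2_inner :: "'a::euclidean_space set \<Rightarrow> ('a \<Rightarrow> 'b::euclidean_space) \<Rightarrow> ('a \<Rightarrow> 'b) \<Rightarrow> real" where
  "L2_inner S u v = (\<integral>x. u x \<bullet> v x \<partial>(lebesgue_on S))"

lemma L2_D:
  assumes "u \<in> L2 S"
  shows L2_measurable: "u \<in> borel_measurable (lebesgue_on S)"
    and L2_integrable_sq: "integrable (lebesgue_on S) (\<lambda>x. (norm (u x))\<^sup>2)"
  using assms by (auto simp: L2_def)

lemma L2_inner_integrable:
  assumes u: "u \<in> L2 S" and v: "v \<in> L2 S"
  shows "integrable (lebesgue_on S) (\<lambda>x. u x \<bullet> v x)"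
proof (rule Bochner_Integration.integrable_bound)
  show "integrable (lebesgue_on S) (\<lambda>x. (norm (u x))\<^sup>2 + (norm (v x))\<^sup>2)"
    by (intro Bochner_Integration.integrable_add L2_integrable_sq u v)
  show "(\<lambda>x. u x \<bullet> v x) \<in> borel_measurable (lebesgue_on S)"
    by (intro borel_measurable_inner L2_measurable u v)
  have "norm (u x \<bullet> v x) \<le> (norm (u x))\<^sup>2 + (norm (v x))\<^sup>2" for x
  proof -
    have "2 * (norm (u x) * norm (v x)) \<le> (norm (u x))\<^sup>2 + (norm (v x))\<^sup>2"
      using sum_squares_bound[of "norm (u x)" "norm (v x)"] by simp
    moreover have "0 \<le> norm (u x) * norm (v x)" by simp
    ultimately show ?thesis using Cauchy_Schwarz_ineq2[of "u x" "v x"] by (simp del: mult_nonneg_nonneg)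
  qed
  then show "AE x in lebesgue_on S. norm (u x \<bullet> v x) \<le> norm ((norm (u x))\<^sup>2 + (norm (v x))\<^sup>2)"
    by auto
qed

lemma L2_comb:
  assumes u: "u \<in> L2 S" and v: "v \<in> L2 S"
  shows "(\<lambda>x. u x + c *\<^sub>R v x) \<in> L2 S"
proof -
  have eq: "(norm (u x + c *\<^sub>R v x))\<^sup>2 = u x \<bullet> u x + 2 * c * (u x \<bullet> v x) + c\<^sup>2 * (v x \<bullet> v x)" for x
    unfolding power2_norm_eq_inner by (simp add: inner_simps inner_commute algebra_simps power2_eq_square)
  have "integrable (lebesgue_on S) (\<lambda>x. u x \<bullet> u x + 2 * c * (u x \<bullet> v x) + c\<^sup>2 * (v x \<bullet> v x))"
    by (intro Bochner_Integration.integrable_add integrable_mult_right L2_inner_integrable u v)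
  then show ?thesis
    using L2_measurable[OF u] L2_measurable[OF v] by (simp add: L2_def eq)
qed

lemma L2_zero [simp]: "(\<lambda>x. 0) \<in> L2 S"
  by (simp add: L2_def)

interpretation L2: semi_inner "L2 S" "\<lambda>c u v x. u x + c *\<^sub>R v x" "L2_inner S" for S
proof
  fix u v w :: "'a::euclidean_space \<Rightarrow> 'b::euclidean_space" and c :: real
  assume u: "u \<in> L2 S" and v: "v \<in> L2 S"
  show "(\<lambda>x. u x + c *\<^sub>R v x) \<in> L2 S" using u v by (rule L2_comb)
  show "L2_inner S u v = L2_inner S v u" by (simp add: L2_inner_def inner_commute)
  assume w: "w \<in> L2 S"
  show "L2_inner S (\<lambda>x. u x + c *\<^sub>R v x) w = L2_inner S u w + c * L2_inner S v w"
    using L2_inner_integrable[OF u w] L2_inner_integrable[OF v w]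
    by (simp add: L2_inner_def inner_left_distrib)
qed (simp add: L2_inner_def)

lemma L2_nrm: "L2.nrm S u = L2_norm S u"
  by (simp add: L2.nrm_def L2_norm_def L2_inner_def power2_norm_eq_inner)

lemma L2_norm_nonneg [simp]: "0 \<le> L2_norm S u"
  by (simp add: L2_norm_def)

lemma L2_norm_sq: "(L2_norm S u)\<^sup>2 = L2_inner S u u"
  by (simp add: L2_norm_def L2_inner_def power2_norm_eq_inner)

lemmas L2_cauchy_schwarz = L2.cauchy_schwarz[unfolded L2_nrm]
lemmas L2_norm_comb_le = L2.nrm_comb_le[unfolded L2_nrm]
lemmas L2_norm_comb_ge = L2.nrm_comb_ge[unfolded L2_nrm]

lemma L2_diff:
  assumes "u \<in> L2 S" "v \<in> L2 S"
  shows "(\<lambda>x. u x - v x) \<in> L2 S"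
  using L2_comb[OF assms, of "-1"] by simp

lemma L2_norm_cong_AE:
  assumes "u \<in> L2 S" "v \<in> L2 S" "ae_eq S u v"
  shows "L2_norm S u = L2_norm S v"
proof -
  have "(\<integral>x. (norm (u x))\<^sup>2 \<partial>(lebesgue_on S)) = (\<integral>x. (norm (v x))\<^sup>2 \<partial>(lebesgue_on S))"
    using assms by (intro integral_cong_AE) (auto simp: ae_eq_def L2_def)
  then show ?thesis by (simp add: L2_norm_def)
qed

lemma L2_norm_zero_AE:
  assumes "u \<in> L2 S" "L2_norm S u = 0"
  shows "ae_eq S u (\<lambda>x. 0)"
proof -
  have "(\<integral>x. (norm (u x))\<^sup>2 \<partial>(lebesgue_on S)) = 0" using assms by (simp add: L2_norm_def)
  then have "AE x in lebesgue_on S. (norm (u x))\<^sup>2 = 0"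
    using L2_integrable_sq[OF assms(1)] by (subst (asm) integral_nonneg_eq_0_iff_AE) auto
  then show ?thesis by (simp add: ae_eq_def)
qed

lemma L2_norm_L2:
  assumes "u \<in> L2 S" shows "(\<lambda>x. norm (u x)) \<in> L2 S"
  using assms by (auto simp: L2_def)

lemma L2_bounded:
  assumes S: "S \<in> lmeasurable" and u: "u \<in> borel_measurable (lebesgue_on S)" and B: "\<And>x. norm (u x) \<le> B"
  shows "u \<in> L2 S"
proof -
  interpret finite_measure "lebesgue_on S" using S by (rule finite_measure_lebesgue_on)
  have "integrable (lebesgue_on S) (\<lambda>x. (norm (u x))\<^sup>2)"
    using u B by (intro integrable_const_bound[where B = "B\<^sup>2"]) (auto intro!: power_mono)
  then show ?thesis using u by (simp add: L2_def)
qed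

text \<open>Cauchy-Schwarz against the constant 1, which is square integrable because
  \<open>S\<close> has finite measure.\<close>

lemma L2_imp_integrable:
  assumes S: "S \<in> lmeasurable" and u: "u \<in> L2 S"
  shows "integrable (lebesgue_on S) u"
    and "(\<integral>x. norm (u x) \<partial>(lebesgue_on S)) \<le> sqrt (measure lebesgue S) * L2_norm S u"
proof -
  have one: "(\<lambda>x. 1::real) \<in> L2 S" using L2_bounded[OF S, of "\<lambda>x. 1::real" 1] by simp
  note nu = L2_norm_L2[OF u]
  have "integrable (lebesgue_on S) (\<lambda>x. norm (u x))"
    using L2_inner_integrable[OF one nu] by simp
  then show "integrable (lebesgue_on S) u" using L2_measurable[OF u] by (simp add: integrable_norm_iff)
  have "L2_norm S (\<lambda>x. 1::real) = sqrt (measure lebesgue S)"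
    using S by (simp add: L2_norm_def measure_restrict_space space_restrict_space)
  moreover have "L2_norm S (\<lambda>x. norm (u x)) = L2_norm S u" by (simp add: L2_norm_def)
  ultimately show "(\<integral>x. norm (u x) \<partial>(lebesgue_on S)) \<le> sqrt (measure lebesgue S) * L2_norm S u"
    using L2_cauchy_schwarz[OF one nu] by (simp add: L2_inner_def)
qed

text \<open>Finite measure makes an L2-Cauchy sequence L1-Cauchy, so a subsequence converges almost
  everywhere. Fatou's lemma along that subsequence bounds the distance of every late term to the
  limit, so the whole sequence converges.\<close>

lemma L2_complete:
  fixes X :: "nat \<Rightarrow> 'a::euclidean_space \<Rightarrow> 'b::euclidean_space"
  assumes S: "S \<in> lmeasurable" and X: "\<And>n. X n \<in> L2 S"
    and C: "\<And>e. e > 0 \<Longrightarrow> \<exists>N. \<forall>m\<ge>N. \<forall>n\<ge>N. L2_norm S (\<lambda>x. X m x - X n x) < e"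
  shows "\<exists>u\<in>L2 S. (\<lambda>n. L2_norm S (\<lambda>x. X n x - u x)) \<longlonglongrightarrow> 0"
proof -
  let ?M = "lebesgue_on S"
  have Xm [measurable]: "X n \<in> borel_measurable ?M" for n using X by (rule L2_measurable)
  obtain r where r: "strict_mono r" "AE x in ?M. Cauchy (\<lambda>i. X (r i) x)"
  proof (rule cauchy_L1_AE_cauchy_subseq[where s = X and M = ?M])
    show "integrable ?M (X n)" for n by (rule L2_imp_integrable[OF S X])
    fix e :: real assume e: "e > 0"
    \<comment> \<open>The summand 1 keeps \<open>k\<close> positive when \<open>S\<close> is a null
      set.\<close>
    define k where "k = sqrt (measure lebesgue S) + 1"
    have k: "k > 0" by (simp add: k_def add_nonneg_pos)
    then obtain N where N: "\<And>m n. m \<ge> N \<Longrightarrow> n \<ge> N \<Longrightarrow> L2_norm S (\<lambda>x. X m x - X n x) < e / k"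
      using C[of "e / k"] e by auto
    show "\<exists>N. \<forall>i\<ge>N. \<forall>j\<ge>N. (\<integral>x. norm (X i x - X j x) \<partial>?M) < e"
    proof (intro exI allI impI)
      fix i j assume "N \<le> i" "N \<le> j"
      have "(\<integral>x. norm (X i x - X j x) \<partial>?M) \<le> sqrt (measure lebesgue S) * L2_norm S (\<lambda>x. X i x - X j x)"
        by (rule L2_imp_integrable(2)[OF S L2_diff[OF X X]])
      also have "\<dots> \<le> k * L2_norm S (\<lambda>x. X i x - X j x)"
        by (intro mult_right_mono) (auto simp: k_def)
      also have "\<dots> < e" using N[OF \<open>N \<le> i\<close> \<open>N \<le> j\<close>] k by (simp add: field_simps)
      finally show "(\<integral>x. norm (X i x - X j x) \<partial>?M) < e" .
    qed
  qed
  define u where "u x = lim (\<lambda>i. X (r i) x)" for x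
  have um [measurable]: "u \<in> borel_measurable ?M" unfolding u_def by measurable
  have conv: "AE x in ?M. (\<lambda>i. X (r i) x) \<longlonglongrightarrow> u x"
    using r(2) by eventually_elim (auto simp: u_def Cauchy_convergent_iff convergent_LIMSEQ_iff)
  \<comment> \<open>The Cauchy estimate with one index sent to infinity. Used with
    \<open>e = 1\<close> to place \<open>u\<close> in \<open>L2 S\<close>, then with small
    \<open>e\<close> for the convergence.\<close>
  have fatou: "integrable ?M (\<lambda>x. (norm (X m x - u x))\<^sup>2) \<and> L2_norm S (\<lambda>x. X m x - u x) \<le> e"
    if N: "\<And>n. n \<ge> N \<Longrightarrow> L2_norm S (\<lambda>x. X m x - X n x) \<le> e" and e: "e > 0" for m N e
  proof -
    have "(\<integral>\<^sup>+x. ennreal ((norm (X m x - u x))\<^sup>2) \<partial>?M)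
        = (\<integral>\<^sup>+x. liminf (\<lambda>i. ennreal ((norm (X m x - X (r i) x))\<^sup>2)) \<partial>?M)"
    proof (rule nn_integral_cong_AE)
      show "AE x in ?M. ennreal ((norm (X m x - u x))\<^sup>2) = liminf (\<lambda>i. ennreal ((norm (X m x - X (r i) x))\<^sup>2))"
        using conv
      proof eventually_elim
        case (elim x)
        have "(\<lambda>i. ennreal ((norm (X m x - X (r i) x))\<^sup>2)) \<longlonglongrightarrow> ennreal ((norm (X m x - u x))\<^sup>2)"
          by (intro tendsto_intros elim)
        then show ?case by (metis lim_imp_Liminf sequentially_bot)
      qed
    qed
    also have "\<dots> \<le> liminf (\<lambda>i. \<integral>\<^sup>+x. ennreal ((norm (X m x - X (r i) x))\<^sup>2) \<partial>?M)"
      by (rule nn_integral_liminf) measurable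
    also have "\<dots> \<le> ennreal (e\<^sup>2)"
    proof (rule Liminf_le)
      have "(\<integral>\<^sup>+x. ennreal ((norm (X m x - X (r i) x))\<^sup>2) \<partial>?M) \<le> ennreal (e\<^sup>2)" if "i \<ge> N" for i
      proof -
        have "r i \<ge> N" using seq_suble[OF r(1), of i] that by linarith
        then have "(L2_norm S (\<lambda>x. X m x - X (r i) x))\<^sup>2 \<le> e\<^sup>2"
          by (intro power_mono N) auto
        moreover have "(\<integral>\<^sup>+x. ennreal ((norm (X m x - X (r i) x))\<^sup>2) \<partial>?M)
            = ennreal ((L2_norm S (\<lambda>x. X m x - X (r i) x))\<^sup>2)"
          using L2_integrable_sq[OF L2_diff[OF X[of m] X[of "r i"]]]
          by (subst nn_integral_eq_integral) (auto simp: L2_norm_def)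
        ultimately show ?thesis by (simp add: ennreal_leI)
      qed
      then show "\<forall>\<^sub>F i in sequentially. (\<integral>\<^sup>+x. ennreal ((norm (X m x - X (r i) x))\<^sup>2) \<partial>?M) \<le> ennreal (e\<^sup>2)"
        by (auto simp: eventually_sequentially)
    qed simp
    finally have le: "(\<integral>\<^sup>+x. ennreal ((norm (X m x - u x))\<^sup>2) \<partial>?M) \<le> ennreal (e\<^sup>2)" .
    then have int: "integrable ?M (\<lambda>x. (norm (X m x - u x))\<^sup>2)"
      by (intro integrableI_bounded) (auto intro: le_less_trans)
    with le have "(\<integral>x. (norm (X m x - u x))\<^sup>2 \<partial>?M) \<le> e\<^sup>2"
      by (subst (asm) nn_integral_eq_integral) (auto simp: ennreal_le_iff)
    then have "L2_norm S (\<lambda>x. X m x - u x) \<le> e"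
      using e real_sqrt_le_mono by (fastforce simp: L2_norm_def)
    with int show ?thesis by simp
  qed
  obtain N1 where N1: "\<And>m n. m \<ge> N1 \<Longrightarrow> n \<ge> N1 \<Longrightarrow> L2_norm S (\<lambda>x. X m x - X n x) < 1"
    using C[of 1] by auto
  have "(\<lambda>x. X N1 x - u x) \<in> L2 S"
    using fatou[of N1 N1 1] N1[of N1] by (auto simp: L2_def intro: less_imp_le)
  from L2_diff[OF X[of N1] this] have u: "u \<in> L2 S" by simp
  have "(\<lambda>n. L2_norm S (\<lambda>x. X n x - u x)) \<longlonglongrightarrow> 0"
  proof (rule LIMSEQ_I)
    fix e :: real assume e: "e > 0"
    obtain N where N: "\<And>m n. m \<ge> N \<Longrightarrow> n \<ge> N \<Longrightarrow> L2_norm S (\<lambda>x. X m x - X n x) < e/2"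
      using C[of "e/2"] e by auto
    show "\<exists>N. \<forall>n\<ge>N. norm (L2_norm S (\<lambda>x. X n x - u x) - 0) < e"
    proof (intro exI allI impI)
      fix n assume "N \<le> n"
      then have "L2_norm S (\<lambda>x. X n x - u x) \<le> e/2"
        using fatou[of N n "e/2"] N[of n] e by (auto intro: less_imp_le)
      then show "norm (L2_norm S (\<lambda>x. X n x - u x) - 0) < e" using e by simp
    qed
  qed
  with u show ?thesis by blast
qed

section \<open>Smooth test functions\<close>

text \<open>By uniqueness of the derivative, any explicit \<open>D\<close> may stand in for
  \<open>frechet_derivative\<close>.\<close>

lemma C_k_SucI:
  assumes "\<And>x. (f has_derivative D x) (at x)" and "\<And>i. i \<in> Basis \<Longrightarrow> C_k k (\<lambda>x. D x i)"
  shows "C_k (Suc k) f"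
proof -
  have "frechet_derivative f (at x) = D x" for x
    using frechet_derivative_at[OF assms(1)[of x]] by simp
  then show ?thesis using assms unfolding C_k.simps differentiable_def by auto
qed

lemma C_k_SucD:
  assumes "C_k (Suc k) f"
  shows "(f has_derivative frechet_derivative f (at x)) (at x)"
    and "i \<in> Basis \<Longrightarrow> C_k k (\<lambda>x. frechet_derivative f (at x) i)"
  using assms frechet_derivative_works[of f "at x"] by auto

text \<open>The recursion in \<open>C_k\<close> mentions continuity only at level 0, so monotonicity
  in \<open>k\<close> takes an induction. The product rule needs it: its terms contain
  undifferentiated factors, which are known at level \<open>Suc k\<close>.\<close>

lemma C_k_Suc_imp: "C_k (Suc k) f \<Longrightarrow> C_k k f"
proof (induction k arbitrary: f)
  case 0
  then have "f differentiable_on UNIV" by (simp add: differentiable_on_def)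
  then show ?case using differentiable_imp_continuous_on by simp
next
  case (Suc k)
  have "C_k k (\<lambda>x. frechet_derivative f (at x) i)" if "i \<in> Basis" for i
    by (rule Suc.IH, rule C_k_SucD(2)[OF Suc.prems that])
  then show ?case using C_k_SucD(1)[OF Suc.prems] by (intro C_k_SucI[where D = "\<lambda>x. frechet_derivative f (at x)"])
qed

lemma C_k_const [simp]: "C_k k (\<lambda>x. c)"
proof (induction k arbitrary: c)
  case (Suc k)
  show ?case by (rule C_k_SucI[where D = "\<lambda>x h. 0"]) (auto simp: Suc)
qed simp

lemma C_k_add: "C_k k f \<Longrightarrow> C_k k g \<Longrightarrow> C_k k (\<lambda>x. f x + g x)"
proof (induction k arbitrary: f g)
  case 0
  then show ?case by (auto intro!: continuous_intros)
next
  case (Suc k)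
  note p = Suc.prems
  show ?case
  proof (rule C_k_SucI)
    show "((\<lambda>x. f x + g x) has_derivative
        (\<lambda>h. frechet_derivative f (at x) h + frechet_derivative g (at x) h)) (at x)" for x
      by (intro has_derivative_add C_k_SucD(1)[OF p(1)] C_k_SucD(1)[OF p(2)])
    show "C_k k (\<lambda>x. frechet_derivative f (at x) i + frechet_derivative g (at x) i)" if "i \<in> Basis" for i
      using Suc.IH[OF C_k_SucD(2)[OF p(1) that] C_k_SucD(2)[OF p(2) that]] .
  qed
qed

lemma C_k_mult: "C_k k f \<Longrightarrow> C_k k g \<Longrightarrow> C_k k (\<lambda>x. f x * g x)"
proof (induction k arbitrary: f g)
  case 0
  then show ?case by (auto intro!: continuous_intros)
next
  case (Suc k)
  note p = Suc.prems
  show ?case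
  proof (rule C_k_SucI)
    show "((\<lambda>x. f x * g x) has_derivative
        (\<lambda>h. f x * frechet_derivative g (at x) h + frechet_derivative f (at x) h * g x)) (at x)" for x
      by (intro has_derivative_mult C_k_SucD(1)[OF p(1)] C_k_SucD(1)[OF p(2)])
    show "C_k k (\<lambda>x. f x * frechet_derivative g (at x) i + frechet_derivative f (at x) i * g x)"
      if "i \<in> Basis" for i
      using C_k_add[OF Suc.IH[OF C_k_Suc_imp[OF p(1)] C_k_SucD(2)[OF p(2) that]]
        Suc.IH[OF C_k_SucD(2)[OF p(1) that] C_k_Suc_imp[OF p(2)]]] .
  qed
qed

lemma C_k_prod: "finite I \<Longrightarrow> (\<And>i. i \<in> I \<Longrightarrow> C_k k (f i)) \<Longrightarrow> C_k k (\<lambda>x. \<Prod>i\<in>I. f i x)"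
  by (induction I rule: finite_induct) (auto intro!: C_k_mult)

text \<open>The partial derivatives are a constant times a composition of the same shape with
  \<open>h'\<close> for \<open>h\<close>, so the induction closes without a general chain rule for
  \<open>C_k\<close>.\<close>

lemma C_k_compose_affine:
  fixes h :: "real \<Rightarrow> real" and w :: "'a::euclidean_space"
  shows "C_k k h \<Longrightarrow> C_k k (\<lambda>x. h (x \<bullet> w + c))"
proof (induction k arbitrary: h)
  case 0
  then have "continuous_on UNIV h" by simp
  then have "continuous_on UNIV (\<lambda>x. h (x \<bullet> w + c))"
    by (rule continuous_on_compose2) (auto intro!: continuous_intros)
  then show ?case by simp
next
  case (Suc k)
  let ?h' = "\<lambda>y. frechet_derivative h (at y) 1"
  have h: "(h has_real_derivative ?h' y) (at y)" for y
  proof -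
    note d = C_k_SucD(1)[OF Suc.prems, of y]
    have "frechet_derivative h (at y) t = ?h' y * t" for t
      using linear_scale[OF has_derivative_linear[OF d], of t 1] by simp
    then have "frechet_derivative h (at y) = (\<lambda>t. ?h' y * t)" by (intro ext)
    with d show ?thesis unfolding has_field_derivative_def by (metis (no_types, lifting) ext)
  qed
  show ?case
  proof (rule C_k_SucI)
    show "((\<lambda>x. h (x \<bullet> w + c)) has_derivative (\<lambda>t. (t \<bullet> w) * ?h' (x \<bullet> w + c))) (at x)" for x
      by (rule DERIV_compose_FDERIV[OF h]) (auto intro!: derivative_eq_intros)
    show "C_k k (\<lambda>x. (i \<bullet> w) * ?h' (x \<bullet> w + c))" if "i \<in> Basis" for i
      by (intro C_k_mult C_k_const Suc.IH[of ?h'] C_k_SucD(2)[OF Suc.prems]) simp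
  qed
qed

lemma C_k_SucI_real:
  fixes f :: "real \<Rightarrow> real"
  assumes "\<And>x. (f has_real_derivative f' x) (at x)" and "C_k k f'"
  shows "C_k (Suc k) f"
  by (rule C_k_SucI[where D = "\<lambda>x t. f' x * t"]) (use assms in \<open>auto simp: has_field_derivative_def\<close>)

lemma C_k_ident: "C_k k (\<lambda>x::real. x)"
proof (cases k)
  case (Suc n)
  show ?thesis unfolding Suc by (rule C_k_SucI_real[where f' = "\<lambda>_. 1"]) auto
qed auto

lemma C_k_inner: "C_k k (\<lambda>x. x \<bullet> w)"
  using C_k_compose_affine[OF C_k_ident, of k w 0] by simp

section \<open>A smooth function that is flat at the origin\<close>

text \<open>
  The derivatives of \<open>exp (-1/t)\<close>, extended by \<open>0\<close>, are linear combinations of these functions.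
\<close>

definition flat_exp :: "nat \<Rightarrow> real \<Rightarrow> real" where
  "flat_exp n t = (if t > 0 then (1 / t) ^ n * exp (- (1 / t)) else 0)"

text \<open>The difference of the two sides for \<open>Suc n\<close> has as derivative
  \<open>Suc n\<close> times the difference for \<open>n\<close>, which is nonnegative by induction;
  hence it stays above its value at 0.\<close>

lemma power_le_fact_exp: "0 \<le> s \<Longrightarrow> s ^ n \<le> fact n * exp (s::real)"
proof (induction n arbitrary: s)
  case (Suc n)
  have "(\<lambda>t. fact (Suc n) * exp t - t ^ Suc n) 0 \<le> (\<lambda>t. fact (Suc n) * exp t - t ^ Suc n) s"
  proof (rule DERIV_nonneg_imp_nondecreasing[OF Suc.prems])
    fix x :: real assume x: "0 \<le> x" "x \<le> s"
    have "((\<lambda>t. fact (Suc n) * exp t - t ^ Suc n) has_real_derivative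
        (fact (Suc n) * exp x - real (Suc n) * x ^ n)) (at x)"
      by (auto intro!: derivative_eq_intros simp del: power_Suc)
    moreover have "real (Suc n) * x ^ n \<le> real (Suc n) * (fact n * exp x)"
      using Suc.IH[OF x(1)] by (intro mult_left_mono) auto
    ultimately show "\<exists>y. ((\<lambda>t. fact (Suc n) * exp t - t ^ Suc n) has_real_derivative y) (at x) \<and> 0 \<le> y"
      by (intro exI conjI) (auto simp: algebra_simps)
  qed
  then have "fact (Suc n) \<le> fact (Suc n) * exp s - s ^ Suc n" by (simp del: fact_Suc)
  then show ?case using fact_ge_zero[of "Suc n", where 'a = real] by linarith
qed simp

text \<open>Put \<open>s = 1 / t\<close> and exponent \<open>n + 2\<close> in the previous estimate.
  Two spare powers of \<open>t\<close> remain, one more than a difference quotient at 0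
  consumes.\<close>

lemma flat_exp_bound: "\<bar>flat_exp n t\<bar> \<le> fact (n + 2) * t\<^sup>2"
proof (cases "t > 0")
  case True
  have "(1/t) ^ (n + 2) \<le> fact (n + 2) * exp (1/t)"
    using True by (intro power_le_fact_exp) simp
  then have "(1/t)^n * (1/t)\<^sup>2 \<le> fact (n + 2) * exp (1/t)" by (simp only: power_add)
  then have 1: "(1/t)^n * (1/t)\<^sup>2 * t\<^sup>2 * exp (-(1/t)) \<le> fact (n + 2) * exp (1/t) * t\<^sup>2 * exp (-(1/t))"
    by (intro mult_right_mono) auto
  have "(1/t)\<^sup>2 * t\<^sup>2 = 1" using True by (simp add: field_simps)
  then have 2: "(1/t)^n * (1/t)\<^sup>2 * t\<^sup>2 * exp (-(1/t)) = flat_exp n t"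
    using True by (simp add: flat_exp_def mult.assoc)
  have "fact (n + 2) * exp (1/t) * t\<^sup>2 * exp (-(1/t)) = fact (n + 2) * t\<^sup>2 * (exp (1/t) * exp (-(1/t)))"
    by (simp only: ac_simps)
  then have 3: "fact (n + 2) * exp (1/t) * t\<^sup>2 * exp (-(1/t)) = fact (n + 2) * t\<^sup>2"
    by (simp add: exp_minus)
  have "0 \<le> flat_exp n t" using True by (simp add: flat_exp_def)
  then show ?thesis using 1 unfolding 2 3 by (simp only: abs_of_nonneg)
qed (simp add: flat_exp_def)

text \<open>Away from 0 this is calculus. At 0 the quadratic bound sends the difference quotient to
  0, which agrees with the formula because every \<open>flat_exp m 0\<close> is 0.\<close>

lemma flat_exp_DERIV:
  "(flat_exp n has_real_derivative (flat_exp (n + 2) t - real n * flat_exp (n + 1) t)) (at t)"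
proof -
  consider "t > 0" | "t < 0" | "t = 0" by linarith
  then show ?thesis
  proof cases
    case 1
    have "((\<lambda>t. (1 / t) ^ n * exp (- (1 / t))) has_real_derivative
        (real n * (1 / t) ^ (n - 1) * (- ((1 / t)\<^sup>2)) * exp (- (1 / t)) + (1 / t) ^ n * (exp (- (1 / t)) * (1 / t)\<^sup>2))) (at t)"
      using 1 by (auto intro!: derivative_eq_intros simp: power2_eq_square)
    \<comment> \<open>For \<open>n = 0\<close> the factor \<open>real n\<close> annihilates the term
      with the truncated exponent \<open>n - 1\<close>.\<close>
    moreover have "real n * s ^ (n - 1) * (- (s\<^sup>2)) * e + s ^ n * (e * s\<^sup>2) = s ^ (n + 2) * e - real n * (s ^ (n + 1) * e)" for s e :: real
      by (cases n) (simp_all add: power2_eq_square algebra_simps)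
    ultimately have "((\<lambda>t. (1 / t) ^ n * exp (- (1 / t))) has_real_derivative
        (flat_exp (n + 2) t - real n * flat_exp (n + 1) t)) (at t)"
      using 1 by (simp only: flat_exp_def if_True)
    then show ?thesis
      by (rule DERIV_cong_ev[THEN iffD1, rotated 3])
         (use 1 in \<open>auto simp: flat_exp_def intro!: eventually_mono[OF eventually_nhds_in_open[of "{0<..}" t]]\<close>)
  next
    case 2
    have "((\<lambda>t. 0) has_real_derivative 0) (at t)" by simp
    then show ?thesis
      by (rule DERIV_cong_ev[THEN iffD1, rotated 3])
         (use 2 in \<open>auto simp: flat_exp_def intro!: eventually_mono[OF eventually_nhds_in_open[of "{..<0}" t]]\<close>)
  next
    case 3
    have "(\<lambda>h. (flat_exp n (0 + h) - flat_exp n 0) / h) \<midarrow>0\<rightarrow> 0"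
    proof (rule Lim_null_comparison)
      have "norm ((flat_exp n (0 + h) - flat_exp n 0) / h) \<le> fact (n + 2) * \<bar>h\<bar>" if "h \<noteq> 0" for h
      proof -
        have "norm ((flat_exp n (0 + h) - flat_exp n 0) / h) = \<bar>flat_exp n h\<bar> / \<bar>h\<bar>"
          by (simp add: flat_exp_def[of n 0] abs_divide)
        also have "\<dots> \<le> (fact (n + 2) * h\<^sup>2) / \<bar>h\<bar>"
          using flat_exp_bound by (intro divide_right_mono) auto
        also have "\<dots> = fact (n + 2) * (h\<^sup>2 / \<bar>h\<bar>)" by (rule times_divide_eq_right[symmetric])
        also have "h\<^sup>2 / \<bar>h\<bar> = \<bar>h\<bar>" using that by (simp add: power2_eq_square abs_if)
        finally show ?thesis .
      qed
      then show "\<forall>\<^sub>F h in at 0. norm ((flat_exp n (0 + h) - flat_exp n 0) / h) \<le> fact (n + 2) * \<bar>h\<bar>"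
        by (auto simp: eventually_at_filter)
      have "(\<lambda>h::real. fact (n + 2) * \<bar>h\<bar>) \<midarrow>0\<rightarrow> fact (n + 2) * \<bar>0\<bar>"
        by (intro tendsto_intros)
      then show "(\<lambda>h::real. fact (n + 2) * \<bar>h\<bar>) \<midarrow>0\<rightarrow> 0" by simp
    qed
    then show ?thesis using 3 by (simp add: DERIV_def flat_exp_def)
  qed
qed

lemma C_k_flat_exp: "C_k k (flat_exp n)"
proof (induction k arbitrary: n)
  case 0
  have "continuous_on UNIV (flat_exp n)"
    using flat_exp_DERIV by (intro DERIV_continuous_on) (auto intro: has_field_derivative_at_within)
  then show ?case by simp
next
  case (Suc k)
  have "C_k k (\<lambda>t. flat_exp (n + 2) t + (- real n) * flat_exp (n + 1) t)"
    by (intro C_k_add C_k_mult C_k_const Suc)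
  then show ?case using flat_exp_DERIV by (intro C_k_SucI_real[where f' = "\<lambda>t. flat_exp (n + 2) t - real n * flat_exp (n + 1) t"]) auto
qed

section \<open>Closure properties and integrals of test functions\<close>

lemma testD:
  assumes "\<eta> \<in> test_functions S"
  shows test_smooth: "C_k k \<eta>"
    and test_compact: "compact (closure {x. \<eta> x \<noteq> 0})"
    and test_support: "closure {x. \<eta> x \<noteq> 0} \<subseteq> S"
  using assms by (auto simp: test_functions_def)

text \<open>Any compact \<open>K\<close> carrying the function may replace the closure of its
  nonzero set, which then is a closed subset of \<open>K\<close>.\<close>

lemma testI:
  assumes "\<And>k. C_k k \<eta>" "compact K" "K \<subseteq> S" "\<And>x. x \<notin> K \<Longrightarrow> \<eta> x = 0"
  shows "\<eta> \<in> test_functions S"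
proof -
  have "closure {x. \<eta> x \<noteq> 0} \<subseteq> K"
    using assms(4) compact_imp_closed[OF assms(2)] by (intro closure_minimal) auto
  moreover have "compact (closure {x. \<eta> x \<noteq> 0})"
    using compact_Int_closed[OF assms(2) closed_closure, of "{x. \<eta> x \<noteq> 0}"] calculation by (simp add: inf.absorb2)
  ultimately show ?thesis using assms(1,3) by (auto simp: test_functions_def)
qed

lemma test_zero: "\<eta> \<in> test_functions S \<Longrightarrow> x \<notin> S \<Longrightarrow> \<eta> x = 0"
  using test_support[of \<eta> S] closure_subset[of "{x. \<eta> x \<noteq> 0}"] by blast

lemma test_mult:
  assumes "\<eta> \<in> test_functions S" "\<And>k. C_k k f"
  shows "(\<lambda>x. f x * \<eta> x) \<in> test_functions S"
proof (rule testI[where K = "closure {x. \<eta> x \<noteq> 0}"])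
  show "f x * \<eta> x = 0" if "x \<notin> closure {x. \<eta> x \<noteq> 0}" for x
    using that closure_subset[of "{x. \<eta> x \<noteq> 0}"] by auto
qed (use assms testD[OF assms(1)] in \<open>auto intro: C_k_mult\<close>)

lemma test_comb:
  assumes "\<eta> \<in> test_functions S" "\<zeta> \<in> test_functions S"
  shows "(\<lambda>x. \<eta> x + c * \<zeta> x) \<in> test_functions S"
proof (rule testI[where K = "closure {x. \<eta> x \<noteq> 0} \<union> closure {x. \<zeta> x \<noteq> 0}"])
  show "\<eta> x + c * \<zeta> x = 0" if "x \<notin> closure {x. \<eta> x \<noteq> 0} \<union> closure {x. \<zeta> x \<noteq> 0}" for x
  proof -
    have "\<eta> x = 0" "\<zeta> x = 0"
      using that closure_subset[of "{x. \<eta> x \<noteq> 0}"] closure_subset[of "{x. \<zeta> x \<noteq> 0}"] by blast+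
    then show ?thesis by simp
  qed
  show "C_k k (\<lambda>x. \<eta> x + c * \<zeta> x)" for k
    by (intro C_k_add C_k_mult C_k_const test_smooth[OF assms(1)] test_smooth[OF assms(2)])
qed (use testD[OF assms(1)] testD[OF assms(2)] in auto)

lemma test_zero_fun: "(\<lambda>x. 0) \<in> test_functions S"
  by (rule testI[where K = "{}"]) auto

lemma test_has_derivative:
  "\<eta> \<in> test_functions S \<Longrightarrow> (\<eta> has_derivative frechet_derivative \<eta> (at x)) (at x)"
  by (rule C_k_SucD(1)[of 0]) (rule test_smooth)

lemma test_deriv:
  assumes "\<eta> \<in> test_functions S" "i \<in> Basis"
  shows "(\<lambda>x. frechet_derivative \<eta> (at x) i) \<in> test_functions S"
proof (rule testI[where K = "closure {x. \<eta> x \<noteq> 0}"])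
  show "frechet_derivative \<eta> (at x) i = 0" if x: "x \<notin> closure {x. \<eta> x \<noteq> 0}" for x
  proof -
    have "((\<lambda>_. 0) has_derivative (\<lambda>_. 0)) (at x)" by simp
    then have "(\<eta> has_derivative (\<lambda>_. 0)) (at x)"
      by (rule has_derivative_transform_within_open[of _ _ _ _ "- closure {x. \<eta> x \<noteq> 0}"])
        (use x closure_subset[of "{x. \<eta> x \<noteq> 0}"] in auto)
    then show ?thesis using frechet_derivative_at by metis
  qed
  show "C_k k (\<lambda>x. frechet_derivative \<eta> (at x) i)" for k
    using test_smooth[OF assms(1), of "Suc k"] assms(2) by simp
qed (use testD[OF assms(1)] in auto)

lemma test_continuous: "\<eta> \<in> test_functions S \<Longrightarrow> continuous_on UNIV \<eta>"
  using test_smooth[of \<eta> S 0] by simp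

lemma test_bounded:
  assumes "\<eta> \<in> test_functions S"
  obtains B where "B > 0" "\<And>x. \<bar>\<eta> x\<bar> \<le> B"
proof -
  let ?K = "closure {x. \<eta> x \<noteq> 0}"
  have "compact (\<eta> ` ?K)"
    using test_compact[OF assms] test_continuous[OF assms]
    by (intro compact_continuous_image) (auto intro: continuous_on_subset)
  then obtain B where B: "B > 0" "\<And>y. y \<in> \<eta> ` ?K \<Longrightarrow> norm y \<le> B"
    using compact_imp_bounded bounded_pos by metis
  have "\<bar>\<eta> x\<bar> \<le> B" for x
    using B closure_subset[of "{x. \<eta> x \<noteq> 0}"] by (cases "\<eta> x = 0") force+
  then show ?thesis using B(1) that by blast
qed

lemma test_measurable: "\<eta> \<in> test_functions S \<Longrightarrow> \<eta> \<in> borel_measurable borel"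
  by (intro borel_measurable_continuous_onI test_continuous)

lemma test_measurable_on: "\<eta> \<in> test_functions S \<Longrightarrow> \<eta> \<in> borel_measurable (lebesgue_on T)"
  using test_measurable[of \<eta> S]
  by (intro measurable_restrict_space1 measurable_completion) simp

lemma test_integrable:
  assumes "\<eta> \<in> test_functions S"
  shows "integrable lborel \<eta>"
proof -
  let ?K = "closure {x. \<eta> x \<noteq> 0}"
  have "integrable lborel (\<lambda>x. indicator ?K x *\<^sub>R \<eta> x)"
    using test_compact[OF assms] test_continuous[OF assms]
    by (intro borel_integrable_compact) (auto intro: continuous_on_subset)
  moreover have "(\<lambda>x. indicator ?K x *\<^sub>R \<eta> x) = \<eta>"
    using closure_subset[of "{x. \<eta> x \<noteq> 0}"] by (intro ext) (auto simp: indicator_def)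
  ultimately show ?thesis by simp
qed

text \<open>Moves integrals to \<open>lborel\<close>, where translation invariance is
  available.\<close>

lemma test_integral_on:
  assumes "\<eta> \<in> test_functions S" "S \<in> sets lebesgue"
  shows "(\<integral>x. \<eta> x \<partial>(lebesgue_on S)) = (\<integral>x. \<eta> x \<partial>lborel)"
proof -
  have "(\<integral>x. \<eta> x \<partial>(lebesgue_on S)) = (\<integral>x. indicator S x *\<^sub>R \<eta> x \<partial>lebesgue)"
    using assms by (intro integral_restrict_space) auto
  also have "(\<lambda>x. indicator S x *\<^sub>R \<eta> x) = \<eta>"
    using test_zero[OF assms(1)] by (intro ext) (auto simp: indicator_def)
  also have "(\<integral>x. \<eta> x \<partial>lebesgue) = (\<integral>x. \<eta> x \<partial>lborel)"
    using test_measurable[OF assms(1)] by (intro integral_completion) auto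
  finally show ?thesis .
qed


text \<open>
  Difference quotients have integral \<open>0\<close> by translation invariance, so neither Fubini nor an
  integration by parts is needed.
\<close>

lemma test_integral_deriv:
  fixes \<eta> :: "'a::euclidean_space \<Rightarrow> real"
  assumes \<eta>: "\<eta> \<in> test_functions S" and i: "i \<in> Basis"
  shows "(\<integral>x. frechet_derivative \<eta> (at x) i \<partial>lborel) = 0"
proof -
  let ?D = "\<lambda>x. frechet_derivative \<eta> (at x) i"
  define q where "q n x = (\<eta> (x + (1 / real (Suc n)) *\<^sub>R i) - \<eta> x) * real (Suc n)" for n x
  obtain B where B: "B > 0" "\<And>x. \<bar>?D x\<bar> \<le> B" using test_bounded[OF test_deriv[OF \<eta> i]] by blast
  obtain R where R: "\<And>x. x \<in> closure {x. \<eta> x \<noteq> 0} \<Longrightarrow> norm x \<le> R"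
    using compact_imp_bounded[OF test_compact[OF \<eta>]] by (auto simp: bounded_iff)
  have R0: "\<eta> x = 0" if "norm x > R" for x
    using R[of x] closure_subset[of "{x. \<eta> x \<noteq> 0}"] that by force
  have line: "((\<lambda>t. \<eta> (x + t *\<^sub>R i)) has_real_derivative ?D (x + t *\<^sub>R i)) (at t)" for x t
  proof -
    note d = test_has_derivative[OF \<eta>, of "x + t *\<^sub>R i"]
    have "((\<lambda>t. \<eta> (x + t *\<^sub>R i)) has_derivative (\<lambda>h. frechet_derivative \<eta> (at (x + t *\<^sub>R i)) (h *\<^sub>R i))) (at t)"
    proof (rule has_derivative_compose[where g = \<eta> and f = "\<lambda>t. x + t *\<^sub>R i"])
      show "((\<lambda>t. x + t *\<^sub>R i) has_derivative (\<lambda>h. h *\<^sub>R i)) (at t)"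
        by (auto intro!: derivative_eq_intros)
    qed (rule d)
    then show ?thesis
      unfolding has_field_derivative_def
      using linear_scale[OF has_derivative_linear[OF d], of _ i] by (simp add: mult_commute_abs)
  qed
  have qD: "(\<lambda>n. q n x) \<longlonglongrightarrow> ?D x" for x
  proof -
    have "(\<lambda>h. (\<eta> (x + h *\<^sub>R i) - \<eta> x) / h) \<midarrow>0\<rightarrow> ?D x"
      using line[of x 0] by (simp add: DERIV_def)
    moreover have "filterlim (\<lambda>n. 1 / real (Suc n)) (at 0) sequentially"
      using LIMSEQ_inverse_real_of_nat unfolding filterlim_at inverse_eq_divide by simp
    ultimately have "(\<lambda>n. (\<eta> (x + (1 / real (Suc n)) *\<^sub>R i) - \<eta> x) / (1 / real (Suc n))) \<longlonglongrightarrow> ?D x"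
      by (rule filterlim_compose)
    then show ?thesis by (simp add: q_def)
  qed
  \<comment> \<open>By the mean value theorem a difference quotient is a value of the derivative;
    this is the uniform bound for dominated convergence.\<close>
  have qB: "\<bar>q n x\<bar> \<le> B" for n x
  proof -
    let ?h = "1 / real (Suc n)"
    obtain t where "\<eta> (x + ?h *\<^sub>R i) - \<eta> (x + 0 *\<^sub>R i) = (?h - 0) * ?D (x + t *\<^sub>R i)"
      using MVT2[of 0 ?h "\<lambda>t. \<eta> (x + t *\<^sub>R i)" "\<lambda>t. ?D (x + t *\<^sub>R i)"] line by auto
    then have "q n x = ?D (x + t *\<^sub>R i)" by (simp add: q_def field_simps)
    then show ?thesis using B(2) by simp
  qed
  \<comment> \<open>The steps have length at most 1, so enlarging the support radius by 1 covers all
    quotients at once.\<close>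
  have q0: "q n x = 0" if "x \<notin> cball 0 (R + 1)" for n x
  proof -
    have far: "norm (x + c) > R" if "norm c \<le> 1" for c
      using that \<open>x \<notin> _\<close> norm_diff_ineq[of x c] by simp
    have "norm (x + (1 / real (Suc n)) *\<^sub>R i) > R" using i by (intro far) (simp add: divide_le_eq)
    moreover have "norm x > R" using that by simp
    ultimately show ?thesis by (simp add: q_def R0)
  qed
  have m [measurable]: "\<eta> \<in> borel_measurable borel" by (rule test_measurable[OF \<eta>])
  have qm [measurable]: "q n \<in> borel_measurable borel" for n unfolding q_def by measurable
  have Dm [measurable]: "?D \<in> borel_measurable borel" by (rule test_measurable[OF test_deriv[OF \<eta> i]])
  have "(\<lambda>n. \<integral>x. q n x \<partial>lborel) \<longlonglongrightarrow> (\<integral>x. ?D x \<partial>lborel)"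
  proof (rule integral_dominated_convergence[where w = "\<lambda>x. B * indicator (cball 0 (R + 1)) x"])
    show "integrable lborel (\<lambda>x. B * indicator (cball (0::'a) (R + 1)) x)"
      using emeasure_bounded_finite[OF bounded_cball[of "0::'a" "R + 1"]] by (intro integrable_mult_right integrable_real_indicator) auto
    show "AE x in lborel. norm (q n x) \<le> B * indicator (cball 0 (R + 1)) x" for n
      using qB[of n] q0[of _ n] by (auto simp: indicator_def)
  qed (use qD in auto)
  moreover have "(\<integral>x. q n x \<partial>lborel) = 0" for n
  proof -
    let ?c = "(1 / real (Suc n)) *\<^sub>R i"
    have int: "integrable lborel \<eta>" by (rule test_integrable[OF \<eta>])
    have eq: "(\<integral>x. \<eta> (?c + x) \<partial>lborel) = (\<integral>x. \<eta> x \<partial>lborel)"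
      using integral_distr[of "(+) ?c" lborel borel \<eta>] by (simp add: lborel_distr_plus)
    have "integrable lborel (\<lambda>x. \<eta> (?c + x))"
      using integrable_distr_eq[of "(+) ?c" lborel borel \<eta>] int by (simp add: lborel_distr_plus)
    then have "(\<integral>x. \<eta> (?c + x) - \<eta> x \<partial>lborel) = 0" using int eq by simp
    then show ?thesis by (simp add: q_def add.commute del: of_nat_Suc)
  qed
  ultimately show ?thesis by (simp add: LIMSEQ_const_iff)
qed

section \<open>Bumps and the fundamental lemma of the calculus of variations\<close>

text \<open>Each coordinate contributes one factor for each of the two faces of the box, positive
  exactly on the inner side of that face. The stretching by \<open>Suc n\<close> drives the exponent
  to 0 at fixed interior points.\<close>

definition bump :: "'a::euclidean_space \<Rightarrow> 'a \<Rightarrow> nat \<Rightarrow> 'a \<Rightarrow> real" where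
  "bump a b n x = (\<Prod>i\<in>Basis. flat_exp 0 (real (Suc n) * (x \<bullet> i - a \<bullet> i)) * flat_exp 0 (real (Suc n) * (b \<bullet> i - x \<bullet> i)))"

lemma flat_exp_0_bounds: "0 \<le> flat_exp 0 t" "flat_exp 0 t \<le> 1"
  by (auto simp: flat_exp_def)

lemma bump_bounds: "0 \<le> bump a b n x" "bump a b n x \<le> 1"
  unfolding bump_def using flat_exp_0_bounds
  by (auto intro!: prod_nonneg prod_le_1 mult_nonneg_nonneg mult_le_one)

lemma bump_outside: "x \<notin> box a b \<Longrightarrow> bump a b n x = 0"
proof -
  assume "x \<notin> box a b"
  then obtain i where i: "i \<in> Basis" "x \<bullet> i - a \<bullet> i \<le> 0 \<or> b \<bullet> i - x \<bullet> i \<le> 0"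
    by (force simp: mem_box)
  then have "\<not> real (Suc n) * (x \<bullet> i - a \<bullet> i) > 0 \<or> \<not> real (Suc n) * (b \<bullet> i - x \<bullet> i) > 0"
    by (auto simp: zero_less_mult_iff simp del: of_nat_Suc)
  then have "flat_exp 0 (real (Suc n) * (x \<bullet> i - a \<bullet> i)) * flat_exp 0 (real (Suc n) * (b \<bullet> i - x \<bullet> i)) = 0"
    by (simp only: mult_eq_0_iff flat_exp_def) auto
  then show ?thesis using i(1) unfolding bump_def by (intro prod_zero) (auto simp del: of_nat_Suc mult_eq_0_iff)
qed

lemma bump_test:
  assumes "cbox a b \<subseteq> S"
  shows "bump a b n \<in> test_functions S"
proof (rule testI[where K = "cbox a b"])
  show "C_k k (bump a b n)" for k
  proof -
    \<comment> \<open>The distances to the faces are rewritten in the form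
      \<open>x \<bullet> w + c\<close> expected by \<open>C_k_compose_affine\<close>.\<close>
    have "C_k k (\<lambda>x. flat_exp 0 (x \<bullet> (real (Suc n) *\<^sub>R i) + - (real (Suc n) * (a \<bullet> i)))
        * flat_exp 0 (x \<bullet> (- real (Suc n) *\<^sub>R i) + real (Suc n) * (b \<bullet> i)))" for i
      by (intro C_k_mult C_k_compose_affine C_k_flat_exp)
    then have "C_k k (\<lambda>x. \<Prod>i\<in>Basis. flat_exp 0 (x \<bullet> (real (Suc n) *\<^sub>R i) + - (real (Suc n) * (a \<bullet> i)))
        * flat_exp 0 (x \<bullet> (- real (Suc n) *\<^sub>R i) + real (Suc n) * (b \<bullet> i)))"
      by (intro C_k_prod) auto
    then show ?thesis by (simp add: bump_def[abs_def] right_diff_distrib algebra_simps del: of_nat_Suc)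
  qed
  show "bump a b n x = 0" if "x \<notin> cbox a b" for x
    using that box_subset_cbox[of a b] by (intro bump_outside) auto
qed (use assms in auto)

lemma flat_exp_0_tendsto:
  assumes "t > 0"
  shows "(\<lambda>n. flat_exp 0 (real (Suc n) * t)) \<longlonglongrightarrow> 1"
proof -
  have "(\<lambda>n. exp (- (inverse (real (Suc n)) * (1 / t)))) \<longlonglongrightarrow> exp (- (0 * (1 / t)))"
    by (intro tendsto_intros LIMSEQ_inverse_real_of_nat)
  moreover have "flat_exp 0 (real (Suc n) * t) = exp (- (inverse (real (Suc n)) * (1 / t)))" for n
  proof -
    have "real (Suc n) * t > 0" using assms by (intro mult_pos_pos) auto
    then show ?thesis using assms by (simp add: flat_exp_def field_simps del: of_nat_Suc)
  qed
  ultimately show ?thesis by (simp del: of_nat_Suc)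
qed

lemma bump_tendsto: "(\<lambda>n. bump a b n x) \<longlonglongrightarrow> indicator (box a b) x"
proof (cases "x \<in> box a b")
  case True
  have "(\<lambda>n. bump a b n x) \<longlonglongrightarrow> (\<Prod>i\<in>(Basis::'a set). 1 * 1)"
    unfolding bump_def using True
    by (intro tendsto_prod tendsto_mult flat_exp_0_tendsto) (auto simp: mem_box)
  then show ?thesis using True by simp
qed (simp add: bump_outside)

text \<open>
  The bumps converge boundedly to indicators of boxes; the Lebesgue differentiation theorem
  (\<open>integrable_ccontinuous_explicit\<close>) then recovers the values of \<open>g\<close> from its integrals over small cubes.
\<close>

theorem fundamental_lemma:
  fixes g :: "'a::euclidean_space \<Rightarrow> real"
  assumes S: "open S" and g: "integrable (lebesgue_on S) g"
    and orth: "\<And>\<eta>. \<eta> \<in> test_functions S \<Longrightarrow> (\<integral>x. g x * \<eta> x \<partial>(lebesgue_on S)) = 0"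
  shows "ae_eq S g (\<lambda>x. 0)"
proof -
  have SL: "S \<in> sets lebesgue" using S by auto
  \<comment> \<open>Extension by zero: the differentiation theorem speaks of cubes in the whole
    space.\<close>
  define G where "G x = indicator S x *\<^sub>R g x" for x
  have Gint: "integrable lebesgue G"
    unfolding G_def using g SL by (subst (asm) integrable_restrict_space) auto
  have box0: "integral (cbox a b) G = 0" if ab: "cbox a b \<subseteq> S" for a b
  proof -
    have bS: "box a b \<subseteq> S" using ab box_subset_cbox by blast
    have "(\<lambda>n. \<integral>x. g x * bump a b n x \<partial>(lebesgue_on S)) \<longlonglongrightarrow> (\<integral>x. g x * indicator (box a b) x \<partial>(lebesgue_on S))"
    proof (rule integral_dominated_convergence[where w = "\<lambda>x. norm (g x)"])
      show "AE x in lebesgue_on S. norm (g x * bump a b n x) \<le> norm (g x)" for n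
        using bump_bounds[of a b n] by (auto simp: abs_mult intro!: mult_left_le)
      show "AE x in lebesgue_on S. (\<lambda>n. g x * bump a b n x) \<longlonglongrightarrow> g x * indicator (box a b) x"
        by (auto intro!: tendsto_intros bump_tendsto)
      show "(\<lambda>x. g x * bump a b n x) \<in> borel_measurable (lebesgue_on S)" for n
        using g test_measurable_on[OF bump_test[OF ab]] by (intro borel_measurable_times) auto
      show "(\<lambda>x. g x * indicator (box a b) x) \<in> borel_measurable (lebesgue_on S)"
        using g SL by (intro borel_measurable_times borel_measurable_indicator) (auto simp: sets_restrict_space_iff bS)
    qed (use g in auto)
    then have "(\<integral>x. g x * indicator (box a b) x \<partial>(lebesgue_on S)) = 0"
      using orth[OF bump_test[OF ab]] by (simp add: LIMSEQ_const_iff)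
    moreover have "(\<integral>x. g x * indicator (box a b) x \<partial>(lebesgue_on S)) = (\<integral>x. indicator (box a b) x *\<^sub>R G x \<partial>lebesgue)"
      using SL by (subst integral_restrict_space) (auto simp: G_def mult_ac)
    moreover have "(\<integral>x. indicator (box a b) x *\<^sub>R G x \<partial>lebesgue) = (\<integral>x. G x \<partial>(lebesgue_on (box a b)))"
      by (subst integral_restrict_space) auto
    moreover have "integrable (lebesgue_on (box a b)) G"
      using Gint integrable_mult_indicator[of "box a b" lebesgue G] by (subst integrable_restrict_space) auto
    ultimately show ?thesis
      using lebesgue_integral_eq_integral[of "box a b" G] by (simp add: integral_open_interval)
  qed
  have "G integrable_on cbox a b" for a b
    using integrable_on_lebesgue[OF Gint] integrable_on_subcbox by blast
  then obtain N where N: "negligible N" "\<And>x e. x \<notin> N \<Longrightarrow> 0 < e \<Longrightarrow>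
      \<exists>d>0. \<forall>h. 0 < h \<and> h < d \<longrightarrow> norm (integral (cbox x (x + h *\<^sub>R One)) G /\<^sub>R h ^ DIM('a) - G x) < e"
    using integrable_ccontinuous_explicit by metis
  have zero: "g x = 0" if x: "x \<in> S" "x \<notin> N" for x
  proof (rule ccontr)
    assume "g x \<noteq> 0"
    then have Gx: "\<bar>G x\<bar> > 0" using x by (simp add: G_def)
    obtain d where d: "d > 0" "\<And>h. 0 < h \<Longrightarrow> h < d \<Longrightarrow>
        norm (integral (cbox x (x + h *\<^sub>R One)) G /\<^sub>R h ^ DIM('a) - G x) < \<bar>G x\<bar>"
      using N(2)[OF x(2) Gx] by blast
    obtain r where r: "r > 0" "ball x r \<subseteq> S" using S x(1) open_contains_ball by blast
    \<comment> \<open>The first bound keeps \<open>h\<close> below \<open>d\<close>; the second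
      keeps the far corner of the cube within \<open>r / 2\<close> of \<open>x\<close>, so the cube
      stays in \<open>S\<close>.\<close>
    define h where "h = min (d/2) (r / (2 * (norm (One::'a) + 1)))"
    have n1: "norm (One::'a) + 1 > 0" by (simp add: add_nonneg_pos)
    have h: "h > 0" "h < d" using d r n1 by (auto simp: h_def)
    have hr: "h * norm (One::'a) < r"
    proof -
      have "h * norm (One::'a) \<le> h * (norm (One::'a) + 1)" using h by simp
      also have "\<dots> \<le> (r / (2 * (norm (One::'a) + 1))) * (norm (One::'a) + 1)"
        using n1 by (intro mult_right_mono) (auto simp: h_def)
      also have "\<dots> = r / 2" using n1 by (simp add: field_simps)
      finally show ?thesis using r by simp
    qed
    have "cbox x (x + h *\<^sub>R One) \<subseteq> S"
    proof
      fix y assume y: "y \<in> cbox x (x + h *\<^sub>R One)"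
      have "norm (y - x) \<le> norm (h *\<^sub>R (One::'a))"
      proof (rule norm_le_componentwise)
        fix b :: 'a assume b: "b \<in> Basis"
        then show "\<bar>(y - x) \<bullet> b\<bar> \<le> \<bar>h *\<^sub>R One \<bullet> b\<bar>"
          using y h by (fastforce simp: mem_box inner_simps)
      qed
      then have "dist x y < r" using hr h by (simp add: dist_norm norm_minus_commute)
      then show "y \<in> S" using r by auto
    qed
    \<comment> \<open>The mean over the cube is 0, so the estimate reads
      \<open>\<bar>G x\<bar> < \<bar>G x\<bar>\<close>.\<close>
    from box0[OF this] d(2)[OF h] show False by simp
  qed
  have "AE x in lebesgue. x \<notin> N" using N(1) by (simp add: AE_not_in negligible_iff_null_sets)
  then have "AE x in lebesgue. x \<in> S \<longrightarrow> g x = 0" by eventually_elim (use zero in auto)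
  then show ?thesis using SL by (simp add: ae_eq_def AE_restrict_space_iff)
qed

section \<open>Sobolev spaces on a bounded open set\<close>

lemma L2_norm_mono:
  assumes v: "v \<in> L2 S" and S: "S \<in> sets lebesgue" and u: "u \<in> borel_measurable (lebesgue_on S)"
    and B: "B \<ge> 0" and le: "\<And>x. x \<in> S \<Longrightarrow> norm (u x) \<le> B * norm (v x)"
  shows "u \<in> L2 S" and "L2_norm S u \<le> B * L2_norm S v"
proof -
  have sq: "(norm (u x))\<^sup>2 \<le> B\<^sup>2 * (norm (v x))\<^sup>2" if "x \<in> S" for x
    using power_mono[OF le[OF that], of 2] by (simp add: power_mult_distrib)
  have int: "integrable (lebesgue_on S) (\<lambda>x. B\<^sup>2 * (norm (v x))\<^sup>2)"
    by (intro integrable_mult_right L2_integrable_sq v)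
  have iu: "integrable (lebesgue_on S) (\<lambda>x. (norm (u x))\<^sup>2)"
    by (rule Bochner_Integration.integrable_bound[OF int])
      (use u sq in \<open>auto intro!: AE_I2 simp: space_restrict_space\<close>)
  then show "u \<in> L2 S" using u by (simp add: L2_def)
  have "(\<integral>x. (norm (u x))\<^sup>2 \<partial>(lebesgue_on S)) \<le> (\<integral>x. B\<^sup>2 * (norm (v x))\<^sup>2 \<partial>(lebesgue_on S))"
    using iu int sq by (intro integral_mono) (auto simp: space_restrict_space)
  then have "L2_norm S u \<le> sqrt (B\<^sup>2 * (\<integral>x. (norm (v x))\<^sup>2 \<partial>(lebesgue_on S)))"
    unfolding L2_norm_def by (intro real_sqrt_le_mono) simp
  then show "L2_norm S u \<le> B * L2_norm S v" using B by (simp add: L2_norm_def real_sqrt_mult)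
qed

lemma L2_component:
  assumes v: "v \<in> L2 S" and S: "S \<in> sets lebesgue" and i: "i \<in> Basis"
  shows "(\<lambda>x. v x \<bullet> i) \<in> L2 S" and "L2_norm S (\<lambda>x. v x \<bullet> i) \<le> L2_norm S v"
proof -
  have m: "(\<lambda>x. v x \<bullet> i) \<in> borel_measurable (lebesgue_on S)" using L2_measurable[OF v] by auto
  have b: "norm (v x \<bullet> i) \<le> 1 * norm (v x)" for x using Basis_le_norm[OF i, of "v x"] by simp
  show "(\<lambda>x. v x \<bullet> i) \<in> L2 S" by (rule L2_norm_mono(1)[OF v S m zero_le_one b])
  show "L2_norm S (\<lambda>x. v x \<bullet> i) \<le> L2_norm S v" using L2_norm_mono(2)[OF v S m zero_le_one b] by simp
qed

lemma L2_inner_cong_AE: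
  assumes "u \<in> L2 S" "u' \<in> L2 S" "v \<in> L2 S" "v' \<in> L2 S" "ae_eq S u u'" "ae_eq S v v'"
  shows "L2_inner S u v = L2_inner S u' v'"
  unfolding L2_inner_def
proof (rule integral_cong_AE)
  show "AE x in lebesgue_on S. u x \<bullet> v x = u' x \<bullet> v' x"
    using assms(5,6) unfolding ae_eq_def by eventually_elim simp
qed (use assms in \<open>auto intro: L2_measurable borel_measurable_inner\<close>)

lemma L2_inner_tendsto:
  assumes X: "\<And>n. X n \<in> L2 S" and u: "u \<in> L2 S" and w: "w \<in> L2 S"
    and lim: "(\<lambda>n. L2_norm S (\<lambda>x. X n x - u x)) \<longlonglongrightarrow> 0"
  shows "(\<lambda>n. L2_inner S (X n) w) \<longlonglongrightarrow> L2_inner S u w"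
proof (rule LIM_zero_cancel, rule Lim_null_comparison)
  have "norm (L2_inner S (X n) w - L2_inner S u w) \<le> L2_norm S (\<lambda>x. X n x - u x) * L2_norm S w" for n
  proof -
    have "L2_inner S (X n) w - L2_inner S u w = L2_inner S (\<lambda>x. X n x - u x) w"
      using L2.lin[OF X u w, of n "-1"] by simp
    then show ?thesis using L2_cauchy_schwarz[OF L2_diff[OF X u] w] by simp
  qed
  then show "\<forall>\<^sub>F n in sequentially. norm (L2_inner S (X n) w - L2_inner S u w) \<le> L2_norm S (\<lambda>x. X n x - u x) * L2_norm S w"
    by simp
  show "(\<lambda>n. L2_norm S (\<lambda>x. X n x - u x) * L2_norm S w) \<longlonglongrightarrow> 0"
    using tendsto_mult_right[OF lim, of "L2_norm S w"] by simp
qed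

text \<open>As identities between L2 inner products, integrations by parts inherit bilinearity and
  continuity.\<close>

lemma has_weak_gradient_alt:
  "has_weak_gradient S u g \<longleftrightarrow> (\<forall>\<eta>\<in>test_functions S. \<forall>i\<in>Basis.
    L2_inner S u (\<lambda>x. frechet_derivative \<eta> (at x) i) = - L2_inner S (\<lambda>x. g x \<bullet> i) \<eta>)"
  by (simp add: has_weak_gradient_def L2_inner_def)

definition H1_inner :: "real \<Rightarrow> 'a::euclidean_space set \<Rightarrow> ('a \<Rightarrow> real) \<Rightarrow> ('a \<Rightarrow> real) \<Rightarrow> real" where
  "H1_inner l S u v = L2_inner S u v + l\<^sup>2 * L2_inner S (wgrad S u) (wgrad S v)"

locale bounded_domain =
  fixes S :: "'a::euclidean_space set"
  assumes open_S: "open S" and bounded_S: "bounded S"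
begin

lemma S_lmeasurable: "S \<in> lmeasurable"
  by (rule lmeasurable_open[OF bounded_S open_S])

lemma S_sets: "S \<in> sets lebesgue"
  using S_lmeasurable by auto

lemma test_L2: "\<eta> \<in> test_functions S \<Longrightarrow> \<eta> \<in> L2 S"
  by (rule test_bounded[of \<eta> S], assumption, rule L2_bounded[OF S_lmeasurable test_measurable_on]) auto

lemma L2_orthogonal_test_zero:
  assumes u: "u \<in> L2 S" and "\<And>\<eta>. \<eta> \<in> test_functions S \<Longrightarrow> L2_inner S u \<eta> = (0::real)"
  shows "ae_eq S u (\<lambda>x. 0)"
  using assms(2) by (intro fundamental_lemma open_S L2_imp_integrable(1)[OF S_lmeasurable u])
    (simp add: L2_inner_def)

lemma weak_gradient_comb:
  assumes u: "u \<in> L2 S" "g \<in> L2 S" "has_weak_gradient S u g"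
    and v: "v \<in> L2 S" "h \<in> L2 S" "has_weak_gradient S v h"
  shows "has_weak_gradient S (\<lambda>x. u x + c * v x) (\<lambda>x. g x + c *\<^sub>R h x)"
  unfolding has_weak_gradient_alt
proof (intro ballI)
  fix \<eta> and i :: 'a assume \<eta>: "\<eta> \<in> test_functions S" and i: "i \<in> Basis"
  let ?D = "\<lambda>x. frechet_derivative \<eta> (at x) i"
  have "L2_inner S (\<lambda>x. u x + c * v x) ?D = L2_inner S u ?D + c * L2_inner S v ?D"
    using L2.lin[OF u(1) v(1) test_L2[OF test_deriv[OF \<eta> i]], of c] by simp
  moreover have "L2_inner S (\<lambda>x. (g x + c *\<^sub>R h x) \<bullet> i) \<eta> = L2_inner S (\<lambda>x. g x \<bullet> i) \<eta> + c * L2_inner S (\<lambda>x. h x \<bullet> i) \<eta>"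
    using L2.lin[OF L2_component(1)[OF u(2) S_sets i] L2_component(1)[OF v(2) S_sets i] test_L2[OF \<eta>], of c]
    by (simp add: inner_left_distrib)
  ultimately show "L2_inner S (\<lambda>x. u x + c * v x) ?D = - L2_inner S (\<lambda>x. (g x + c *\<^sub>R h x) \<bullet> i) \<eta>"
    using u(3) v(3) \<eta> i by (simp add: has_weak_gradient_alt algebra_simps)
qed

text \<open>Each component of the difference is orthogonal to all test functions. This is what makes
  the choice in \<open>wgrad\<close> harmless.\<close>

lemma weak_gradient_unique:
  assumes g: "g \<in> L2 S" "has_weak_gradient S u g" and h: "h \<in> L2 S" "has_weak_gradient S u h"
  shows "ae_eq S g h"
proof -
  have "ae_eq S (\<lambda>x. g x \<bullet> i - h x \<bullet> i) (\<lambda>x. 0)" if i: "i \<in> Basis" for i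
  proof (rule L2_orthogonal_test_zero)
    note gi = L2_component(1)[OF g(1) S_sets i] and hi = L2_component(1)[OF h(1) S_sets i]
    show "(\<lambda>x. g x \<bullet> i - h x \<bullet> i) \<in> L2 S" by (rule L2_diff[OF gi hi])
    fix \<eta> assume \<eta>: "\<eta> \<in> test_functions S"
    have "L2_inner S (\<lambda>x. g x \<bullet> i - h x \<bullet> i) \<eta> = L2_inner S (\<lambda>x. g x \<bullet> i) \<eta> - L2_inner S (\<lambda>x. h x \<bullet> i) \<eta>"
      using L2.lin[OF gi hi test_L2[OF \<eta>], of "-1"] by simp
    then show "L2_inner S (\<lambda>x. g x \<bullet> i - h x \<bullet> i) \<eta> = 0"
      using g(2) h(2) \<eta> i by (simp add: has_weak_gradient_alt)
  qed
  then have "AE x in lebesgue_on S. \<forall>i\<in>Basis. g x \<bullet> i - h x \<bullet> i = 0"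
    unfolding ae_eq_def by (intro AE_finite_allI) auto
  then show ?thesis unfolding ae_eq_def by eventually_elim (auto intro: euclidean_eqI)
qed

lemma H1_L2: "u \<in> H1 S \<Longrightarrow> u \<in> L2 S"
  by (simp add: H1_def)

lemma H1I: "u \<in> L2 S \<Longrightarrow> g \<in> L2 S \<Longrightarrow> has_weak_gradient S u g \<Longrightarrow> u \<in> H1 S"
  by (auto simp: H1_def)

lemma wgrad:
  assumes "u \<in> H1 S"
  shows wgrad_L2: "wgrad S u \<in> L2 S" and wgrad_weak: "has_weak_gradient S u (wgrad S u)"
proof -
  have "\<exists>g. g \<in> L2 S \<and> has_weak_gradient S u g" using assms by (simp add: H1_def)
  from someI_ex[OF this] show "wgrad S u \<in> L2 S" "has_weak_gradient S u (wgrad S u)"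
    by (auto simp: wgrad_def)
qed

lemma wgrad_ae_eq:
  assumes "u \<in> L2 S" "g \<in> L2 S" "has_weak_gradient S u g"
  shows "ae_eq S (wgrad S u) g"
  using weak_gradient_unique wgrad[OF H1I[OF assms]] assms(2,3) by blast

text \<open>\<open>wgrad\<close> of a combination is chosen afresh, so its linearity holds only
  almost everywhere; under inner products it becomes an equation.\<close>

lemma H1_comb:
  assumes "u \<in> H1 S" "v \<in> H1 S"
  shows "(\<lambda>x. u x + c * v x) \<in> H1 S"
    and wgrad_comb: "ae_eq S (wgrad S (\<lambda>x. u x + c * v x)) (\<lambda>x. wgrad S u x + c *\<^sub>R wgrad S v x)"
proof -
  note * = weak_gradient_comb[OF H1_L2[OF assms(1)] wgrad[OF assms(1)] H1_L2[OF assms(2)] wgrad[OF assms(2)], of c]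
  have 1: "(\<lambda>x. u x + c * v x) \<in> L2 S"
    using L2_comb[OF H1_L2[OF assms(1)] H1_L2[OF assms(2)], of c] by simp
  have 2: "(\<lambda>x. wgrad S u x + c *\<^sub>R wgrad S v x) \<in> L2 S"
    by (intro L2_comb wgrad_L2 assms)
  show "(\<lambda>x. u x + c * v x) \<in> H1 S" by (rule H1I[OF 1 2 *])
  show "ae_eq S (wgrad S (\<lambda>x. u x + c * v x)) (\<lambda>x. wgrad S u x + c *\<^sub>R wgrad S v x)"
    by (rule wgrad_ae_eq[OF 1 2 *])
qed

lemma L2_inner_wgrad_comb:
  assumes "u \<in> H1 S" "v \<in> H1 S" "g \<in> L2 S"
  shows "L2_inner S (wgrad S (\<lambda>x. u x + c * v x)) g = L2_inner S (wgrad S u) g + c * L2_inner S (wgrad S v) g"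
proof -
  have "L2_inner S (wgrad S (\<lambda>x. u x + c * v x)) g = L2_inner S (\<lambda>x. wgrad S u x + c *\<^sub>R wgrad S v x) g"
    by (intro L2_inner_cong_AE wgrad_L2 H1_comb L2_comb assms) (simp add: ae_eq_def)
  then show ?thesis using L2.lin[OF wgrad_L2[OF assms(1)] wgrad_L2[OF assms(2)] assms(3)] by simp
qed

lemma H1_diff:
  assumes "u \<in> H1 S" "v \<in> H1 S" shows "(\<lambda>x. u x - v x) \<in> H1 S"
  using H1_comb(1)[OF assms, of "-1"] by simp

lemma wgrad_diff:
  assumes "u \<in> H1 S" "v \<in> H1 S"
  shows "ae_eq S (wgrad S (\<lambda>x. u x - v x)) (\<lambda>x. wgrad S u x - wgrad S v x)"
  using wgrad_comb[OF assms, of "-1"] by simp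

lemma L2_norm_wgrad_diff:
  assumes "u \<in> H1 S" "v \<in> H1 S"
  shows "L2_norm S (wgrad S (\<lambda>x. u x - v x)) = L2_norm S (\<lambda>x. wgrad S u x - wgrad S v x)"
  by (intro L2_norm_cong_AE wgrad_diff wgrad_L2 H1_diff L2_diff assms)

sublocale H1: semi_inner "H1 S" "\<lambda>c u v x. u x + c * v x" "H1_inner l S" for l
proof
  fix u v w :: "'a \<Rightarrow> real" and c :: real
  assume u: "u \<in> H1 S" and v: "v \<in> H1 S"
  show "(\<lambda>x. u x + c * v x) \<in> H1 S" by (rule H1_comb(1)[OF u v])
  show "H1_inner l S u v = H1_inner l S v u"
    using L2.sym[OF H1_L2[OF u] H1_L2[OF v]] L2.sym[OF wgrad_L2[OF u] wgrad_L2[OF v]] by (simp add: H1_inner_def)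
  assume w: "w \<in> H1 S"
  show "H1_inner l S (\<lambda>x. u x + c * v x) w = H1_inner l S u w + c * H1_inner l S v w"
    using L2_inner_wgrad_comb[OF u v wgrad_L2[OF w], of c] L2.lin[OF H1_L2[OF u] H1_L2[OF v] H1_L2[OF w], of c]
    by (simp add: H1_inner_def algebra_simps)
next
  fix u :: "'a \<Rightarrow> real" assume u: "u \<in> H1 S"
  show "0 \<le> H1_inner l S u u"
    using L2.nonneg[OF H1_L2[OF u]] L2.nonneg[OF wgrad_L2[OF u]] by (simp add: H1_inner_def)
qed

lemma H1_nrm: "H1.nrm l u = H1_norm l S u"
  by (simp add: H1.nrm_def H1_norm_def H1_inner_def L2_norm_sq)

lemmas H1_norm_comb_le = H1.nrm_comb_le[unfolded H1_nrm]

lemma H1_norm_nonneg [simp]: "0 \<le> H1_norm l S u"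
  by (simp add: H1_norm_def)

text \<open>This bound and the two that follow separate the value and gradient parts of the norm, so
  that the weights \<open>1\<close>, \<open>l\<close> and \<open>L\<close> can be exchanged at the
  price of a constant.\<close>

lemma L2_norm_le_H1_norm: "L2_norm S u \<le> H1_norm l S u"
  unfolding H1_norm_def by (rule real_le_rsqrt) simp

lemma grad_le_H1_norm: "0 \<le> l \<Longrightarrow> l * L2_norm S (wgrad S u) \<le> H1_norm l S u"
  unfolding H1_norm_def by (rule real_le_rsqrt) (simp add: power_mult_distrib)

lemma H1_norm_le: "0 \<le> l \<Longrightarrow> H1_norm l S u \<le> L2_norm S u + l * L2_norm S (wgrad S u)"
  unfolding H1_norm_def by (rule real_le_lsqrt) (auto simp: power2_sum power_mult_distrib)

text \<open>The classical gradient is a weak one: for test functions \<open>\<eta>\<close> and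
  \<open>\<zeta>\<close> the product is a test function, so the integral of its derivative vanishes,
  and the product rule gives the integration by parts.\<close>

lemma test_H1:
  assumes \<eta>: "\<eta> \<in> test_functions S"
  shows "\<eta> \<in> H1 S"
    and wgrad_test: "ae_eq S (wgrad S \<eta>) (\<lambda>x. \<Sum>i\<in>Basis. frechet_derivative \<eta> (at x) i *\<^sub>R i)"
proof -
  let ?g = "\<lambda>x. \<Sum>i\<in>Basis. frechet_derivative \<eta> (at x) i *\<^sub>R i"
  have gi: "?g x \<bullet> j = frechet_derivative \<eta> (at x) j" if "j \<in> Basis" for x j
    using that by (simp add: inner_sum_left inner_Basis if_distrib cong: if_cong)
  have "(\<lambda>x. \<Sum>i\<in>I. frechet_derivative \<eta> (at x) i *\<^sub>R i) \<in> L2 S" if "finite I" "I \<subseteq> Basis" for I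
    using that
  proof (induction I rule: finite_induct)
    case (insert j I)
    have j: "j \<in> Basis" using insert by auto
    have D: "(\<lambda>x. frechet_derivative \<eta> (at x) j) \<in> L2 S" by (rule test_L2[OF test_deriv[OF \<eta> j]])
    have "(\<lambda>x. frechet_derivative \<eta> (at x) j *\<^sub>R j) \<in> L2 S"
      by (rule L2_norm_mono(1)[OF D S_sets, of _ 1]) (use L2_measurable[OF D] j in auto)
    from L2_comb[OF this, of "\<lambda>x. \<Sum>i\<in>I. frechet_derivative \<eta> (at x) i *\<^sub>R i" 1] insert
    show ?case by simp
  qed simp
  then have gL: "?g \<in> L2 S" by auto
  have w: "has_weak_gradient S \<eta> ?g"
    unfolding has_weak_gradient_alt
  proof (intro ballI)
    fix \<zeta> and i :: 'a assume \<zeta>: "\<zeta> \<in> test_functions S" and i: "i \<in> Basis"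
    have p: "(\<lambda>x. \<eta> x * \<zeta> x) \<in> test_functions S" by (rule test_mult[OF \<zeta> test_smooth[OF \<eta>]])
    have D: "frechet_derivative (\<lambda>x. \<eta> x * \<zeta> x) (at x) = (\<lambda>h. \<eta> x * frechet_derivative \<zeta> (at x) h
        + frechet_derivative \<eta> (at x) h * \<zeta> x)" for x
      by (rule frechet_derivative_at[symmetric]) (intro has_derivative_mult test_has_derivative[OF \<eta>] test_has_derivative[OF \<zeta>])
    have "0 = (\<integral>x. frechet_derivative (\<lambda>x. \<eta> x * \<zeta> x) (at x) i \<partial>(lebesgue_on S))"
      using test_integral_on[OF test_deriv[OF p i] S_sets] test_integral_deriv[OF p i] by simp
    also have "\<dots> = L2_inner S \<eta> (\<lambda>x. frechet_derivative \<zeta> (at x) i) + L2_inner S (\<lambda>x. frechet_derivative \<eta> (at x) i) \<zeta>"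
      using L2_inner_integrable[OF test_L2[OF \<eta>] test_L2[OF test_deriv[OF \<zeta> i]]]
        L2_inner_integrable[OF test_L2[OF test_deriv[OF \<eta> i]] test_L2[OF \<zeta>]]
      by (simp add: D L2_inner_def)
    finally show "L2_inner S \<eta> (\<lambda>x. frechet_derivative \<zeta> (at x) i) = - L2_inner S (\<lambda>x. ?g x \<bullet> i) \<zeta>"
      by (simp add: gi[OF i])
  qed
  show "\<eta> \<in> H1 S" by (rule H1I[OF test_L2[OF \<eta>] gL w])
  show "ae_eq S (wgrad S \<eta>) ?g" by (rule wgrad_ae_eq[OF test_L2[OF \<eta>] gL w])
qed

text \<open>For a fixed test function both sides of the integration by parts are continuous in L2,
  so the graph of the weak gradient is closed.\<close>

lemma weak_gradient_limit:
  assumes X: "\<And>n. X n \<in> L2 S" "\<And>n. G n \<in> L2 S" "\<And>n. has_weak_gradient S (X n) (G n)"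
    and u: "u \<in> L2 S" "g \<in> L2 S"
    and lim: "(\<lambda>n. L2_norm S (\<lambda>x. X n x - u x)) \<longlonglongrightarrow> 0" "(\<lambda>n. L2_norm S (\<lambda>x. G n x - g x)) \<longlonglongrightarrow> 0"
  shows "has_weak_gradient S u g"
  unfolding has_weak_gradient_alt
proof (intro ballI)
  fix \<eta> and i :: 'a assume \<eta>: "\<eta> \<in> test_functions S" and i: "i \<in> Basis"
  let ?D = "\<lambda>x. frechet_derivative \<eta> (at x) i"
  have 1: "(\<lambda>n. L2_inner S (X n) ?D) \<longlonglongrightarrow> L2_inner S u ?D"
    by (intro L2_inner_tendsto X u lim test_L2 test_deriv \<eta> i)
  have "(\<lambda>n. L2_norm S (\<lambda>x. G n x \<bullet> i - g x \<bullet> i)) \<longlonglongrightarrow> 0"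
  proof (rule Lim_null_comparison[OF _ lim(2)])
    show "\<forall>\<^sub>F n in sequentially. norm (L2_norm S (\<lambda>x. G n x \<bullet> i - g x \<bullet> i)) \<le> L2_norm S (\<lambda>x. G n x - g x)"
      using L2_component(2)[OF L2_diff[OF X(2) u(2)] S_sets i] by (simp add: inner_diff_left)
  qed
  then have 2: "(\<lambda>n. L2_inner S (\<lambda>x. G n x \<bullet> i) \<eta>) \<longlonglongrightarrow> L2_inner S (\<lambda>x. g x \<bullet> i) \<eta>"
    by (intro L2_inner_tendsto L2_component X u test_L2 \<eta> i S_sets)
  have "L2_inner S (X n) ?D = - L2_inner S (\<lambda>x. G n x \<bullet> i) \<eta>" for n
    using X(3) \<eta> i by (simp add: has_weak_gradient_alt)
  then show "L2_inner S u ?D = - L2_inner S (\<lambda>x. g x \<bullet> i) \<eta>"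
    using LIMSEQ_unique[OF 1] tendsto_minus[OF 2] by simp
qed

text \<open>Values and gradients converge separately in L2; closedness of the weak gradient
  identifies the second limit as the gradient of the first.\<close>

lemma H1_complete:
  assumes X: "\<And>n. X n \<in> H1 S"
    and C: "\<And>e. e > 0 \<Longrightarrow> \<exists>N. \<forall>m\<ge>N. \<forall>n\<ge>N. H1_norm 1 S (\<lambda>x. X m x - X n x) < e"
  shows "\<exists>u\<in>H1 S. (\<lambda>n. H1_norm 1 S (\<lambda>x. X n x - u x)) \<longlonglongrightarrow> 0"
proof -
  have "\<exists>u\<in>L2 S. (\<lambda>n. L2_norm S (\<lambda>x. X n x - u x)) \<longlonglongrightarrow> 0"
  proof (rule L2_complete[OF S_lmeasurable])
    fix e :: real assume "e > 0"
    then obtain N where "\<And>m n. m \<ge> N \<Longrightarrow> n \<ge> N \<Longrightarrow> H1_norm 1 S (\<lambda>x. X m x - X n x) < e"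
      using C by blast
    then have "L2_norm S (\<lambda>x. X m x - X n x) < e" if "m \<ge> N" "n \<ge> N" for m n
      using that L2_norm_le_H1_norm[of "\<lambda>x. X m x - X n x" 1] by (meson le_less_trans)
    then show "\<exists>N. \<forall>m\<ge>N. \<forall>n\<ge>N. L2_norm S (\<lambda>x. X m x - X n x) < e" by blast
  qed (rule H1_L2[OF X])
  then obtain u where u: "u \<in> L2 S" "(\<lambda>n. L2_norm S (\<lambda>x. X n x - u x)) \<longlonglongrightarrow> 0" by blast
  have "\<exists>g\<in>L2 S. (\<lambda>n. L2_norm S (\<lambda>x. wgrad S (X n) x - g x)) \<longlonglongrightarrow> 0"
  proof (rule L2_complete[OF S_lmeasurable])
    fix e :: real assume "e > 0"
    then obtain N where N: "\<And>m n. m \<ge> N \<Longrightarrow> n \<ge> N \<Longrightarrow> H1_norm 1 S (\<lambda>x. X m x - X n x) < e"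
      using C by blast
    have "L2_norm S (\<lambda>x. wgrad S (X m) x - wgrad S (X n) x) < e" if "m \<ge> N" "n \<ge> N" for m n
      using grad_le_H1_norm[of 1 "\<lambda>x. X m x - X n x"] L2_norm_wgrad_diff[OF X[of m] X[of n]] N[OF that] by simp
    then show "\<exists>N. \<forall>m\<ge>N. \<forall>n\<ge>N. L2_norm S (\<lambda>x. wgrad S (X m) x - wgrad S (X n) x) < e"
      by blast
  qed (rule wgrad_L2[OF X])
  then obtain g where g: "g \<in> L2 S" "(\<lambda>n. L2_norm S (\<lambda>x. wgrad S (X n) x - g x)) \<longlonglongrightarrow> 0" by blast
  have w: "has_weak_gradient S u g"
    by (rule weak_gradient_limit[OF H1_L2[OF X] wgrad[OF X] u(1) g(1) u(2) g(2)])
  have uH: "u \<in> H1 S" by (rule H1I[OF u(1) g(1) w])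
  have "L2_norm S (wgrad S (\<lambda>x. X n x - u x)) = L2_norm S (\<lambda>x. wgrad S (X n) x - g x)" for n
  proof (rule L2_norm_cong_AE)
    show "ae_eq S (wgrad S (\<lambda>x. X n x - u x)) (\<lambda>x. wgrad S (X n) x - g x)"
      using wgrad_diff[OF X[of n] uH] wgrad_ae_eq[OF u(1) g(1) w] unfolding ae_eq_def
      by eventually_elim simp
  qed (intro wgrad_L2 H1_diff L2_diff X uH g)+
  then have le: "H1_norm 1 S (\<lambda>x. X n x - u x) \<le> L2_norm S (\<lambda>x. X n x - u x) + L2_norm S (\<lambda>x. wgrad S (X n) x - g x)" for n
    using H1_norm_le[of 1 "\<lambda>x. X n x - u x"] by simp
  have "(\<lambda>n. H1_norm 1 S (\<lambda>x. X n x - u x)) \<longlonglongrightarrow> 0"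
  proof (rule Lim_null_comparison)
    show "\<forall>\<^sub>F n in sequentially. norm (H1_norm 1 S (\<lambda>x. X n x - u x))
        \<le> L2_norm S (\<lambda>x. X n x - u x) + L2_norm S (\<lambda>x. wgrad S (X n) x - g x)"
      using le by simp
    show "(\<lambda>n. L2_norm S (\<lambda>x. X n x - u x) + L2_norm S (\<lambda>x. wgrad S (X n) x - g x)) \<longlonglongrightarrow> 0"
      using tendsto_add[OF u(2) g(2)] by simp
  qed
  with uH show ?thesis by blast
qed

section \<open>Zero boundary values and the Poincare inequality\<close>

lemma H10_H1: "u \<in> H10 S \<Longrightarrow> u \<in> H1 S"
  by (simp add: H10_def)

lemma H10_approx: "u \<in> H10 S \<Longrightarrow> e > 0 \<Longrightarrow> \<exists>\<eta>\<in>test_functions S. H1_norm 1 S (\<lambda>x. u x - \<eta> x) < e"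
  by (simp add: H10_def)

lemma H10_comb:
  assumes u: "u \<in> H10 S" and v: "v \<in> H10 S"
  shows "(\<lambda>x. u x + c * v x) \<in> H10 S"
proof -
  have "\<exists>\<eta>\<in>test_functions S. H1_norm 1 S (\<lambda>x. (u x + c * v x) - \<eta> x) < e" if e: "e > 0" for e
  proof -
    define k where "k = e / (\<bar>c\<bar> + 1)"
    have k: "k > 0" "k * (\<bar>c\<bar> + 1) = e" using e by (auto simp: k_def)
    obtain \<eta> where \<eta>: "\<eta> \<in> test_functions S" "H1_norm 1 S (\<lambda>x. u x - \<eta> x) < k"
      using u k by (auto simp: H10_def)
    obtain \<zeta> where \<zeta>: "\<zeta> \<in> test_functions S" "H1_norm 1 S (\<lambda>x. v x - \<zeta> x) < k"
      using v k by (auto simp: H10_def)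
    have "H1_norm 1 S (\<lambda>x. (u x - \<eta> x) + c * (v x - \<zeta> x)) \<le> H1_norm 1 S (\<lambda>x. u x - \<eta> x) + \<bar>c\<bar> * H1_norm 1 S (\<lambda>x. v x - \<zeta> x)"
      by (intro H1_norm_comb_le H1_diff H10_H1 test_H1 u v \<eta> \<zeta>)
    also have "\<dots> < k + \<bar>c\<bar> * k"
      using \<eta>(2) \<zeta>(2) by (intro add_less_le_mono mult_left_mono) auto
    also have "\<dots> = e" using k by (simp add: algebra_simps)
    finally have "H1_norm 1 S (\<lambda>x. (u x + c * v x) - (\<eta> x + c * \<zeta> x)) < e"
      by (simp add: algebra_simps)
    then show ?thesis using test_comb[OF \<eta>(1) \<zeta>(1), of c] by (intro bexI)
  qed
  then show ?thesis using H1_comb(1)[OF H10_H1[OF u] H10_H1[OF v]] by (simp add: H10_def)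
qed

lemma H10_closed:
  assumes X: "\<And>n. X n \<in> H10 S" and u: "u \<in> H1 S"
    and lim: "(\<lambda>n. H1_norm 1 S (\<lambda>x. X n x - u x)) \<longlonglongrightarrow> 0"
  shows "u \<in> H10 S"
proof -
  have "\<exists>\<eta>\<in>test_functions S. H1_norm 1 S (\<lambda>x. u x - \<eta> x) < e" if e: "e > 0" for e
  proof -
    obtain n where n: "H1_norm 1 S (\<lambda>x. X n x - u x) < e/2"
      using order_tendstoD(2)[OF lim, of "e/2"] e by (auto simp: eventually_sequentially)
    obtain \<eta> where \<eta>: "\<eta> \<in> test_functions S" "H1_norm 1 S (\<lambda>x. X n x - \<eta> x) < e/2"
      using H10_approx[OF X[of n], of "e/2"] e by auto
    have "H1_norm 1 S (\<lambda>x. u x - \<eta> x) \<le> H1_norm 1 S (\<lambda>x. (X n x - \<eta> x) + (-1) * (X n x - u x))"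
      by simp
    also have "\<dots> \<le> H1_norm 1 S (\<lambda>x. X n x - \<eta> x) + \<bar>-1\<bar> * H1_norm 1 S (\<lambda>x. X n x - u x)"
      by (intro H1_norm_comb_le H1_diff H10_H1 test_H1 X u \<eta>)
    finally show ?thesis using n \<eta> by force
  qed
  then show ?thesis using u by (simp add: H10_def)
qed

text \<open>
  From \<open>\<integral> \<partial>\<^sub>i (x\<^sub>i \<eta>\<^sup>2) = 0\<close> one gets \<open>\<integral> \<eta>\<^sup>2 = - 2 \<integral> x\<^sub>i \<eta> \<partial>\<^sub>i \<eta>\<close>.
\<close>

lemma poincare_test:
  obtains C where "C > 0" "\<And>\<eta>. \<eta> \<in> test_functions S \<Longrightarrow> L2_norm S \<eta> \<le> C * L2_norm S (wgrad S \<eta>)"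
proof -
  obtain R where R: "R > 0" "\<And>x. x \<in> S \<Longrightarrow> norm x \<le> R"
    using bounded_S bounded_pos by blast
  obtain i :: 'a where i: "i \<in> Basis" using nonempty_Basis by blast
  have "L2_norm S \<eta> \<le> 2 * R * L2_norm S (wgrad S \<eta>)" if \<eta>: "\<eta> \<in> test_functions S" for \<eta>
  proof -
    let ?D = "\<lambda>x. frechet_derivative \<eta> (at x) i"
    \<comment> \<open>With this \<open>?f\<close> the identity says that the squared norm of
      \<open>\<eta>\<close> is the inner product of \<open>?f\<close> and \<open>?D\<close>. The
      coordinate is at most \<open>R\<close> on \<open>S\<close>, whence the constant
      \<open>2 * R\<close>.\<close>
    let ?f = "\<lambda>x. (-2) * (x \<bullet> i) * \<eta> x"
    have p: "(\<lambda>x. (x \<bullet> i) * (\<eta> x * \<eta> x)) \<in> test_functions S"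
      by (intro test_mult \<eta> test_smooth[OF \<eta>] C_k_inner)
    have ft: "?f \<in> test_functions S" by (intro test_mult \<eta> C_k_mult C_k_const C_k_inner)
    have D: "frechet_derivative (\<lambda>x. (x \<bullet> i) * (\<eta> x * \<eta> x)) (at x) = (\<lambda>h. (x \<bullet> i) * (\<eta> x * frechet_derivative \<eta> (at x) h
        + frechet_derivative \<eta> (at x) h * \<eta> x) + (h \<bullet> i) * (\<eta> x * \<eta> x))" for x
      by (rule frechet_derivative_at[symmetric])
        (intro has_derivative_mult test_has_derivative[OF \<eta>] has_derivative_inner_left has_derivative_ident)
    have "0 = (\<integral>x. frechet_derivative (\<lambda>x. (x \<bullet> i) * (\<eta> x * \<eta> x)) (at x) i \<partial>(lebesgue_on S))"
      using test_integral_on[OF test_deriv[OF p i] S_sets] test_integral_deriv[OF p i] by simp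
    also have "\<dots> = (\<integral>x. \<eta> x \<bullet> \<eta> x - ?f x \<bullet> ?D x \<partial>(lebesgue_on S))"
      unfolding D using i by (simp add: algebra_simps)
    also have "\<dots> = L2_inner S \<eta> \<eta> - L2_inner S ?f ?D"
      unfolding L2_inner_def
      by (intro Bochner_Integration.integral_diff L2_inner_integrable test_L2 \<eta> ft test_deriv i)
    finally have "(L2_norm S \<eta>)\<^sup>2 \<le> L2_norm S ?f * L2_norm S ?D"
      using L2_cauchy_schwarz[OF test_L2[OF ft] test_L2[OF test_deriv[OF \<eta> i]]] by (simp add: L2_norm_sq)
    also have "L2_norm S ?f \<le> (2 * R) * L2_norm S \<eta>"
    proof (rule L2_norm_mono(2)[OF test_L2[OF \<eta>] S_sets test_measurable_on[OF ft]])
      fix x assume "x \<in> S"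
      then have "\<bar>x \<bullet> i\<bar> \<le> R" using R(2)[of x] Basis_le_norm[OF i, of x] by simp
      then show "norm (?f x) \<le> (2 * R) * norm (\<eta> x)" by (simp add: abs_mult mult_right_mono)
    qed (use R in auto)
    then have "L2_norm S ?f * L2_norm S ?D \<le> (2 * R * L2_norm S \<eta>) * L2_norm S ?D"
      by (rule mult_right_mono) simp
    finally have sq: "L2_norm S \<eta> * L2_norm S \<eta> \<le> L2_norm S \<eta> * (2 * R * L2_norm S ?D)"
      by (simp add: power2_eq_square mult_ac)
    \<comment> \<open>One factor of the norm of \<open>\<eta>\<close> is cancelled; if it is 0 there
      is nothing to prove.\<close>
    have le: "L2_norm S \<eta> \<le> 2 * R * L2_norm S ?D"
    proof (cases "L2_norm S \<eta> = 0")
      case False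
      then have "L2_norm S \<eta> > 0" using L2_norm_nonneg[of S \<eta>] by linarith
      then show ?thesis using sq by (simp only: mult_le_cancel_left_pos)
    qed (use R in auto)
    have "ae_eq S ?D (\<lambda>x. wgrad S \<eta> x \<bullet> i)"
      using wgrad_test[OF \<eta>] unfolding ae_eq_def
      by eventually_elim (use i in \<open>simp add: inner_sum_left inner_Basis if_distrib cong: if_cong\<close>)
    then have "L2_norm S ?D = L2_norm S (\<lambda>x. wgrad S \<eta> x \<bullet> i)"
      by (intro L2_norm_cong_AE test_L2 test_deriv L2_component(1) wgrad_L2 test_H1(1) \<eta> i S_sets)
    also have "\<dots> \<le> L2_norm S (wgrad S \<eta>)"
      by (intro L2_component(2) wgrad_L2 test_H1(1) \<eta> i S_sets)
    finally have "2 * R * L2_norm S ?D \<le> 2 * R * L2_norm S (wgrad S \<eta>)" using R by simp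
    with le show ?thesis by linarith
  qed
  then show ?thesis using that[of "2 * R"] R by simp
qed

text \<open>Both sides are continuous in the H1 norm, and test functions are dense in
  \<open>H10 S\<close> by definition.\<close>

theorem poincare:
  obtains C where "C > 0" "\<And>u. u \<in> H10 S \<Longrightarrow> L2_norm S u \<le> C * L2_norm S (wgrad S u)"
proof -
  obtain C where C: "C > 0" "\<And>\<eta>. \<eta> \<in> test_functions S \<Longrightarrow> L2_norm S \<eta> \<le> C * L2_norm S (wgrad S \<eta>)"
    using poincare_test by blast
  have "L2_norm S u \<le> C * L2_norm S (wgrad S u)" if u: "u \<in> H10 S" for u
  proof (rule field_le_epsilon)
    fix e :: real assume e: "e > 0"
    \<comment> \<open>Replacing \<open>u\<close> by \<open>\<eta>\<close> costs \<open>k\<close> on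
      the left and \<open>C * k\<close> on the right.\<close>
    define k where "k = e / (C + 1)"
    have k: "k > 0" "k * (C + 1) = e" using e C by (auto simp: k_def)
    obtain \<eta> where \<eta>: "\<eta> \<in> test_functions S" "H1_norm 1 S (\<lambda>x. u x - \<eta> x) < k"
      using u k by (auto simp: H10_def)
    note uH = H10_H1[OF u] and \<eta>H = test_H1(1)[OF \<eta>(1)]
    have "\<bar>L2_norm S u - L2_norm S \<eta>\<bar> \<le> L2_norm S (\<lambda>x. u x - \<eta> x)"
      using L2_norm_comb_ge[OF H1_L2[OF uH] H1_L2[OF \<eta>H]] by simp
    then have 1: "L2_norm S u \<le> L2_norm S \<eta> + k"
      using L2_norm_le_H1_norm[of "\<lambda>x. u x - \<eta> x" 1] \<eta>(2) by linarith
    have "\<bar>L2_norm S (wgrad S u) - L2_norm S (wgrad S \<eta>)\<bar> \<le> L2_norm S (\<lambda>x. wgrad S u x - wgrad S \<eta> x)"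
      using L2_norm_comb_ge[OF wgrad_L2[OF uH] wgrad_L2[OF \<eta>H]] by simp
    then have "L2_norm S (wgrad S \<eta>) \<le> L2_norm S (wgrad S u) + k"
      using grad_le_H1_norm[of 1 "\<lambda>x. u x - \<eta> x"] \<eta>(2) L2_norm_wgrad_diff[OF uH \<eta>H] by simp
    then have "C * L2_norm S (wgrad S \<eta>) \<le> C * (L2_norm S (wgrad S u) + k)"
      using C(1) by simp
    with 1 C(2)[OF \<eta>(1)] have "L2_norm S u \<le> C * (L2_norm S (wgrad S u) + k) + k" by linarith
    also have "\<dots> = C * L2_norm S (wgrad S u) + k * (C + 1)" by (simp add: algebra_simps)
    finally show "L2_norm S u \<le> C * L2_norm S (wgrad S u) + e" using k by simp
  qed
  then show ?thesis using that C(1) by blast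
qed

lemma test_H10:
  assumes "\<eta> \<in> test_functions S"
  shows "\<eta> \<in> H10 S"
proof -
  have "H1_norm 1 S (\<lambda>x. \<eta> x - \<eta> x) = 0"
    using H1.nrm_comb_same[OF test_H1(1)[OF assms], of 1 "-1"] by (simp add: H1_nrm)
  then have "\<exists>\<zeta>\<in>test_functions S. H1_norm 1 S (\<lambda>x. \<eta> x - \<zeta> x) < e" if "e > 0" for e
    using assms that by (intro bexI[of _ \<eta>]) auto
  then show ?thesis using test_H1(1)[OF assms] by (simp add: H10_def)
qed

section \<open>Averages over subsets\<close>

lemma L2_subset:
  assumes u: "u \<in> L2 S" and B: "B \<in> sets lebesgue" "B \<subseteq> S"
  shows "u \<in> L2 B" and "L2_norm B u \<le> L2_norm S u"
proof -
  have iS: "integrable lebesgue (\<lambda>x. indicator S x *\<^sub>R (norm (u x))\<^sup>2)"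
    using L2_integrable_sq[OF u] S_sets by (subst (asm) integrable_restrict_space) auto
  have eq: "(\<lambda>x. indicator B x *\<^sub>R indicator S x *\<^sub>R (norm (u x))\<^sup>2) = (\<lambda>x. indicator B x *\<^sub>R (norm (u x))\<^sup>2)"
    using B(2) by (intro ext) (auto simp: indicator_def)
  have iB: "integrable lebesgue (\<lambda>x. indicator B x *\<^sub>R (norm (u x))\<^sup>2)"
    using integrable_mult_indicator[OF B(1) iS] unfolding eq .
  have "u \<in> borel_measurable (lebesgue_on B)"
    using L2_measurable[OF u] B(2) by (rule measurable_restrict_mono)
  then show "u \<in> L2 B" using iB B(1) by (simp add: L2_def integrable_restrict_space)
  have "(\<integral>x. (norm (u x))\<^sup>2 \<partial>(lebesgue_on B)) = (\<integral>x. indicator B x *\<^sub>R (norm (u x))\<^sup>2 \<partial>lebesgue)"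
    using B(1) by (intro integral_restrict_space) simp
  also have "\<dots> \<le> (\<integral>x. indicator S x *\<^sub>R (norm (u x))\<^sup>2 \<partial>lebesgue)"
    using B(2) by (intro integral_mono iB iS) (auto simp: indicator_def)
  also have "\<dots> = (\<integral>x. (norm (u x))\<^sup>2 \<partial>(lebesgue_on S))"
    using S_sets by (intro integral_restrict_space[symmetric]) simp
  finally show "L2_norm B u \<le> L2_norm S u" by (simp add: L2_norm_def)
qed

lemma mean_over_comb:
  assumes u: "u \<in> L2 S" and v: "v \<in> L2 S" and B: "B \<in> sets lebesgue" "B \<subseteq> S"
  shows "mean_over B (\<lambda>x. u x + c * v x) = mean_over B u + c * mean_over B v"
proof -
  have Bm: "B \<in> lmeasurable" using bounded_subset[OF bounded_S B(2)] B(1) by (rule bounded_set_imp_lmeasurable)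
  show ?thesis
    using L2_imp_integrable(1)[OF Bm L2_subset(1)[OF u B]] L2_imp_integrable(1)[OF Bm L2_subset(1)[OF v B]]
    by (simp add: mean_over_def add_divide_distrib)
qed

text \<open>Cauchy-Schwarz against the constant 1 on \<open>B\<close>. For positive measure the
  factor is the measure to the power -1/2.\<close>

lemma mean_over_bound:
  assumes u: "u \<in> L2 S" and B: "B \<in> sets lebesgue" "B \<subseteq> S"
  shows "\<bar>mean_over B u\<bar> \<le> sqrt (measure lebesgue B) / measure lebesgue B * L2_norm S u"
proof -
  have Bm: "B \<in> lmeasurable" using bounded_subset[OF bounded_S B(2)] B(1) by (rule bounded_set_imp_lmeasurable)
  have "\<bar>\<integral>x. u x \<partial>(lebesgue_on B)\<bar> \<le> (\<integral>x. norm (u x) \<partial>(lebesgue_on B))"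
    using integral_abs_bound[of "lebesgue_on B" u] by simp
  also have "\<dots> \<le> sqrt (measure lebesgue B) * L2_norm B u"
    by (rule L2_imp_integrable(2)[OF Bm L2_subset(1)[OF u B]])
  also have "\<dots> \<le> sqrt (measure lebesgue B) * L2_norm S u"
    using L2_subset(2)[OF u B] by (intro mult_left_mono) auto
  finally have "\<bar>\<integral>x. u x \<partial>(lebesgue_on B)\<bar> / measure lebesgue B \<le> sqrt (measure lebesgue B) * L2_norm S u / measure lebesgue B"
    by (intro divide_right_mono) auto
  then show ?thesis by (simp add: mean_over_def abs_divide)
qed

end

section \<open>Sobolev functions on an interval\<close>

locale interval_domain =
  fixes L :: real
  assumes L_pos: "L > 0"

sublocale interval_domain \<subseteq> bounded_domain "{0<..<L}"
  by unfold_locales auto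

context interval_domain
begin

abbreviation "I \<equiv> {0<..<L}"

lemma const_L2: "(\<lambda>x. c::real) \<in> L2 I"
  by (rule L2_bounded[OF S_lmeasurable, of _ "\<bar>c\<bar>"]) auto

lemma L2_norm_const: "L2_norm I (\<lambda>x. c::real) = \<bar>c\<bar> * sqrt L"
proof -
  have "(\<integral>x. (norm c)\<^sup>2 \<partial>(lebesgue_on I)) = c\<^sup>2 * L"
    using L_pos by (simp add: measure_restrict_space space_restrict_space)
  then show ?thesis by (simp add: L2_norm_def real_sqrt_mult)
qed

section \<open>Weak derivatives and primitives in one dimension\<close>

text \<open>If every test function integrated to 0, the fundamental lemma would make the constant 1
  vanish almost everywhere; so no bump has to be integrated explicitly.\<close>

lemma test_nonzero_integral:
  obtains \<rho> where "\<rho> \<in> test_functions I" "L2_inner I (\<lambda>x. 1) \<rho> \<noteq> (0::real)"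
proof -
  have "\<exists>\<rho>\<in>test_functions I. L2_inner I (\<lambda>x. 1) \<rho> \<noteq> (0::real)"
  proof (rule ccontr)
    assume "\<not> ?thesis"
    then have "ae_eq I (\<lambda>x. 1::real) (\<lambda>x. 0)" by (intro L2_orthogonal_test_zero const_L2) auto
    then have "L2_norm I (\<lambda>x. 1::real) = L2_norm I (\<lambda>x. 0::real)"
      by (intro L2_norm_cong_AE const_L2)
    then show False using L_pos by (simp add: L2_norm_const)
  qed
  then show ?thesis using that by blast
qed

text \<open>A primitive may be nonzero in the gaps of the support of its integrand, so a whole
  interval is needed to carry it.\<close>

lemma compact_in_subinterval:
  assumes "compact K" "K \<subseteq> I"
  obtains a b where "0 < a" "a \<le> b" "b < L" "K \<subseteq> {a..b}"
proof (cases "K = {}")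
  case True
  then show ?thesis using that[of "L/2" "L/2"] L_pos by auto
next
  case False
  obtain a where a: "a \<in> K" "\<And>x. x \<in> K \<Longrightarrow> a \<le> x" using compact_attains_inf[OF assms(1) False] by blast
  obtain b where b: "b \<in> K" "\<And>x. x \<in> K \<Longrightarrow> x \<le> b" using compact_attains_sup[OF assms(1) False] by blast
  show ?thesis by (rule that[of a b]) (use a b assms(2) in auto)
qed

text \<open>The primitive that vanishes left of the support is constant to its right, and the
  constant is the total integral, which is 0.\<close>

lemma test_primitive:
  assumes \<theta>: "\<theta> \<in> test_functions I" and zero: "(\<integral>x. \<theta> x \<partial>lborel) = 0"
  obtains \<eta> where "\<eta> \<in> test_functions I" "\<And>x. frechet_derivative \<eta> (at x) 1 = \<theta> x"
proof -
  obtain a b where ab: "0 < a" "a \<le> b" "b < L" "closure {x. \<theta> x \<noteq> 0} \<subseteq> {a..b}"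
    using compact_in_subinterval[OF test_compact[OF \<theta>] test_support[OF \<theta>]] by blast
  have out: "\<theta> x = 0" if "x \<notin> {a..b}" for x
    using that ab(4) closure_subset[of "{x. \<theta> x \<noteq> 0}"] by blast
  have cont: "isCont \<theta> x" for x
    using test_continuous[OF \<theta>] by (simp add: continuous_on_eq_continuous_at)
  obtain F where F: "\<And>x. (F has_real_derivative \<theta> x) (at x)"
    using einterval_antiderivative[of "-\<infinity>" "\<infinity>" \<theta>] cont
    by (auto simp: has_real_derivative_iff_has_vector_derivative)
  define \<eta> where "\<eta> x = F x - F a" for x
  have d\<eta>: "(\<eta> has_real_derivative \<theta> x) (at x)" for x
    unfolding \<eta>_def using F by (auto intro!: derivative_eq_intros)
  have le: "\<eta> x = 0" if "x \<le> a" for x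
  proof (cases "x = a")
    case False
    then have "x < a" using that by simp
    then obtain z where "x < z" "z < a" "\<eta> a - \<eta> x = (a - x) * \<theta> z"
      using MVT2[of x a \<eta> \<theta>] d\<eta> by blast
    then show ?thesis using out[of z] by (simp add: \<eta>_def)
  qed (simp add: \<eta>_def)
  have "\<eta> b = 0"
  proof -
    have "(\<integral>x. \<theta> x * indicator {a..b} x \<partial>lborel) = \<eta> b - \<eta> a"
      using ab(2) d\<eta> cont by (intro integral_FTC_Icc_real) auto
    moreover have "(\<lambda>x. \<theta> x * indicator {a..b} x) = \<theta>"
      using out by (intro ext) (auto simp: indicator_def)
    ultimately show ?thesis using zero by (simp add: \<eta>_def)
  qed
  moreover have "\<eta> x = \<eta> b" if x: "x > b" for x
  proof -
    obtain z where "b < z" "z < x" "\<eta> x - \<eta> b = (x - b) * \<theta> z"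
      using MVT2[of b x \<eta> \<theta>, OF x d\<eta>] by blast
    then show ?thesis using out[of z] by simp
  qed
  ultimately have out\<eta>: "\<eta> x = 0" if "x \<notin> {a..b}" for x
    using le[of x] that by (cases "x \<le> a") auto
  have "\<eta> \<in> test_functions I"
  proof (rule testI[where K = "{a..b}"])
    show "C_k k \<eta>" for k
      by (rule C_k_Suc_imp, rule C_k_SucI_real[OF d\<eta> test_smooth[OF \<theta>]])
  qed (use ab out\<eta> in auto)
  moreover have "frechet_derivative \<eta> (at x) 1 = \<theta> x" for x
    using frechet_derivative_at[OF d\<eta>[of x, unfolded has_field_derivative_def]] by (metis mult_1_right)
  ultimately show ?thesis using that by blast
qed

text \<open>
  Subtracting a multiple of a fixed test function \<open>\<rho>\<close> makes any test function a derivative of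
  a test function.
\<close>

lemma du_bois_reymond:
  assumes w: "w \<in> L2 I"
    and orth: "\<And>\<eta>. \<eta> \<in> test_functions I \<Longrightarrow> L2_inner I w (\<lambda>x. frechet_derivative \<eta> (at x) 1) = 0"
  obtains c :: real where "ae_eq I w (\<lambda>x. c)"
proof -
  obtain \<rho> where \<rho>: "\<rho> \<in> test_functions I" "L2_inner I (\<lambda>x. 1) \<rho> \<noteq> (0::real)"
    by (rule test_nonzero_integral)
  let ?m = "L2_inner I (\<lambda>x. 1) \<rho>"
  \<comment> \<open>The only candidate: it is the value that \<open>w = c\<close> would force when
    tested against \<open>\<rho>\<close>.\<close>
  define c where "c = L2_inner I w \<rho> / ?m"
  have "ae_eq I (\<lambda>x. w x + (-1) *\<^sub>R c) (\<lambda>x. 0)"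
  proof (rule L2_orthogonal_test_zero)
    show "(\<lambda>x. w x + (-1) *\<^sub>R c) \<in> L2 I" by (rule L2_comb[OF w const_L2])
    fix \<zeta> assume \<zeta>: "\<zeta> \<in> test_functions I"
    let ?k = "- L2_inner I (\<lambda>x. 1) \<zeta> / ?m"
    let ?t = "\<lambda>x. \<zeta> x + ?k * \<rho> x"
    have t: "?t \<in> test_functions I" by (rule test_comb[OF \<zeta> \<rho>(1)])
    have lin: "L2_inner I v ?t = L2_inner I v \<zeta> + ?k * L2_inner I v \<rho>" if "v \<in> L2 I" for v
      using L2.lin_right[OF test_L2[OF \<zeta>] test_L2[OF \<rho>(1)] that, of ?k] by simp
    have "(\<integral>x. ?t x \<partial>lborel) = L2_inner I (\<lambda>x. 1) ?t"
      using test_integral_on[OF t S_sets] by (simp add: L2_inner_def)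
    also have "\<dots> = 0" unfolding lin[OF const_L2] using \<rho>(2) by simp
    finally obtain \<eta> where \<eta>: "\<eta> \<in> test_functions I" "\<And>x. frechet_derivative \<eta> (at x) 1 = ?t x"
      using test_primitive[OF t] by blast
    have "0 = L2_inner I w ?t" using orth[OF \<eta>(1)] \<eta>(2) by simp
    also have "\<dots> = L2_inner I w \<zeta> - c * L2_inner I (\<lambda>x. 1) \<zeta>" unfolding lin[OF w] by (simp add: c_def)
    also have "c * L2_inner I (\<lambda>x. 1) \<zeta> = L2_inner I (\<lambda>x. c) \<zeta>" by (simp add: L2_inner_def)
    finally show "L2_inner I (\<lambda>x. w x + (-1) *\<^sub>R c) \<zeta> = 0"
      using L2.lin[OF w const_L2[of c] test_L2[OF \<zeta>], of "-1"] by simp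
  qed
  then have "ae_eq I w (\<lambda>x. c)" by (simp add: ae_eq_def)
  then show ?thesis by (rule that)
qed

text \<open>\<open>W\<close> is the indefinite integral of \<open>g\<close> extended by zero. Its
  oscillation is at most the L1 norm of \<open>g\<close>, and exchanging the order of integration
  shows that \<open>g\<close> is its weak derivative.\<close>

lemma primitive_weak_derivative:
  assumes g: "g \<in> L2 I"
  obtains W where "continuous_on UNIV W"
    and "\<And>x y. \<bar>W x - W y\<bar> \<le> sqrt L * L2_norm I g"
    and "\<And>\<eta>. \<eta> \<in> test_functions I \<Longrightarrow> L2_inner I W (\<lambda>x. frechet_derivative \<eta> (at x) 1) = - L2_inner I g \<eta>"
proof -
  have gi: "integrable lebesgue (\<lambda>x. indicator I x *\<^sub>R g x)"
    using L2_imp_integrable(1)[OF S_lmeasurable g] by (subst (asm) integrable_restrict_space) auto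
  have "(\<lambda>x. indicator I x *\<^sub>R g x) \<in> borel_measurable lebesgue" using gi by simp
  \<comment> \<open>A Borel version of the extension, since the Fubini argument takes place on the
    product of two copies of \<open>lborel\<close>.\<close>
  then obtain G where G [measurable]: "G \<in> borel_measurable borel"
    and GL: "AE x in lborel. indicator I x *\<^sub>R g x = G x"
    using completion_ex_borel_measurable_real by force
  have GLc: "AE x in lebesgue. indicator I x *\<^sub>R g x = G x" using GL by (rule AE_completion)
  have Gint: "integrable lborel G"
  proof -
    have "integrable lebesgue G"
      by (rule integrable_cong_AE_imp[OF gi]) (use GLc in \<open>auto intro: measurable_completion elim!: eventually_mono\<close>)
    then show ?thesis by (subst (asm) integrable_completion) auto
  qed
  have to_I: "(\<integral>x. G x * v x \<partial>lborel) = (\<integral>x. g x * v x \<partial>(lebesgue_on I))"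
    if v: "v \<in> borel_measurable borel" for v :: "real \<Rightarrow> real"
  proof -
    have "(\<integral>x. g x * v x \<partial>(lebesgue_on I)) = (\<integral>x. (indicator I x *\<^sub>R g x) * v x \<partial>lebesgue)"
      by (subst integral_restrict_space) (auto simp: mult.assoc)
    also have "\<dots> = (\<integral>x. G x * v x \<partial>lebesgue)"
    proof (rule integral_cong_AE)
      show "AE x in lebesgue. (indicator I x *\<^sub>R g x) * v x = G x * v x"
        using GLc by eventually_elim simp
      show "(\<lambda>x. (indicator I x *\<^sub>R g x) * v x) \<in> borel_measurable lebesgue"
        using gi v by (intro borel_measurable_times) (auto intro: measurable_completion)
      show "(\<lambda>x. G x * v x) \<in> borel_measurable lebesgue"
        using v by (intro measurable_completion) simp
    qed
    also have "\<dots> = (\<integral>x. G x * v x \<partial>lborel)" using v by (intro integral_completion) simp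
    finally show ?thesis by simp
  qed
  have normG: "(\<integral>x. \<bar>G x\<bar> \<partial>lborel) \<le> sqrt L * L2_norm I g"
  proof -
    have "(\<integral>x. \<bar>G x\<bar> \<partial>lborel) = (\<integral>x. \<bar>G x\<bar> \<partial>lebesgue)" by (intro integral_completion[symmetric]) simp
    also have "\<dots> = (\<integral>x. indicator I x *\<^sub>R \<bar>g x\<bar> \<partial>lebesgue)"
    proof (rule integral_cong_AE)
      show "AE x in lebesgue. \<bar>G x\<bar> = indicator I x *\<^sub>R \<bar>g x\<bar>"
        using GLc by eventually_elim (auto simp: indicator_def)
      have "(\<lambda>x. \<bar>indicator I x *\<^sub>R g x\<bar>) \<in> borel_measurable lebesgue" using gi by (intro borel_measurable_abs) auto
      then show "(\<lambda>x. indicator I x *\<^sub>R \<bar>g x\<bar>) \<in> borel_measurable lebesgue" by (simp add: abs_mult)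
    qed (auto intro: measurable_completion)
    also have "\<dots> = (\<integral>x. norm (g x) \<partial>(lebesgue_on I))" by (subst integral_restrict_space) auto
    also have "\<dots> \<le> sqrt L * L2_norm I g" using L2_imp_integrable(2)[OF S_lmeasurable g] L_pos by simp
    finally show ?thesis .
  qed
  define W where "W x = (\<integral>t. indicator {..x} t * G t \<partial>lborel)" for x
  have Wint: "integrable lborel (\<lambda>t. indicator {..x} t * G t)" for x
    using integrable_mult_indicator[OF _ Gint, of "{..x}"] by simp
  have Wdiff: "\<bar>W x - W y\<bar> \<le> sqrt L * L2_norm I g" for x y
  proof -
    have "W x - W y = (\<integral>t. indicator {..x} t * G t - indicator {..y} t * G t \<partial>lborel)"
      unfolding W_def by (rule Bochner_Integration.integral_diff[OF Wint Wint, symmetric])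
    also have "\<bar>\<dots>\<bar> \<le> (\<integral>t. \<bar>indicator {..x} t * G t - indicator {..y} t * G t\<bar> \<partial>lborel)"
      by (rule integral_abs_bound)
    also have "\<dots> \<le> (\<integral>t. \<bar>G t\<bar> \<partial>lborel)"
      using Wint[of x] Wint[of y] Gint by (intro integral_mono) (auto simp: indicator_def)
    finally show ?thesis using normG by linarith
  qed
  have Wcont: "continuous_on UNIV W"
  proof (rule continuous_on_sequentiallyI)
    fix u :: "nat \<Rightarrow> real" and x assume "u \<longlonglongrightarrow> x"
    then have u: "u \<longlonglongrightarrow> x" .
    show "(\<lambda>n. W (u n)) \<longlonglongrightarrow> W x"
      unfolding W_def
    proof (rule integral_dominated_convergence[where w = "\<lambda>t. \<bar>G t\<bar>"])
      show "AE t in lborel. (\<lambda>n. indicator {..u n} t * G t) \<longlonglongrightarrow> indicator {..x} t * G t"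
        using AE_lborel_singleton[of x]
      proof eventually_elim
        case (elim t)
        have "\<forall>\<^sub>F n in sequentially. indicator {..u n} t * G t = indicator {..x} t * G t"
        proof (cases "t < x")
          case True
          show ?thesis by (rule eventually_mono[OF order_tendstoD(1)[OF u True]]) (use True in \<open>auto simp: indicator_def\<close>)
        next
          case False
          then have "x < t" using elim by simp
          show ?thesis by (rule eventually_mono[OF order_tendstoD(2)[OF u \<open>x < t\<close>]]) (use \<open>x < t\<close> in \<open>auto simp: indicator_def\<close>)
        qed
        then show ?case by (rule tendsto_eventually)
      qed
      show "AE t in lborel. norm (indicator {..u n} t * G t) \<le> \<bar>G t\<bar>" for n
        by (auto simp: indicator_def)
    qed (use Gint in auto)
  qed
  have Wm [measurable]: "W \<in> borel_measurable borel"
    using Wcont by (rule borel_measurable_continuous_onI)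
  have weak: "L2_inner I W (\<lambda>x. frechet_derivative \<eta> (at x) 1) = - L2_inner I g \<eta>" if \<eta>: "\<eta> \<in> test_functions I" for \<eta>
  proof -
    let ?D = "\<lambda>x. frechet_derivative \<eta> (at x) 1"
    have Dt: "?D \<in> test_functions I" by (rule test_deriv[OF \<eta>]) simp
    have Dm [measurable]: "?D \<in> borel_measurable borel" by (rule test_measurable[OF Dt])
    have Di: "integrable lborel ?D" by (rule test_integrable[OF Dt])
    have d: "(\<eta> has_real_derivative ?D x) (at x)" for x
    proof -
      note d = test_has_derivative[OF \<eta>, of x]
      have "frechet_derivative \<eta> (at x) h = ?D x * h" for h
        using linear_scale[OF has_derivative_linear[OF d], of h 1] by simp
      then have "frechet_derivative \<eta> (at x) = (*) (?D x)" by (intro ext)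
      with d show ?thesis by (simp add: has_field_derivative_def)
    qed
    have prod: "integrable (lborel \<Otimes>\<^sub>M lborel) (\<lambda>z. ?D (fst z) * G (snd z))"
    proof (rule lborel_pair.Fubini_integrable)
      show "integrable lborel (\<lambda>x. \<integral>y. norm (?D (fst (x, y)) * G (snd (x, y))) \<partial>lborel)"
        using Di by (simp add: abs_mult)
      show "AE x in lborel. integrable lborel (\<lambda>y. ?D (fst (x, y)) * G (snd (x, y)))"
        using Gint by simp
    qed measurable
    \<comment> \<open>Dominated by the product \<open>?D x * G t\<close>, which is integrable
      because each factor is. For measurability the indicator is written as the condition
      \<open>snd z \<le> fst z\<close>.\<close>
    have int: "integrable (lborel \<Otimes>\<^sub>M lborel) (\<lambda>(x, t). ?D x * (indicator {..x} t * G t))"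
    proof (rule Bochner_Integration.integrable_bound[OF prod])
      have "(\<lambda>z::real \<times> real. ?D (fst z) * ((if snd z \<le> fst z then 1 else 0) * G (snd z))) \<in> borel_measurable (lborel \<Otimes>\<^sub>M lborel)"
        by measurable
      then show "(\<lambda>(x, t). ?D x * (indicator {..x} t * G t)) \<in> borel_measurable (lborel \<Otimes>\<^sub>M lborel)"
        by (rule measurable_cong[THEN iffD1, rotated]) (auto simp: indicator_def)
    qed (auto simp: indicator_def abs_mult)
    have "L2_inner I W ?D = (\<integral>x. ?D x * W x \<partial>lebesgue_on I)" by (simp add: L2_inner_def mult.commute)
    also have "\<dots> = (\<integral>x. indicator I x *\<^sub>R (?D x * W x) \<partial>lebesgue)" by (rule integral_restrict_space) simp
    also have "(\<lambda>x. indicator I x *\<^sub>R (?D x * W x)) = (\<lambda>x. ?D x * W x)"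
      using test_zero[OF Dt] by (intro ext) (auto simp: indicator_def)
    also have "(\<integral>x. ?D x * W x \<partial>lebesgue) = (\<integral>x. ?D x * W x \<partial>lborel)" by (intro integral_completion) simp
    also have "\<dots> = (\<integral>x. (\<integral>t. ?D x * (indicator {..x} t * G t) \<partial>lborel) \<partial>lborel)"
      by (simp add: W_def)
    also have "\<dots> = (\<integral>t. (\<integral>x. ?D x * (indicator {..x} t * G t) \<partial>lborel) \<partial>lborel)"
      by (rule lborel_pair.Fubini_integral[symmetric]) (rule int)
    also have "\<dots> = (\<integral>t. G t * (- \<eta> t) \<partial>lborel)"
    proof (rule Bochner_Integration.integral_cong[OF refl])
      fix t :: real
      \<comment> \<open>Integrating the derivative of \<open>\<eta>\<close> from \<open>t\<close> to
        \<open>L\<close> leaves \<open>- \<eta> t\<close>, as \<open>\<eta>\<close> vanishes at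
        \<open>L\<close>. For \<open>t > L\<close> both sides are 0.\<close>
      have "(\<integral>x. ?D x * indicator {t..} x \<partial>lborel) = - \<eta> t"
      proof (cases "t \<le> L")
        case True
        have "(\<integral>x. ?D x * indicator {t..L} x \<partial>lborel) = \<eta> L - \<eta> t"
          using True d test_continuous[OF Dt] by (intro integral_FTC_Icc_real) (auto simp: continuous_on_eq_continuous_at)
        moreover have "(\<lambda>x. ?D x * indicator {t..L} x) = (\<lambda>x. ?D x * indicator {t..} x)"
          using test_zero[OF Dt] by (intro ext) (auto simp: indicator_def)
        ultimately show ?thesis using test_zero[OF \<eta>, of L] by simp
      next
        case False
        then have "(\<lambda>x. ?D x * indicator {t..} x) = (\<lambda>x. 0)"
          using test_zero[OF Dt] by (intro ext) (auto simp: indicator_def)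
        then show ?thesis using test_zero[OF \<eta>, of t] False by simp
      qed
      moreover have "(\<lambda>x. ?D x * (indicator {..x} t * G t)) = (\<lambda>x. (?D x * indicator {t..} x) * G t)"
        by (intro ext) (auto simp: indicator_def)
      ultimately show "(\<integral>x. ?D x * (indicator {..x} t * G t) \<partial>lborel) = G t * (- \<eta> t)" by simp
    qed
    also have "\<dots> = (\<integral>x. g x * (- \<eta> x) \<partial>(lebesgue_on I))"
      using test_measurable[OF \<eta>] by (intro to_I) simp
    finally show ?thesis by (simp add: L2_inner_def)
  qed
  show ?thesis by (rule that[OF Wcont Wdiff weak])
qed

section \<open>Continuous representatives and endpoint values\<close>

lemma continuous_L2:
  assumes "continuous_on {0..L} h"
  shows "h \<in> L2 I"
proof -
  have "compact (h ` {0..L})" using assms by (intro compact_continuous_image) auto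
  then obtain B where B: "B > 0" "\<And>y. y \<in> h ` {0..L} \<Longrightarrow> norm y \<le> B"
    using compact_imp_bounded bounded_pos by metis
  show ?thesis
  proof (rule L2_norm_mono(1)[OF const_L2[of 1] S_sets])
    show "h \<in> borel_measurable (lebesgue_on I)"
      using assms by (intro continuous_imp_measurable_on_sets_lebesgue S_sets) (auto intro: continuous_on_subset)
    show "norm (h x) \<le> B * norm (1::real)" if "x \<in> I" for x using B(2)[of "h x"] that by auto
  qed (use B in auto)
qed

text \<open>The set of interior points with nonzero value is open and null, hence empty; continuity
  carries the zero to the endpoints.\<close>

lemma continuous_ae_zero:
  fixes h :: "real \<Rightarrow> real"
  assumes h: "continuous_on {0..L} h" and ae: "ae_eq I h (\<lambda>x. 0)" and x: "x \<in> {0..L}"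
  shows "h x = 0"
proof -
  let ?U = "{x \<in> I. h x \<noteq> 0}"
  have "continuous_on I h" using h by (rule continuous_on_subset) auto
  then have "open (I \<inter> h -` (- {0}))" by (intro continuous_open_preimage) auto
  then have U: "open ?U" by (simp add: Int_def vimage_def)
  have "AE x in lebesgue. x \<notin> ?U"
    using ae S_sets by (auto simp: ae_eq_def AE_restrict_space_iff elim!: eventually_mono)
  then have "negligible ?U" using U by (simp add: negligible_iff_null_sets AE_iff_null_sets)
  then have "?U = {}" using U open_not_negligible by blast
  then have "\<And>x. x \<in> I \<Longrightarrow> h x = 0" by blast
  moreover have "closure I = {0..L}" using L_pos by (simp add: closure_greaterThanLessThan)
  ultimately show ?thesis using continuous_constant_on_closure[of I h 0 x] h x by simp
qed

text \<open>\<open>\<theta>\<close> and the primitive \<open>W\<close> of its weak derivative have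
  the same weak derivative, so they differ by a constant; the shift preserves the oscillation
  bound.\<close>

lemma H1_representative:
  assumes \<theta>: "\<theta> \<in> H1 I"
  obtains h where "continuous_on {0..L} h" "ae_eq I h \<theta>"
    "\<And>x y. \<bar>h x - h y\<bar> \<le> sqrt L * L2_norm I (wgrad I \<theta>)"
proof -
  note g = wgrad[OF \<theta>]
  obtain W where W: "continuous_on UNIV W"
    "\<And>x y. \<bar>W x - W y\<bar> \<le> sqrt L * L2_norm I (wgrad I \<theta>)"
    "\<And>\<eta>. \<eta> \<in> test_functions I \<Longrightarrow> L2_inner I W (\<lambda>x. frechet_derivative \<eta> (at x) 1) = - L2_inner I (wgrad I \<theta>) \<eta>"
    using primitive_weak_derivative[OF g(1)] by blast
  have WL: "W \<in> L2 I" using W(1) by (intro continuous_L2) (auto intro: continuous_on_subset)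
  obtain c where c: "ae_eq I (\<lambda>x. \<theta> x - W x) (\<lambda>x. c)"
  proof (rule du_bois_reymond[OF L2_diff[OF H1_L2[OF \<theta>] WL]])
    fix \<eta> assume \<eta>: "\<eta> \<in> test_functions I"
    let ?D = "\<lambda>x. frechet_derivative \<eta> (at x) 1"
    have "?D \<in> L2 I" using test_deriv[OF \<eta>, of 1] by (intro test_L2) simp
    then have "L2_inner I (\<lambda>x. \<theta> x - W x) ?D = L2_inner I \<theta> ?D - L2_inner I W ?D"
      using L2.lin[OF H1_L2[OF \<theta>] WL, of ?D "-1"] by simp
    moreover have "L2_inner I \<theta> ?D = - L2_inner I (wgrad I \<theta>) \<eta>"
      using g(2) \<eta> by (simp add: has_weak_gradient_alt)
    ultimately show "L2_inner I (\<lambda>x. \<theta> x - W x) ?D = 0" using W(3)[OF \<eta>] by simp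
  qed
  show ?thesis
  proof (rule that[of "\<lambda>x. W x + c"])
    show "continuous_on {0..L} (\<lambda>x. W x + c)"
      using W(1) by (intro continuous_intros) (auto intro: continuous_on_subset)
    show "ae_eq I (\<lambda>x. W x + c) \<theta>" using c unfolding ae_eq_def by eventually_elim simp
  qed (use W(2) in simp)
qed

lemma cont_rep:
  assumes "\<theta> \<in> H1 I"
  shows cont_rep_continuous: "continuous_on {0..L} (cont_rep L \<theta>)"
    and cont_rep_ae: "ae_eq I (cont_rep L \<theta>) \<theta>"
proof -
  have "\<exists>h. continuous_on {0..L} h \<and> ae_eq I h \<theta>" using H1_representative[OF assms] by metis
  from someI_ex[OF this] show "continuous_on {0..L} (cont_rep L \<theta>)" "ae_eq I (cont_rep L \<theta>) \<theta>"
    by (auto simp: cont_rep_def)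
qed

text \<open>Any continuous representative determines the chosen one on the closed interval.
  Linearity of endpoint values and their computation for affine functions both come from
  here.\<close>

lemma cont_rep_unique:
  assumes \<theta>: "\<theta> \<in> H1 I" and h: "continuous_on {0..L} h" "ae_eq I h \<theta>" and x: "x \<in> {0..L}"
  shows "cont_rep L \<theta> x = h x"
proof -
  have "cont_rep L \<theta> x - h x = 0"
  proof (rule continuous_ae_zero[OF _ _ x])
    show "continuous_on {0..L} (\<lambda>x. cont_rep L \<theta> x - h x)"
      by (intro continuous_intros cont_rep_continuous \<theta> h)
    show "ae_eq I (\<lambda>x. cont_rep L \<theta> x - h x) (\<lambda>x. 0)"
      using cont_rep_ae[OF \<theta>] h(2) unfolding ae_eq_def by eventually_elim simp
  qed
  then show ?thesis by simp
qed

lemma cont_rep_comb: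
  assumes \<theta>: "\<theta> \<in> H1 I" and \<delta>: "\<delta> \<in> H1 I" and x: "x \<in> {0..L}"
  shows "cont_rep L (\<lambda>x. \<theta> x + c * \<delta> x) x = cont_rep L \<theta> x + c * cont_rep L \<delta> x"
proof (rule cont_rep_unique[OF H1_comb(1)[OF \<theta> \<delta>] _ _ x])
  show "continuous_on {0..L} (\<lambda>x. cont_rep L \<theta> x + c * cont_rep L \<delta> x)"
    by (intro continuous_intros cont_rep_continuous \<theta> \<delta>)
  show "ae_eq I (\<lambda>x. cont_rep L \<theta> x + c * cont_rep L \<delta> x) (\<lambda>x. \<theta> x + c * \<delta> x)"
    using cont_rep_ae[OF \<theta>] cont_rep_ae[OF \<delta>] unfolding ae_eq_def by eventually_elim simp
qed

lemma cont_rep_oscillation: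
  assumes \<theta>: "\<theta> \<in> H1 I" and "x \<in> {0..L}" "y \<in> {0..L}"
  shows "\<bar>cont_rep L \<theta> x - cont_rep L \<theta> y\<bar> \<le> sqrt L * L2_norm I (wgrad I \<theta>)"
proof -
  obtain h where h: "continuous_on {0..L} h" "ae_eq I h \<theta>"
    "\<And>x y. \<bar>h x - h y\<bar> \<le> sqrt L * L2_norm I (wgrad I \<theta>)"
    using H1_representative[OF \<theta>] by blast
  show ?thesis using h(3)[of x y] cont_rep_unique[OF \<theta> h(1,2)] assms by simp
qed

lemma L2_norm_cont_rep:
  assumes "\<theta> \<in> H1 I"
  shows "L2_norm I (cont_rep L \<theta>) = L2_norm I \<theta>"
  by (intro L2_norm_cong_AE continuous_L2 cont_rep_continuous cont_rep_ae H1_L2 assms)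

text \<open>Take the L2 norm in \<open>x\<close> of the inequality bounding
  \<open>\<bar>h y\<bar>\<close> by \<open>\<bar>h x\<bar>\<close> plus the oscillation, where
  \<open>h\<close> is the continuous representative; \<open>sqrt L\<close> is the norm of the
  constant 1.\<close>

lemma trace_bound:
  assumes \<theta>: "\<theta> \<in> H1 I" and y: "y \<in> {0..L}"
  shows "sqrt L * \<bar>cont_rep L \<theta> y\<bar> \<le> L2_norm I \<theta> + L * L2_norm I (wgrad I \<theta>)"
proof -
  let ?h = "cont_rep L \<theta>" and ?k = "sqrt L * L2_norm I (wgrad I \<theta>)"
  have hL: "(\<lambda>x. norm (?h x)) \<in> L2 I" by (intro L2_norm_L2 continuous_L2 cont_rep_continuous \<theta>)
  have v: "(\<lambda>x. norm (?h x) + ?k *\<^sub>R 1) \<in> L2 I" by (intro L2_comb hL const_L2)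
  have "L2_norm I (\<lambda>x. ?h y) \<le> 1 * L2_norm I (\<lambda>x. norm (?h x) + ?k *\<^sub>R (1::real))"
  proof (rule L2_norm_mono(2)[OF v S_sets])
    fix x assume "x \<in> I"
    then show "norm (?h y) \<le> 1 * norm (norm (?h x) + ?k *\<^sub>R (1::real))"
      using cont_rep_oscillation[OF \<theta> y, of x] by simp
  qed auto
  also have "L2_norm I (\<lambda>x. norm (?h x) + ?k *\<^sub>R (1::real)) \<le> L2_norm I (\<lambda>x. norm (?h x)) + \<bar>?k\<bar> * L2_norm I (\<lambda>x. 1::real)"
    by (rule L2_norm_comb_le[OF hL const_L2])
  also have "L2_norm I (\<lambda>x. norm (?h x)) = L2_norm I \<theta>"
    using L2_norm_cont_rep[OF \<theta>] by (simp add: L2_norm_def)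
  also have "\<bar>?k\<bar> * L2_norm I (\<lambda>x. 1::real) = L * L2_norm I (wgrad I \<theta>)"
    using L_pos by (simp add: L2_norm_const abs_mult)
  finally show ?thesis by (simp add: L2_norm_const mult.commute)
qed

text \<open>The reverse use of the oscillation bound, and the step in coercivity that recovers
  \<open>\<theta>\<close> from one endpoint value and its derivative.\<close>

lemma L2_norm_le_trace:
  assumes \<theta>: "\<theta> \<in> H1 I"
  shows "L2_norm I \<theta> \<le> sqrt L * \<bar>cont_rep L \<theta> 0\<bar> + L * L2_norm I (wgrad I \<theta>)"
proof -
  let ?h = "cont_rep L \<theta>" and ?k = "sqrt L * L2_norm I (wgrad I \<theta>)"
  have hL: "?h \<in> L2 I" by (intro continuous_L2 cont_rep_continuous \<theta>)
  have "L2_norm I ?h \<le> (\<bar>?h 0\<bar> + ?k) * L2_norm I (\<lambda>x. 1::real)"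
  proof (rule L2_norm_mono(2)[OF const_L2 S_sets L2_measurable[OF hL]])
    fix x assume "x \<in> I"
    then show "norm (?h x) \<le> (\<bar>?h 0\<bar> + ?k) * norm (1::real)"
      using cont_rep_oscillation[OF \<theta>, of x 0] L_pos by simp
  qed (use L_pos in auto)
  also have "\<dots> = sqrt L * \<bar>?h 0\<bar> + (sqrt L * sqrt L) * L2_norm I (wgrad I \<theta>)"
    by (simp add: L2_norm_const algebra_simps)
  finally show ?thesis using L2_norm_cont_rep[OF \<theta>] L_pos by simp
qed

lemma affine_H1:
  shows "(\<lambda>x. \<alpha> + \<beta> * x) \<in> H1 I"
    and "x \<in> {0..L} \<Longrightarrow> cont_rep L (\<lambda>x. \<alpha> + \<beta> * x) x = \<alpha> + \<beta> * x"
proof -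
  let ?f = "\<lambda>x. \<alpha> + \<beta> * x"
  have fc: "continuous_on {0..L} ?f" by (intro continuous_intros)
  have fs: "C_k k ?f" for k by (intro C_k_add C_k_mult C_k_const C_k_ident)
  have w: "has_weak_gradient I ?f (\<lambda>x. \<beta>)"
    unfolding has_weak_gradient_alt
  proof (intro ballI)
    fix \<eta> and i :: real assume \<eta>: "\<eta> \<in> test_functions I" and i: "i \<in> Basis"
    then have i1: "i = 1" by simp
    have p: "(\<lambda>x. ?f x * \<eta> x) \<in> test_functions I" by (rule test_mult[OF \<eta> fs])
    have D: "frechet_derivative (\<lambda>x. ?f x * \<eta> x) (at x) = (\<lambda>h. ?f x * frechet_derivative \<eta> (at x) h + (\<beta> * h) * \<eta> x)" for x
      by (rule frechet_derivative_at[symmetric], rule has_derivative_mult[OF _ test_has_derivative[OF \<eta>]])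
        (auto intro!: derivative_eq_intros)
    have "0 = (\<integral>x. frechet_derivative (\<lambda>x. ?f x * \<eta> x) (at x) i \<partial>(lebesgue_on I))"
      using test_integral_on[OF test_deriv[OF p i] S_sets] test_integral_deriv[OF p i] by simp
    also have "\<dots> = (\<integral>x. ?f x \<bullet> frechet_derivative \<eta> (at x) i + (\<beta> \<bullet> i) \<bullet> \<eta> x \<partial>(lebesgue_on I))"
      unfolding D i1 by simp
    also have "\<dots> = L2_inner I ?f (\<lambda>x. frechet_derivative \<eta> (at x) i) + L2_inner I (\<lambda>x. \<beta> \<bullet> i) \<eta>"
      unfolding L2_inner_def
      by (intro Bochner_Integration.integral_add L2_inner_integrable continuous_L2 fc test_L2 \<eta> test_deriv i const_L2)
    finally show "L2_inner I ?f (\<lambda>x. frechet_derivative \<eta> (at x) i) = - L2_inner I (\<lambda>x. \<beta> \<bullet> i) \<eta>" by simp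
  qed
  show f: "?f \<in> H1 I" by (rule H1I[OF continuous_L2[OF fc] const_L2 w])
  show "x \<in> {0..L} \<Longrightarrow> cont_rep L ?f x = ?f x"
    by (rule cont_rep_unique[OF f fc]) (auto simp: ae_eq_def)
qed

end

section \<open>The coupled problem\<close>

definition pair_comb ::
    "real \<Rightarrow> ('a \<Rightarrow> real) \<times> (real \<Rightarrow> real) \<Rightarrow> ('a \<Rightarrow> real) \<times> (real \<Rightarrow> real) \<Rightarrow> ('a \<Rightarrow> real) \<times> (real \<Rightarrow> real)" where
  "pair_comb c u v = (\<lambda>x. fst u x + c * fst v x, \<lambda>x. snd u x + c * snd v x)"

locale coupled = dom: bounded_domain \<Omega> + itv: interval_domain L
  for \<Omega> :: "'a::euclidean_space set" and L :: real +
  fixes B1 B2 :: "'a set" and l \<kappa> \<kappa>' :: real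
  assumes l_pos: "l > 0" and \<kappa>_pos: "\<kappa> > 0" and \<kappa>'_pos: "\<kappa>' > 0"
    and B1: "B1 \<in> sets lebesgue" "B1 \<subseteq> \<Omega>" and B2: "B2 \<in> sets lebesgue" "B2 \<subseteq> \<Omega>"
begin

abbreviation "I \<equiv> {0<..<L}"
abbreviation "V \<equiv> V_space \<Omega> L"
abbreviation "a \<equiv> form_a \<kappa> \<kappa>' \<Omega> L"

lemma V_iff: "u \<in> V \<longleftrightarrow> fst u \<in> H10 \<Omega> \<and> snd u \<in> H1 I"
  by (cases u) (simp add: V_space_def)

lemma V_D:
  assumes "u \<in> V"
  shows "fst u \<in> H10 \<Omega>" "fst u \<in> H1 \<Omega>" "snd u \<in> H1 I"
  using assms dom.H10_H1 by (auto simp: V_iff)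

lemma pair_comb_V: "u \<in> V \<Longrightarrow> v \<in> V \<Longrightarrow> pair_comb c u v \<in> V"
  by (simp add: V_iff pair_comb_def dom.H10_comb itv.H1_comb(1))

lemma form_a_eq:
  "a u v = \<kappa> * L2_inner \<Omega> (wgrad \<Omega> (fst u)) (wgrad \<Omega> (fst v)) + \<kappa>' * L2_inner I (wgrad I (snd u)) (wgrad I (snd v))"
  by (cases u; cases v) (simp add: form_a_def L2_inner_def)

sublocale energy: semi_inner V pair_comb a
proof
  fix u v w :: "('a \<Rightarrow> real) \<times> (real \<Rightarrow> real)" and c :: real
  assume u: "u \<in> V" and v: "v \<in> V"
  show "pair_comb c u v \<in> V" by (rule pair_comb_V[OF u v])
  show "a u v = a v u"
    unfolding form_a_eq
    using L2.sym[OF dom.wgrad_L2[OF V_D(2)[OF u]] dom.wgrad_L2[OF V_D(2)[OF v]]]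
      L2.sym[OF itv.wgrad_L2[OF V_D(3)[OF u]] itv.wgrad_L2[OF V_D(3)[OF v]]] by simp
  assume w: "w \<in> V"
  show "a (pair_comb c u v) w = a u w + c * a v w"
    unfolding form_a_eq pair_comb_def fst_conv snd_conv
    using dom.L2_inner_wgrad_comb[OF V_D(2)[OF u] V_D(2)[OF v] dom.wgrad_L2[OF V_D(2)[OF w]], of c]
      itv.L2_inner_wgrad_comb[OF V_D(3)[OF u] V_D(3)[OF v] itv.wgrad_L2[OF V_D(3)[OF w]], of c]
    by (simp add: algebra_simps)
next
  fix u :: "('a \<Rightarrow> real) \<times> (real \<Rightarrow> real)" assume u: "u \<in> V"
  show "0 \<le> a u u"
    unfolding form_a_eq
    using L2.nonneg[OF dom.wgrad_L2[OF V_D(2)[OF u]]] L2.nonneg[OF itv.wgrad_L2[OF V_D(3)[OF u]]] \<kappa>_pos \<kappa>'_pos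
    by simp
qed

definition V_inner :: "('a \<Rightarrow> real) \<times> (real \<Rightarrow> real) \<Rightarrow> ('a \<Rightarrow> real) \<times> (real \<Rightarrow> real) \<Rightarrow> real" where
  "V_inner u v = H1_inner l \<Omega> (fst u) (fst v) + l ^ (DIM('a) - 1) * H1_inner L I (snd u) (snd v)"

sublocale V: semi_inner V pair_comb V_inner
proof
  fix u v w :: "('a \<Rightarrow> real) \<times> (real \<Rightarrow> real)" and c :: real
  assume u: "u \<in> V" and v: "v \<in> V"
  show "pair_comb c u v \<in> V" by (rule pair_comb_V[OF u v])
  show "V_inner u v = V_inner v u"
    using dom.H1.sym[OF V_D(2)[OF u] V_D(2)[OF v]] itv.H1.sym[OF V_D(3)[OF u] V_D(3)[OF v]] by (simp add: V_inner_def)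
  assume w: "w \<in> V"
  show "V_inner (pair_comb c u v) w = V_inner u w + c * V_inner v w"
    using dom.H1.lin[OF V_D(2)[OF u] V_D(2)[OF v] V_D(2)[OF w], of l c]
      itv.H1.lin[OF V_D(3)[OF u] V_D(3)[OF v] V_D(3)[OF w], of L c]
    by (simp add: V_inner_def pair_comb_def algebra_simps)
next
  fix u :: "('a \<Rightarrow> real) \<times> (real \<Rightarrow> real)" assume u: "u \<in> V"
  show "0 \<le> V_inner u u"
    using dom.H1.nonneg[OF V_D(2)[OF u]] itv.H1.nonneg[OF V_D(3)[OF u]] l_pos by (simp add: V_inner_def)
qed

lemma V_nrm: "V.nrm u = V_norm l \<Omega> L u"
  by (cases u) (simp add: V.nrm_def V_inner_def V_norm_def H1_norm_def H1_inner_def L2_norm_sq L2.nonneg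
      sum_power2_ge_zero flip: L2_norm_sq)

lemma V_norm_parts:
  "H1_norm l \<Omega> (fst u) \<le> V_norm l \<Omega> L u"
  "sqrt (l ^ (DIM('a) - 1)) * H1_norm L I (snd u) \<le> V_norm l \<Omega> L u"
  "V_norm l \<Omega> L u \<le> H1_norm l \<Omega> (fst u) + sqrt (l ^ (DIM('a) - 1)) * H1_norm L I (snd u)"
proof -
  have p: "0 \<le> l ^ (DIM('a) - 1)" using l_pos by simp
  have sq: "(sqrt (l ^ (DIM('a) - 1)) * t)\<^sup>2 = l ^ (DIM('a) - 1) * t\<^sup>2" for t
    using p by (simp add: power_mult_distrib)
  have V: "V_norm l \<Omega> L u = sqrt ((H1_norm l \<Omega> (fst u))\<^sup>2 + (sqrt (l ^ (DIM('a) - 1)) * H1_norm L I (snd u))\<^sup>2)"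
    by (cases u) (simp only: V_norm_def sq prod.case fst_conv snd_conv)
  show "H1_norm l \<Omega> (fst u) \<le> V_norm l \<Omega> L u" unfolding V by (rule real_le_rsqrt) simp
  show "sqrt (l ^ (DIM('a) - 1)) * H1_norm L I (snd u) \<le> V_norm l \<Omega> L u" unfolding V by (rule real_le_rsqrt) simp
  show "V_norm l \<Omega> L u \<le> H1_norm l \<Omega> (fst u) + sqrt (l ^ (DIM('a) - 1)) * H1_norm L I (snd u)"
    unfolding V by (rule sqrt_add_le_add_sqrt[THEN order_trans]) (use p in auto)
qed

section \<open>The two constraints and their continuity\<close>

definition b1 :: "('a \<Rightarrow> real) \<times> (real \<Rightarrow> real) \<Rightarrow> real" where
  "b1 u = cont_rep L (snd u) 0 - mean_over B1 (fst u)"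

definition b2 :: "('a \<Rightarrow> real) \<times> (real \<Rightarrow> real) \<Rightarrow> real" where
  "b2 u = cont_rep L (snd u) L - mean_over B2 (fst u)"

lemma form_b_eq: "form_b B1 B2 L u \<Gamma> = \<Gamma> $ 1 * b1 u + \<Gamma> $ 2 * b2 u"
  by (cases u) (simp add: form_b_def b1_def b2_def)

lemma b_comb:
  assumes u: "u \<in> V" and v: "v \<in> V"
  shows "b1 (pair_comb c u v) = b1 u + c * b1 v" "b2 (pair_comb c u v) = b2 u + c * b2 v"
  using itv.cont_rep_comb[OF V_D(3)[OF u] V_D(3)[OF v], of _ c] itv.L_pos
    dom.mean_over_comb[OF dom.H1_L2[OF V_D(2)[OF u]] dom.H1_L2[OF V_D(2)[OF v]] B1, of c]
    dom.mean_over_comb[OF dom.H1_L2[OF V_D(2)[OF u]] dom.H1_L2[OF V_D(2)[OF v]] B2, of c]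
  by (simp_all add: b1_def b2_def pair_comb_def algebra_simps)

text \<open>A working norm with unit weights: completeness and \<open>H10\<close> are expressed with
  \<open>H1_norm 1\<close>, so limits and coercivity are handled here, and
  \<open>V_norm_le_V1\<close> leads back to \<open>V_norm\<close>.\<close>

definition V1 :: "('a \<Rightarrow> real) \<times> (real \<Rightarrow> real) \<Rightarrow> real" where
  "V1 u = H1_norm 1 \<Omega> (fst u) + H1_norm 1 I (snd u)"

lemma V1_parts:
  "L2_norm \<Omega> (fst u) \<le> V1 u" "L2_norm \<Omega> (wgrad \<Omega> (fst u)) \<le> V1 u"
  "L2_norm I (snd u) \<le> V1 u" "L2_norm I (wgrad I (snd u)) \<le> V1 u"
  using dom.L2_norm_le_H1_norm[of "fst u" 1] dom.grad_le_H1_norm[of 1 "fst u", OF zero_le_one] dom.H1_norm_nonneg[of 1 "fst u"]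
    itv.L2_norm_le_H1_norm[of "snd u" 1] itv.grad_le_H1_norm[of 1 "snd u", OF zero_le_one] itv.H1_norm_nonneg[of 1 "snd u"]
  unfolding V1_def mult_1_left by linarith+

lemma b_bound:
  obtains C where "C \<ge> 0" "\<And>u. u \<in> V \<Longrightarrow> \<bar>b1 u\<bar> \<le> C * V1 u" "\<And>u. u \<in> V \<Longrightarrow> \<bar>b2 u\<bar> \<le> C * V1 u"
proof -
  define m1 where "m1 = sqrt (measure lebesgue B1) / measure lebesgue B1"
  define m2 where "m2 = sqrt (measure lebesgue B2) / measure lebesgue B2"
  have m: "m1 \<ge> 0" "m2 \<ge> 0" by (auto simp: m1_def m2_def)
  \<comment> \<open>\<open>trace_bound\<close> with both norms replaced by \<open>V1 u\<close>,
    divided by \<open>sqrt L\<close>.\<close>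
  define t where "t = (1 + L) / sqrt L"
  have t: "t \<ge> 0" using itv.L_pos by (simp add: t_def)
  have tr: "\<bar>cont_rep L (snd u) y\<bar> \<le> t * V1 u" if u: "u \<in> V" and y: "y \<in> {0..L}" for u y
  proof -
    have "sqrt L * \<bar>cont_rep L (snd u) y\<bar> \<le> V1 u + L * V1 u"
      using itv.trace_bound[OF V_D(3)[OF u] y] V1_parts(3)[of u] mult_left_mono[OF V1_parts(4)[of u], of L] itv.L_pos by linarith
    then show ?thesis using itv.L_pos by (simp add: t_def field_simps)
  qed
  have mn: "\<bar>mean_over B1 (fst u)\<bar> \<le> m1 * V1 u" "\<bar>mean_over B2 (fst u)\<bar> \<le> m2 * V1 u" if u: "u \<in> V" for u
    using dom.mean_over_bound[OF dom.H1_L2[OF V_D(2)[OF u]] B1] dom.mean_over_bound[OF dom.H1_L2[OF V_D(2)[OF u]] B2]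
      mult_left_mono[OF V1_parts(1)[of u] m(1)] mult_left_mono[OF V1_parts(1)[of u] m(2)]
    unfolding m1_def[symmetric] m2_def[symmetric] by linarith+
  show ?thesis
  proof (rule that[of "t + m1 + m2"])
    show "0 \<le> t + m1 + m2" using t m by simp
    fix u assume u: "u \<in> V"
    have v0: "0 \<le> V1 u" using V1_parts(1)[of u] L2_norm_nonneg order_trans by blast
    have "0 \<le> m1 * V1 u" "0 \<le> m2 * V1 u" using v0 m by auto
    then show "\<bar>b1 u\<bar> \<le> (t + m1 + m2) * V1 u" "\<bar>b2 u\<bar> \<le> (t + m1 + m2) * V1 u"
      using tr[OF u, of 0] tr[OF u, of L] mn[OF u] itv.L_pos unfolding b1_def b2_def distrib_right by auto
  qed
qed

section \<open>Coercivity and completeness on the kernel\<close>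

definition ker_b :: "(('a \<Rightarrow> real) \<times> (real \<Rightarrow> real)) set" where
  "ker_b = {u \<in> V. b1 u = 0 \<and> b2 u = 0}"

lemma ker_b_V: "u \<in> ker_b \<Longrightarrow> u \<in> V"
  by (simp add: ker_b_def)

lemma ker_b_comb: "u \<in> ker_b \<Longrightarrow> v \<in> ker_b \<Longrightarrow> pair_comb c u v \<in> ker_b"
  by (simp add: ker_b_def pair_comb_V b_comb)

text \<open>\<open>nrm\<close> depends on the form only, so \<open>ker.nrm\<close> and
  \<open>energy.nrm\<close> are the same function.\<close>

sublocale ker: semi_inner ker_b pair_comb a
  by unfold_locales
    (auto simp: ker_b_comb ker_b_V energy.lin intro: energy.sym energy.nonneg ker_b_V)

lemma energy_grad:
  assumes u: "u \<in> V"
  shows "sqrt \<kappa> * L2_norm \<Omega> (wgrad \<Omega> (fst u)) \<le> energy.nrm u"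
    and "sqrt \<kappa>' * L2_norm I (wgrad I (snd u)) \<le> energy.nrm u"
    and "energy.nrm u \<le> sqrt \<kappa> * L2_norm \<Omega> (wgrad \<Omega> (fst u)) + sqrt \<kappa>' * L2_norm I (wgrad I (snd u))"
proof -
  have E: "energy.nrm u = sqrt ((sqrt \<kappa> * L2_norm \<Omega> (wgrad \<Omega> (fst u)))\<^sup>2 + (sqrt \<kappa>' * L2_norm I (wgrad I (snd u)))\<^sup>2)"
    using \<kappa>_pos \<kappa>'_pos by (simp add: energy.nrm_def form_a_eq power_mult_distrib L2_norm_sq)
  show "sqrt \<kappa> * L2_norm \<Omega> (wgrad \<Omega> (fst u)) \<le> energy.nrm u" unfolding E by (rule real_le_rsqrt) simp
  show "sqrt \<kappa>' * L2_norm I (wgrad I (snd u)) \<le> energy.nrm u" unfolding E by (rule real_le_rsqrt) simp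
  show "energy.nrm u \<le> sqrt \<kappa> * L2_norm \<Omega> (wgrad \<Omega> (fst u)) + sqrt \<kappa>' * L2_norm I (wgrad I (snd u))"
    unfolding E by (rule sqrt_add_le_add_sqrt[THEN order_trans]) (use \<kappa>_pos \<kappa>'_pos in auto)
qed

lemma coercive:
  obtains D where "D > 0" "\<And>u. u \<in> ker_b \<Longrightarrow> V1 u \<le> D * energy.nrm u"
proof -
  obtain P where P: "P > 0" "\<And>u. u \<in> H10 \<Omega> \<Longrightarrow> L2_norm \<Omega> u \<le> P * L2_norm \<Omega> (wgrad \<Omega> u)"
    using dom.poincare by blast
  define m1 where "m1 = sqrt (measure lebesgue B1) / measure lebesgue B1"
  have m1: "m1 \<ge> 0" by (auto simp: m1_def)
  define p where "p = 1 / sqrt \<kappa>"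
  define q where "q = 1 / sqrt \<kappa>'"
  have pq: "p > 0" "q > 0" using \<kappa>_pos \<kappa>'_pos by (auto simp: p_def q_def)
  \<comment> \<open>\<open>p\<close> and \<open>q\<close> convert energy into gradient norms. The
    first bracket bounds \<open>\<phi>\<close> and its gradient; the second collects the value of
    \<open>\<theta>\<close> at 0 through the mean over \<open>B1\<close>, its oscillation and its
    derivative.\<close>
  define D where "D = (P * p + p) + (sqrt L * m1 * (P * p) + L * q + q)"
  have "V1 u \<le> D * energy.nrm u" if k: "u \<in> ker_b" for u
  proof -
    note u = ker_b_V[OF k]
    have g1: "L2_norm \<Omega> (wgrad \<Omega> (fst u)) \<le> p * energy.nrm u"
      using energy_grad(1)[OF u] \<kappa>_pos by (simp add: p_def field_simps)
    have g2: "L2_norm I (wgrad I (snd u)) \<le> q * energy.nrm u"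
      using energy_grad(2)[OF u] \<kappa>'_pos by (simp add: q_def field_simps)
    have n1: "L2_norm \<Omega> (fst u) \<le> P * (p * energy.nrm u)"
      using P(2)[OF V_D(1)[OF u]] mult_left_mono[OF g1, of P] P(1) by linarith
    have "\<bar>cont_rep L (snd u) 0\<bar> = \<bar>mean_over B1 (fst u)\<bar>" using k by (simp add: ker_b_def b1_def)
    also have "\<dots> \<le> m1 * L2_norm \<Omega> (fst u)"
      unfolding m1_def by (rule dom.mean_over_bound[OF dom.H1_L2[OF V_D(2)[OF u]] B1])
    also have "\<dots> \<le> m1 * (P * (p * energy.nrm u))" using n1 m1 by (rule mult_left_mono)
    finally have "sqrt L * \<bar>cont_rep L (snd u) 0\<bar> \<le> sqrt L * (m1 * (P * (p * energy.nrm u)))"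
      using itv.L_pos by (intro mult_left_mono) auto
    then have "L2_norm I (snd u) \<le> sqrt L * (m1 * (P * (p * energy.nrm u))) + L * (q * energy.nrm u)"
      using itv.L2_norm_le_trace[OF V_D(3)[OF u]] mult_left_mono[OF g2, of L] itv.L_pos by linarith
    then have "V1 u \<le> (P * (p * energy.nrm u) + p * energy.nrm u)
        + (sqrt L * (m1 * (P * (p * energy.nrm u))) + L * (q * energy.nrm u) + q * energy.nrm u)"
      using dom.H1_norm_le[of 1 "fst u"] itv.H1_norm_le[of 1 "snd u"] g1 g2 n1 by (simp add: V1_def)
    also have "\<dots> = D * energy.nrm u" by (simp add: D_def algebra_simps)
    finally show ?thesis .
  qed
  moreover have "D > 0" unfolding D_def using pq P m1 itv.L_pos by (intro add_pos_nonneg) auto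
  ultimately show ?thesis using that by blast
qed

lemma V_norm_le_V1:
  obtains C where "C > 0" "\<And>u. V_norm l \<Omega> L u \<le> C * V1 u"
proof -
  let ?s = "sqrt (l ^ (DIM('a) - 1))"
  have s: "?s \<ge> 0" using l_pos by simp
  have "V_norm l \<Omega> L u \<le> ((1 + l) + ?s * (1 + L)) * V1 u" for u
  proof -
    have "H1_norm l \<Omega> (fst u) \<le> (1 + l) * V1 u"
      using dom.H1_norm_le[of l "fst u"] V1_parts(1)[of u] mult_left_mono[OF V1_parts(2)[of u], of l] l_pos
      unfolding distrib_right mult_1_left by linarith
    moreover have "H1_norm L I (snd u) \<le> (1 + L) * V1 u"
      using itv.H1_norm_le[of L "snd u"] V1_parts(3)[of u] mult_left_mono[OF V1_parts(4)[of u], of L] itv.L_pos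
      unfolding distrib_right mult_1_left by linarith
    then have "?s * H1_norm L I (snd u) \<le> ?s * ((1 + L) * V1 u)" using s by (rule mult_left_mono)
    ultimately have "V_norm l \<Omega> L u \<le> (1 + l) * V1 u + ?s * ((1 + L) * V1 u)" using V_norm_parts(3)[of u] by linarith
    then show ?thesis by (simp only: distrib_right mult.assoc)
  qed
  moreover have "(1 + l) + ?s * (1 + L) > 0" using l_pos itv.L_pos s by (intro add_pos_nonneg) auto
  ultimately show ?thesis using that by blast
qed

lemma V1_tendsto_energy:
  assumes X: "\<And>n. X n \<in> V" and lim: "(\<lambda>n. V1 (X n)) \<longlonglongrightarrow> 0"
  shows "(\<lambda>n. energy.nrm (X n)) \<longlonglongrightarrow> 0"
proof (rule Lim_null_comparison)
  have "energy.nrm (X n) \<le> (sqrt \<kappa> + sqrt \<kappa>') * V1 (X n)" for n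
    using energy_grad(3)[OF X[of n]]
      mult_left_mono[OF V1_parts(2)[of "X n"] real_sqrt_ge_zero[OF less_imp_le[OF \<kappa>_pos]]]
      mult_left_mono[OF V1_parts(4)[of "X n"] real_sqrt_ge_zero[OF less_imp_le[OF \<kappa>'_pos]]]
    unfolding distrib_right by linarith
  then show "\<forall>\<^sub>F n in sequentially. norm (energy.nrm (X n)) \<le> (sqrt \<kappa> + sqrt \<kappa>') * V1 (X n)"
    using X by simp
  show "(\<lambda>n. (sqrt \<kappa> + sqrt \<kappa>') * V1 (X n)) \<longlonglongrightarrow> 0" using tendsto_mult_left[OF lim] by simp
qed

text \<open>Coercivity turns energy-Cauchy into H1-Cauchy in both components. The limit stays in the
  kernel because the constraints are continuous, and H1 convergence implies energy
  convergence.\<close>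

lemma ker_b_complete:
  assumes X: "\<And>n. X n \<in> ker_b"
    and C: "\<And>e. e > 0 \<Longrightarrow> \<exists>N. \<forall>m\<ge>N. \<forall>n\<ge>N. energy.nrm (pair_comb (-1) (X m) (X n)) < e"
  shows "\<exists>u\<in>ker_b. (\<lambda>n. energy.nrm (pair_comb (-1) (X n) u)) \<longlonglongrightarrow> 0"
proof -
  obtain D where D: "D > 0" "\<And>u. u \<in> ker_b \<Longrightarrow> V1 u \<le> D * energy.nrm u" using coercive by blast
  note XV = ker_b_V[OF X]
  have V1_diff: "V1 (pair_comb (-1) u v) = H1_norm 1 \<Omega> (\<lambda>x. fst u x - fst v x) + H1_norm 1 I (\<lambda>x. snd u x - snd v x)" for u v
    by (simp add: V1_def pair_comb_def)
  have C1: "\<exists>N. \<forall>m\<ge>N. \<forall>n\<ge>N. V1 (pair_comb (-1) (X m) (X n)) < e" if e: "e > 0" for e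
  proof -
    obtain N where N: "\<And>m n. m \<ge> N \<Longrightarrow> n \<ge> N \<Longrightarrow> energy.nrm (pair_comb (-1) (X m) (X n)) < e / D"
      using C[of "e / D"] e D(1) by auto
    have "V1 (pair_comb (-1) (X m) (X n)) < e" if "m \<ge> N" "n \<ge> N" for m n
    proof -
      have "V1 (pair_comb (-1) (X m) (X n)) \<le> D * energy.nrm (pair_comb (-1) (X m) (X n))"
        by (intro D(2) ker_b_comb X)
      also have "\<dots> < D * (e / D)" using N[OF that] D(1) by (intro mult_strict_left_mono)
      finally show ?thesis using D(1) by simp
    qed
    then show ?thesis by blast
  qed
  have "\<exists>\<phi>\<in>H1 \<Omega>. (\<lambda>n. H1_norm 1 \<Omega> (\<lambda>x. fst (X n) x - \<phi> x)) \<longlonglongrightarrow> 0"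
  proof (rule dom.H1_complete)
    fix e :: real assume "e > 0"
    then obtain N where N: "\<And>m n. m \<ge> N \<Longrightarrow> n \<ge> N \<Longrightarrow> V1 (pair_comb (-1) (X m) (X n)) < e" using C1 by blast
    have "H1_norm 1 \<Omega> (\<lambda>x. fst (X m) x - fst (X n) x) < e" if "m \<ge> N" "n \<ge> N" for m n
      using N[OF that] itv.H1_norm_nonneg[of 1 "\<lambda>x. snd (X m) x - snd (X n) x"] unfolding V1_diff by linarith
    then show "\<exists>N. \<forall>m\<ge>N. \<forall>n\<ge>N. H1_norm 1 \<Omega> (\<lambda>x. fst (X m) x - fst (X n) x) < e" by blast
  qed (rule V_D(2)[OF XV])
  then obtain \<phi> where \<phi>: "\<phi> \<in> H1 \<Omega>" "(\<lambda>n. H1_norm 1 \<Omega> (\<lambda>x. fst (X n) x - \<phi> x)) \<longlonglongrightarrow> 0" by blast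
  have \<phi>0: "\<phi> \<in> H10 \<Omega>" by (rule dom.H10_closed[OF V_D(1)[OF XV] \<phi>])
  have "\<exists>\<theta>\<in>H1 I. (\<lambda>n. H1_norm 1 I (\<lambda>x. snd (X n) x - \<theta> x)) \<longlonglongrightarrow> 0"
  proof (rule itv.H1_complete)
    fix e :: real assume "e > 0"
    then obtain N where N: "\<And>m n. m \<ge> N \<Longrightarrow> n \<ge> N \<Longrightarrow> V1 (pair_comb (-1) (X m) (X n)) < e" using C1 by blast
    have "H1_norm 1 I (\<lambda>x. snd (X m) x - snd (X n) x) < e" if "m \<ge> N" "n \<ge> N" for m n
      using N[OF that] dom.H1_norm_nonneg[of 1 "\<lambda>x. fst (X m) x - fst (X n) x"] unfolding V1_diff by linarith
    then show "\<exists>N. \<forall>m\<ge>N. \<forall>n\<ge>N. H1_norm 1 I (\<lambda>x. snd (X m) x - snd (X n) x) < e" by blast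
  qed (rule V_D(3)[OF XV])
  then obtain \<theta> where \<theta>: "\<theta> \<in> H1 I" "(\<lambda>n. H1_norm 1 I (\<lambda>x. snd (X n) x - \<theta> x)) \<longlonglongrightarrow> 0" by blast
  let ?u = "(\<phi>, \<theta>)"
  have uV: "?u \<in> V" using \<phi>0 \<theta>(1) by (simp add: V_iff)
  have lim: "(\<lambda>n. V1 (pair_comb (-1) (X n) ?u)) \<longlonglongrightarrow> 0"
    unfolding V1_diff using tendsto_add[OF \<phi>(2) \<theta>(2)] by simp
  obtain c where c: "\<And>u. u \<in> V \<Longrightarrow> \<bar>b1 u\<bar> \<le> c * V1 u" "\<And>u. u \<in> V \<Longrightarrow> \<bar>b2 u\<bar> \<le> c * V1 u"
    using b_bound by metis
  have limc: "(\<lambda>n. c * V1 (pair_comb (-1) (X n) ?u)) \<longlonglongrightarrow> 0" using tendsto_mult_left[OF lim, of c] by simp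
  \<comment> \<open>\<open>X n\<close> satisfies the constraints, so those of the difference are, up
    to sign, those of the limit: a fixed number bounded by a null sequence.\<close>
  have le: "\<bar>b1 ?u\<bar> \<le> c * V1 (pair_comb (-1) (X n) ?u)" "\<bar>b2 ?u\<bar> \<le> c * V1 (pair_comb (-1) (X n) ?u)" for n
    using c[OF pair_comb_V[OF XV[of n] uV], of "-1"] X[of n] unfolding b_comb[OF XV uV] by (simp_all add: ker_b_def)
  have "\<bar>b1 ?u\<bar> \<le> 0" "\<bar>b2 ?u\<bar> \<le> 0"
    using LIMSEQ_le_const[OF limc] le by blast+
  then have "?u \<in> ker_b" using uV by (simp add: ker_b_def)
  moreover have "(\<lambda>n. energy.nrm (pair_comb (-1) (X n) ?u)) \<longlonglongrightarrow> 0"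
    by (rule V1_tendsto_energy[OF pair_comb_V[OF XV uV] lim])
  ultimately show ?thesis by blast
qed

section \<open>Lifting the constraints and solving for given data\<close>

text \<open>
  The affine forms are written so as to match \<open>affine_H1\<close> literally.
\<close>

definition lift0 :: "('a \<Rightarrow> real) \<times> (real \<Rightarrow> real)" where "lift0 = (\<lambda>x. 0, \<lambda>x. 1 + (- 1 / L) * x)"
definition liftL :: "('a \<Rightarrow> real) \<times> (real \<Rightarrow> real)" where "liftL = (\<lambda>x. 0, \<lambda>x. 0 + (1 / L) * x)"

lemma lift:
  "lift0 \<in> V" "b1 lift0 = 1" "b2 lift0 = 0" "liftL \<in> V" "b1 liftL = 0" "b2 liftL = 1"
proof -
  have z: "(\<lambda>x. 0) \<in> H10 \<Omega>" by (rule dom.test_H10[OF test_zero_fun])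
  show "lift0 \<in> V" "liftL \<in> V" unfolding V_iff lift0_def liftL_def fst_conv snd_conv
    using z itv.affine_H1(1) by blast+
  have z: "0 \<in> {0..L}" "L \<in> {0..L}" using itv.L_pos by auto
  show "b1 lift0 = 1"
    unfolding b1_def lift0_def fst_conv snd_conv itv.affine_H1(2)[OF z(1)] using itv.L_pos by (simp add: mean_over_def)
  show "b1 liftL = 0"
    unfolding b1_def liftL_def fst_conv snd_conv itv.affine_H1(2)[OF z(1)] using itv.L_pos by (simp add: mean_over_def)
  show "b2 lift0 = 0"
    unfolding b2_def lift0_def fst_conv snd_conv itv.affine_H1(2)[OF z(2)] using itv.L_pos by (simp add: mean_over_def)
  show "b2 liftL = 1"
    unfolding b2_def liftL_def fst_conv snd_conv itv.affine_H1(2)[OF z(2)] using itv.L_pos by (simp add: mean_over_def)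
qed

lemma zero_ker: "pair_comb (-1) lift0 lift0 \<in> ker_b"
  by (simp add: ker_b_def pair_comb_V lift b_comb)

text \<open>Each lift is invisible to the other constraint, so the coefficients are simply the
  constraint values of \<open>v\<close>.\<close>

lemma project_ker:
  assumes v: "v \<in> V"
  shows "pair_comb (- b2 v) (pair_comb (- b1 v) v lift0) liftL \<in> ker_b"
  by (simp add: ker_b_def pair_comb_V b_comb lift v)

context
  fixes f :: "('a \<Rightarrow> real) \<Rightarrow> real" and r :: "real \<Rightarrow> real"
  assumes f: "f \<in> H_minus1 \<Omega>" and r: "admissible_r L r"
begin

abbreviation "F \<equiv> form_f L f r"

lemma F_eq: "F u = f (fst u) + form_L L r (snd u)"
  by (cases u) (simp add: form_f_def)

lemma F_comb:
  assumes u: "u \<in> V" and v: "v \<in> V"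
  shows "F (pair_comb c u v) = F u + c * F v"
proof -
  have "f (\<lambda>x. fst u x + c * fst v x) = f (fst u) + f (\<lambda>x. c * fst v x)"
  proof -
    \<comment> \<open>Closure of \<open>H10\<close> under scaling, obtained as a combination with
      the zero function.\<close>
    have "(\<lambda>x. 0 + c * fst v x) \<in> H10 \<Omega>"
      by (rule dom.H10_comb[OF dom.test_H10[OF test_zero_fun] V_D(1)[OF v]])
    then show ?thesis using f V_D(1)[OF u] by (simp add: H_minus1_def)
  qed
  also have "f (\<lambda>x. c * fst v x) = c * f (fst v)" using f V_D(1)[OF v] by (simp add: H_minus1_def)
  finally have 1: "f (\<lambda>x. fst u x + c * fst v x) = f (fst u) + c * f (fst v)" .
  have "integrable (lebesgue_on I) (\<lambda>x. r x * snd u x)" "integrable (lebesgue_on I) (\<lambda>x. r x * snd v x)"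
    using r V_D(3)[OF u] V_D(3)[OF v] by (auto simp: admissible_r_def)
  then have "(\<integral>x. r x * snd u x + c * (r x * snd v x) \<partial>(lebesgue_on I)) = form_L L r (snd u) + c * form_L L r (snd v)"
    by (simp add: form_L_def)
  then have 2: "form_L L r (\<lambda>x. snd u x + c * snd v x) = form_L L r (snd u) + c * form_L L r (snd v)"
    by (simp add: form_L_def algebra_simps)
  show ?thesis unfolding F_eq by (simp add: pair_comb_def 1 2 algebra_simps)
qed

text \<open>Makes the supremum in \<open>V_dual_norm\<close> finite. Bounds on \<open>f\<close> are
  given with unit weight, whence \<open>1 + 1 / l\<close>; the division by \<open>?s\<close> undoes
  the weight of the second component in \<open>V_norm\<close>.\<close>

lemma F_bounded: "\<exists>M. \<forall>u\<in>V. \<bar>F u\<bar> \<le> M * V.nrm u"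
proof -
  obtain M1 where M1: "\<And>u. u \<in> H10 \<Omega> \<Longrightarrow> \<bar>f u\<bar> \<le> M1 * H1_norm 1 \<Omega> u"
    using f unfolding H_minus1_def by blast
  obtain M2 where M2: "\<And>\<delta>. \<delta> \<in> H1 I \<Longrightarrow> \<bar>form_L L r \<delta>\<bar> \<le> M2 * H1_norm L I \<delta>"
    using r unfolding admissible_r_def by blast
  let ?s = "sqrt (l ^ (DIM('a) - 1))"
  have s: "?s > 0" using l_pos by simp
  have "\<bar>F u\<bar> \<le> (\<bar>M1\<bar> * (1 + 1 / l) + \<bar>M2\<bar> / ?s) * V.nrm u" if u: "u \<in> V" for u
  proof -
    have "l * L2_norm \<Omega> (wgrad \<Omega> (fst u)) \<le> V_norm l \<Omega> L u"
      using dom.grad_le_H1_norm[of l "fst u"] V_norm_parts(1)[of u] l_pos by simp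
    then have "L2_norm \<Omega> (wgrad \<Omega> (fst u)) \<le> 1 / l * V_norm l \<Omega> L u" using l_pos by (simp add: field_simps)
    then have "H1_norm 1 \<Omega> (fst u) \<le> (1 + 1 / l) * V_norm l \<Omega> L u"
      using dom.H1_norm_le[of 1 "fst u"] dom.L2_norm_le_H1_norm[of "fst u" l] V_norm_parts(1)[of u]
      by (simp add: algebra_simps)
    then have "\<bar>M1\<bar> * H1_norm 1 \<Omega> (fst u) \<le> \<bar>M1\<bar> * ((1 + 1 / l) * V_norm l \<Omega> L u)" by (rule mult_left_mono) simp
    moreover have "M1 * H1_norm 1 \<Omega> (fst u) \<le> \<bar>M1\<bar> * H1_norm 1 \<Omega> (fst u)" by (intro mult_right_mono) auto
    ultimately have 1: "\<bar>f (fst u)\<bar> \<le> \<bar>M1\<bar> * ((1 + 1 / l) * V_norm l \<Omega> L u)"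
      using M1[OF V_D(1)[OF u]] by linarith
    have "H1_norm L I (snd u) \<le> V_norm l \<Omega> L u / ?s"
      using V_norm_parts(2)[of u] s by (simp add: pos_le_divide_eq mult.commute)
    then have "\<bar>M2\<bar> * H1_norm L I (snd u) \<le> \<bar>M2\<bar> * (V_norm l \<Omega> L u / ?s)" by (rule mult_left_mono) simp
    moreover have "M2 * H1_norm L I (snd u) \<le> \<bar>M2\<bar> * H1_norm L I (snd u)" by (intro mult_right_mono) auto
    ultimately have 2: "\<bar>form_L L r (snd u)\<bar> \<le> \<bar>M2\<bar> * (V_norm l \<Omega> L u / ?s)"
      using M2[OF V_D(3)[OF u]] by linarith
    have "\<bar>F u\<bar> \<le> \<bar>M1\<bar> * ((1 + 1 / l) * V_norm l \<Omega> L u) + \<bar>M2\<bar> * (V_norm l \<Omega> L u / ?s)"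
      unfolding F_eq using 1 2 by linarith
    also have "\<dots> = (\<bar>M1\<bar> * (1 + 1 / l) + \<bar>M2\<bar> / ?s) * V_norm l \<Omega> L u"
      by (simp add: algebra_simps)
    finally show ?thesis unfolding V_nrm .
  qed
  then show ?thesis by blast
qed

lemma F_dual:
  shows "0 \<le> V_dual_norm l \<Omega> L F"
    and "u \<in> V \<Longrightarrow> \<bar>F u\<bar> \<le> V_dual_norm l \<Omega> L F * V_norm l \<Omega> L u"
proof -
  obtain M where M: "\<And>u. u \<in> V \<Longrightarrow> \<bar>F u\<bar> \<le> M * V.nrm u" using F_bounded by blast
  show "0 \<le> V_dual_norm l \<Omega> L F"
    using V.dual_bound(1)[of F M lift0, OF F_comb M lift(1)] by (simp add: V_dual_norm_def V_nrm)
  show "u \<in> V \<Longrightarrow> \<bar>F u\<bar> \<le> V_dual_norm l \<Omega> L F * V_norm l \<Omega> L u"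
    using V.dual_bound(2)[of F M u, OF F_comb M] by (simp add: V_dual_norm_def V_nrm)
qed

text \<open>Decouples the system: an equation on the kernel determines the field, and explicit
  formulas give the multipliers, so existence, uniqueness and bounds are proved for the field and
  carried over.\<close>

lemma mixed_solution_iff:
  "mixed_solution \<kappa> \<kappa>' \<Omega> L B1 B2 f r u \<mu> \<longleftrightarrow>
    u \<in> ker_b \<and> (\<forall>v\<in>ker_b. a u v = F v) \<and> \<mu> $ 1 = F lift0 - a u lift0 \<and> \<mu> $ 2 = F liftL - a u liftL"
  (is "?L \<longleftrightarrow> ?R")
proof
  assume L: ?L
  then have u: "u \<in> V" and eq: "\<And>v. v \<in> V \<Longrightarrow> a u v + (\<mu> $ 1 * b1 v + \<mu> $ 2 * b2 v) = F v"
    and z: "\<And>\<Gamma>::real^2. \<Gamma> $ 1 * b1 u + \<Gamma> $ 2 * b2 u = 0"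
    by (auto simp: mixed_solution_def form_b_eq)
  have "b1 u = 0" using z[of "axis 1 1"] by (simp add: axis_def)
  moreover have "b2 u = 0" using z[of "axis 2 1"] by (simp add: axis_def)
  ultimately have "u \<in> ker_b" using u by (simp add: ker_b_def)
  moreover have "a u v = F v" if "v \<in> ker_b" for v using eq[of v] that by (simp add: ker_b_def)
  ultimately show ?R using eq[OF lift(1)] eq[OF lift(4)] lift by simp
next
  assume R: ?R
  then have u: "u \<in> V" by (simp add: ker_b_V)
  have "a u v + form_b B1 B2 L v \<mu> = F v" if v: "v \<in> V" for v
  proof -
    \<comment> \<open>The equation is known on the kernel, so it is used at the projection of an
      arbitrary \<open>v\<close>; expanding linearly brings out the residuals at the lifts.\<close>
    have "a u (pair_comb (- b2 v) (pair_comb (- b1 v) v lift0) liftL)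
        = F (pair_comb (- b2 v) (pair_comb (- b1 v) v lift0) liftL)"
      using R project_ker[OF v] by blast
    then have "a u v - b1 v * a u lift0 - b2 v * a u liftL = F v - b1 v * F lift0 - b2 v * F liftL"
      by (simp add: energy.lin_right F_comb pair_comb_V v u lift)
    moreover have \<mu>: "\<mu> $ 1 = F lift0 - a u lift0" "\<mu> $ 2 = F liftL - a u liftL" using R by auto
    ultimately show ?thesis unfolding form_b_eq \<mu> by (simp add: algebra_simps)
  qed
  then show ?L using R u by (simp add: mixed_solution_def form_b_eq ker_b_def)
qed

lemma mixed_solution_exists: "\<exists>u \<mu>. mixed_solution \<kappa> \<kappa>' \<Omega> L B1 B2 f r u \<mu>"
proof -
  obtain D where D: "D > 0" "\<And>u. u \<in> ker_b \<Longrightarrow> V1 u \<le> D * energy.nrm u" using coercive by blast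
  obtain C where C: "C > 0" "\<And>u. V_norm l \<Omega> L u \<le> C * V1 u" using V_norm_le_V1 by blast
  let ?N = "V_dual_norm l \<Omega> L F"
  have "\<exists>u\<in>ker_b. \<forall>v\<in>ker_b. a u v = F v"
  proof (rule ker.riesz[OF zero_ker])
    fix u v c assume "u \<in> ker_b" "v \<in> ker_b"
    then show "F (pair_comb c u v) = F u + c * F v" by (intro F_comb ker_b_V)
  next
    fix u assume u: "u \<in> ker_b"
    have "V_norm l \<Omega> L u \<le> C * (D * energy.nrm u)"
      using C(2)[of u] mult_left_mono[OF D(2)[OF u], of C] C(1) by linarith
    then have "?N * V_norm l \<Omega> L u \<le> ?N * (C * (D * energy.nrm u))" using F_dual(1) by (rule mult_left_mono)
    then show "\<bar>F u\<bar> \<le> (?N * C * D) * ker.nrm u"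
      using F_dual(2)[OF ker_b_V[OF u]] by (simp add: mult.assoc)
  next
    fix X :: "nat \<Rightarrow> ('a \<Rightarrow> real) \<times> (real \<Rightarrow> real)"
    assume "\<And>n. X n \<in> ker_b" "\<And>e. 0 < e \<Longrightarrow> \<exists>N. \<forall>m\<ge>N. \<forall>n\<ge>N. ker.nrm (pair_comb (- 1) (X m) (X n)) < e"
    then show "\<exists>u\<in>ker_b. (\<lambda>n. ker.nrm (pair_comb (- 1) (X n) u)) \<longlonglongrightarrow> 0"
      by (rule ker_b_complete)
  qed
  then obtain u where "u \<in> ker_b" "\<forall>v\<in>ker_b. a u v = F v" by blast
  then have "mixed_solution \<kappa> \<kappa>' \<Omega> L B1 B2 f r u (vector [F lift0 - a u lift0, F liftL - a u liftL])"
    by (simp add: mixed_solution_iff vector_2)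
  then show ?thesis by blast
qed

lemma mixed_solution_unique:
  assumes s: "mixed_solution \<kappa> \<kappa>' \<Omega> L B1 B2 f r u \<mu>" and s': "mixed_solution \<kappa> \<kappa>' \<Omega> L B1 B2 f r u' \<mu>'"
  shows "ae_eq \<Omega> (fst u') (fst u)" "ae_eq I (snd u') (snd u)" "\<mu>' = \<mu>"
proof -
  obtain D where D: "D > 0" "\<And>u. u \<in> ker_b \<Longrightarrow> V1 u \<le> D * energy.nrm u" using coercive by blast
  have u: "u \<in> ker_b" "\<And>v. v \<in> ker_b \<Longrightarrow> a u v = F v" and u': "u' \<in> ker_b" "\<And>v. v \<in> ker_b \<Longrightarrow> a u' v = F v"
    using s s' by (auto simp: mixed_solution_iff)
  let ?w = "pair_comb (-1) u' u"
  have w: "?w \<in> ker_b" by (rule ker_b_comb[OF u'(1) u(1)])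
  have "a ?w ?w = 0" using ker.lin[OF u'(1) u(1) w, of "-1"] u(2)[OF w] u'(2)[OF w] by simp
  then have e0: "energy.nrm ?w = 0" by (simp add: energy.nrm_def)
  have "V1 ?w \<le> 0" using D(2)[OF w] e0 by simp
  then have n: "L2_norm \<Omega> (\<lambda>x. fst u' x - fst u x) = 0" "L2_norm I (\<lambda>x. snd u' x - snd u x) = 0"
    using V1_parts(1,3)[of ?w] by (auto simp: pair_comb_def intro: antisym)
  note uV = ker_b_V[OF u(1)] and uV' = ker_b_V[OF u'(1)]
  have "ae_eq \<Omega> (\<lambda>x. fst u' x - fst u x) (\<lambda>x. 0)"
    by (rule L2_norm_zero_AE[OF L2_diff[OF dom.H1_L2[OF V_D(2)[OF uV']] dom.H1_L2[OF V_D(2)[OF uV]]] n(1)])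
  then show "ae_eq \<Omega> (fst u') (fst u)" by (simp add: ae_eq_def)
  have "ae_eq I (\<lambda>x. snd u' x - snd u x) (\<lambda>x. 0)"
    by (rule L2_norm_zero_AE[OF L2_diff[OF itv.H1_L2[OF V_D(3)[OF uV']] itv.H1_L2[OF V_D(3)[OF uV]]] n(2)])
  then show "ae_eq I (snd u') (snd u)" by (simp add: ae_eq_def)
  \<comment> \<open>The fields agree only almost everywhere, so they cannot be substituted for each
    other; Cauchy-Schwarz with a difference of zero energy gives the equality needed for the
    multipliers.\<close>
  have "a u' v = a u v" if v: "v \<in> V" for v
    using energy.cauchy_schwarz[OF ker_b_V[OF w] v] e0 energy.lin[OF uV' uV v, of "-1"] by simp
  then show "\<mu>' = \<mu>" using s s' lift by (simp add: mixed_solution_iff vec_eq_iff forall_2)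
qed

end

text \<open>Proved outside the context fixing \<open>f\<close> and \<open>r\<close>, so that
  \<open>C\<close> is chosen before the data.\<close>

lemma mixed_solution_bound:
  obtains C where "C > 0"
    "\<And>f r u \<mu>. f \<in> H_minus1 \<Omega> \<Longrightarrow> admissible_r L r \<Longrightarrow> mixed_solution \<kappa> \<kappa>' \<Omega> L B1 B2 f r u \<mu> \<Longrightarrow>
      V_norm l \<Omega> L u + norm \<mu> \<le> C * V_dual_norm l \<Omega> L (form_f L f r)"
proof -
  obtain D where D: "D > 0" "\<And>u. u \<in> ker_b \<Longrightarrow> V1 u \<le> D * energy.nrm u" using coercive by blast
  obtain C where C: "C > 0" "\<And>u. V_norm l \<Omega> L u \<le> C * V1 u" using V_norm_le_V1 by blast
  define k where "k = C * D"
  have k: "k > 0" using C D by (simp add: k_def)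
  \<comment> \<open>The term \<open>k * k\<close> accounts for the field, one factor from the energy
    bound and one from coercivity; each lift contributes the bound of its multiplier.\<close>
  define R where "R = k * k + (V_norm l \<Omega> L lift0 + k * energy.nrm lift0) + (V_norm l \<Omega> L liftL + k * energy.nrm liftL)"
  have Vn: "V_norm l \<Omega> L u \<ge> 0" for u using V_norm_parts(1)[of u] dom.H1_norm_nonneg[of l "fst u"] by linarith
  have R: "R > 0" unfolding R_def using k Vn lift energy.nrm_nonneg by (intro add_pos_nonneg mult_pos_pos) auto
  have "V_norm l \<Omega> L u + norm \<mu> \<le> R * V_dual_norm l \<Omega> L (form_f L f r)"
    if f: "f \<in> H_minus1 \<Omega>" and r: "admissible_r L r" and s: "mixed_solution \<kappa> \<kappa>' \<Omega> L B1 B2 f r u \<mu>" for f r u \<mu>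
  proof -
    let ?F = "form_f L f r" and ?N = "V_dual_norm l \<Omega> L (form_f L f r)" and ?E = "energy.nrm u"
    note N0 = F_dual(1)[OF f r] and FN = F_dual(2)[OF f r]
    have u: "u \<in> ker_b" "\<And>v. v \<in> ker_b \<Longrightarrow> a u v = ?F v" and \<mu>: "\<mu> $ 1 = ?F lift0 - a u lift0" "\<mu> $ 2 = ?F liftL - a u liftL"
      using s by (auto simp: mixed_solution_iff[OF f r])
    note uV = ker_b_V[OF u(1)]
    have Vk: "V_norm l \<Omega> L u \<le> k * ?E"
      using C(2)[of u] mult_left_mono[OF D(2)[OF u(1)], of C] C(1) unfolding k_def mult.assoc by linarith
    \<comment> \<open>The equation tested with the solution itself, which lies in the kernel; one
      factor of the energy norm is then cancelled.\<close>
    have "?E * ?E = ?F u" using energy.nrm_sq[OF uV] u(2)[OF u(1)] by (simp add: power2_eq_square)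
    also have "\<dots> \<le> ?N * V_norm l \<Omega> L u" using FN[OF uV] by linarith
    also have "\<dots> \<le> ?N * (k * ?E)" using Vk N0 by (rule mult_left_mono)
    finally have EE: "?E * ?E \<le> ?E * (k * ?N)" by (simp add: mult_ac)
    have E: "?E \<le> k * ?N"
    proof (cases "?E = 0")
      case False
      then have "?E > 0" using energy.nrm_nonneg[OF uV] by linarith
      then show ?thesis using EE by (simp only: mult_le_cancel_left_pos)
    qed (use k N0 in simp)
    have m: "\<bar>?F v - a u v\<bar> \<le> (V_norm l \<Omega> L v + k * energy.nrm v) * ?N" if v: "v \<in> V" for v
    proof -
      have "\<bar>a u v\<bar> \<le> ?E * energy.nrm v" by (rule energy.cauchy_schwarz[OF uV v])
      also have "\<dots> \<le> (k * ?N) * energy.nrm v" using E energy.nrm_nonneg[OF v] by (rule mult_right_mono)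
      finally show ?thesis using FN[OF v] by (simp add: algebra_simps)
    qed
    have "norm \<mu> \<le> \<bar>\<mu> $ 1\<bar> + \<bar>\<mu> $ 2\<bar>" using norm_le_l1_cart[of \<mu>] by (simp add: sum_2)
    moreover have "V_norm l \<Omega> L u \<le> k * k * ?N"
      using Vk mult_left_mono[OF E, of k] k unfolding mult.assoc by linarith
    ultimately show ?thesis using m[OF lift(1)] m[OF lift(4)] unfolding \<mu>[symmetric] R_def distrib_right by linarith
  qed
  then show ?thesis using that R by blast
qed

end

theorem mainTheorem1:
  fixes \<Omega> B1 B2 :: "(real^2) set" and l L \<kappa> \<kappa>' :: real
  assumes "open \<Omega>" and "bounded \<Omega>"
    and "l > 0" and "L > 0"
    and "B1 \<in> sets lebesgue" and "B2 \<in> sets lebesgue"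
    and "B1 \<subset> \<Omega>" and "B2 \<subset> \<Omega>" and "B1 \<inter> B2 = {}"
    and "measure lebesgue B1 > 0" and "measure lebesgue B2 > 0"
    and "\<kappa> > 0" and "\<kappa>' > 0"
  shows "(\<forall>f r. f \<in> H_minus1 \<Omega> \<and> admissible_r L r \<longrightarrow>
            (\<exists>\<phi> \<theta> \<mu>. mixed_solution \<kappa> \<kappa>' \<Omega> L B1 B2 f r (\<phi>, \<theta>) \<mu> \<and>
               (\<forall>\<phi>' \<theta>' \<mu>'. mixed_solution \<kappa> \<kappa>' \<Omega> L B1 B2 f r (\<phi>', \<theta>') \<mu>' \<longrightarrow>
                  ae_eq \<Omega> \<phi>' \<phi> \<and> ae_eq {0<..<L} \<theta>' \<theta> \<and> \<mu>' = \<mu>))) \<and>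
         (\<exists>C>0. \<forall>f r. f \<in> H_minus1 \<Omega> \<and> admissible_r L r \<longrightarrow>
            (\<forall>\<phi> \<theta> \<mu>. mixed_solution \<kappa> \<kappa>' \<Omega> L B1 B2 f r (\<phi>, \<theta>) \<mu> \<longrightarrow>
               V_norm l \<Omega> L (\<phi>, \<theta>) + norm \<mu> \<le> C * V_dual_norm l \<Omega> L (form_f L f r)))"
proof -
  interpret coupled \<Omega> L B1 B2 l \<kappa> \<kappa>'
    using assms by unfold_locales auto
  obtain C where C: "C > 0"
    "\<And>f r u \<mu>. f \<in> H_minus1 \<Omega> \<Longrightarrow> admissible_r L r \<Longrightarrow> mixed_solution \<kappa> \<kappa>' \<Omega> L B1 B2 f r u \<mu> \<Longrightarrow>
      V_norm l \<Omega> L u + norm \<mu> \<le> C * V_dual_norm l \<Omega> L (form_f L f r)"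
    using mixed_solution_bound by blast
  show ?thesis
  proof (intro conjI allI impI exI[of _ C])
    fix f r assume "f \<in> H_minus1 \<Omega> \<and> admissible_r L r"
    then have f: "f \<in> H_minus1 \<Omega>" and r: "admissible_r L r" by auto
    obtain \<phi> \<theta> \<mu> where s: "mixed_solution \<kappa> \<kappa>' \<Omega> L B1 B2 f r (\<phi>, \<theta>) \<mu>"
      using mixed_solution_exists[OF f r] by force
    show "\<exists>\<phi> \<theta> \<mu>. mixed_solution \<kappa> \<kappa>' \<Omega> L B1 B2 f r (\<phi>, \<theta>) \<mu> \<and>
        (\<forall>\<phi>' \<theta>' \<mu>'. mixed_solution \<kappa> \<kappa>' \<Omega> L B1 B2 f r (\<phi>', \<theta>') \<mu>' \<longrightarrow>
          ae_eq \<Omega> \<phi>' \<phi> \<and> ae_eq {0<..<L} \<theta>' \<theta> \<and> \<mu>' = \<mu>)"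
      using s mixed_solution_unique[OF f r s] by (metis fst_conv snd_conv)
  qed (use C in auto)
qed

end
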